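(* Let $\mathcal{B}(\Omega)$ be a Bergman-type space with Rudin–Forelli constant $\kappa$, and let $T:\mathcal{B}(\Omega)\to\mathcal{B}(\Omega)$ be a bounded linear operator such that for some $p>\frac{4-\kappa}{2-\kappa}$ $$\sup_{z\in\Omega}\|U_zTk_z\|_{L^p(\Omega;d\sigma)}<\infty\quad\text{and}\quad\sup_{z\in\Omega}\|U_zT^*k_z\|_{L^p(\Omega;d\sigma)}<\infty.$$ Then: (a) $\|T\|_e\simeq\sup_{\|f\|\le1}\limsup_{d(z,0)\to\infty}\|T^zf\|$; (b) if $\lim_{d(z,0)\to\infty}\|Tk_z\|=0$, then $T$ is compact.
   Context: Notation: $A\lesssim B$ means $A\le CB$ for a constant $C$ independent of the relevant variables; $A\simeq B$ means $A\lesssim B$ and $B\lesssim A$. Bergman-type space: $\Omega\subset\mathbb{C}^n$ is a domain containing $0$ such that: (A.1) for each $z\in\Omega$ there is an involutive biholomorphic automorphism $\varphi_z$ of $\Omega$ with $\varphi_z(0)=z$; (A.2) there is a metric $d$ on $\Omega$ with $d(u,v)\simeq d(\varphi_z(u),\varphi_z(v))$ uniformly in $u,v,z$; $(\Omega,d)$ is separable and every closed $d$-ball is compact; $D(z,r)$ denotes the $d$-ball of center $z$ and radius $r$; (A.3) $\sigma$ is a finite Borel measure on $\Omega$, $\mathcal{B}(\Omega)$ is the space of holomorphic functions on $\Omega$ lying in $L^2(\Omega;d\sigma)$ with the $L^2(\sigma)$ norm $\|\cdot\|$ and inner product $\langle\cdot,\cdot\rangle$; $\mathcal{B}(\Omega)$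 is a reproducing kernel Hilbert space with reproducing kernel $K_z$ ($f(z)=\langle f,K_z\rangle$) and normalized kernel $k_z=K_z/\|K_z\|$; $z\mapsto\|K_z\|$ is continuous on $(\Omega,d)$; (A.4) the measure $d\lambda(z):=\|K_z\|^2d\sigma(z)$ satisfies $\lambda(E)\simeq\lambda(\varphi_z(E))$ for Borel $E$, uniformly in $z$, and is doubling: $\lambda(D(z,2r))\le C\lambda(D(z,r))$ for all $z,r>0$; (A.5) $|\langle k_z,k_w\rangle|\simeq 1/\|K_{\varphi_z(w)}\|$ uniformly in $z,w$; (A.6) (Rudin–Forelli estimates) there is a constant $\kappa\in[0,2)$ such that, if $\kappa>0$, for all $r>\kappa>s>0$ one has $\sup_{z\in\Omega}\int_\Omega \frac{|\langle K_z,K_w\rangle|^{(r+s)/2}}{\|K_z\|^s\|K_w\|^r}d\lambda(w)<\infty$, and if $\kappa=0$ this holds for all $r=s>0$; (A.7) $\|K_z\|\to\infty$ as $d(z,0)\to\infty$. Translation operators: $U_zf(w):=f(\varphi_z(w))k_z(w)$, and for an operator $T$ on $\mathcal{B}(\Omega)$, $T^z:=U_zTU_z^*$. The essential norm is $\|T\|_e:=\inf\{\|T-A\|: A \text{ compact on } \mathcal{B}(\Omega)\}$. *)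

theory Defs
  imports "HOL-Analysis.Analysis"
begin

type_synonym 'n pt = "complex ^ 'n"
type_synonym 'n fn = "'n pt \<Rightarrow> complex"

definition cholo_on :: "('n::finite) fn \<Rightarrow> 'n pt set \<Rightarrow> bool" where
  "cholo_on f S \<longleftrightarrow> open S \<and>
     (\<forall>z\<in>S. \<exists>L. (f has_derivative L) (at z) \<and> (\<forall>(c::complex) x. L (c *s x) = c * L x))"

definition holo_map_on :: "('n::finite pt \<Rightarrow> 'n pt) \<Rightarrow> 'n pt set \<Rightarrow> bool" where
  "holo_map_on F S \<longleftrightarrow> (\<forall>i. cholo_on (\<lambda>w. F w $ i) S)"

definition bspace :: "'n::finite pt set \<Rightarrow> 'n pt measure \<Rightarrow> 'n fn set" where
  "bspace \<Omega> \<sigma> = {f. cholo_on f \<Omega> \<and> (\<forall>z. z \<notin> \<Omega> \<longrightarrow> f z = 0) \<and>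
                    f \<in> borel_measurable \<sigma> \<and> integrable \<sigma> (\<lambda>z. (cmod (f z))\<^sup>2)}"

definition ip :: "'n pt measure \<Rightarrow> 'n fn \<Rightarrow> 'n fn \<Rightarrow> complex" where
  "ip \<sigma> f g = (\<integral>z. f z * cnj (g z) \<partial>\<sigma>)"

definition bnorm :: "'n pt measure \<Rightarrow> 'n fn \<Rightarrow> real" where
  "bnorm \<sigma> f = sqrt (\<integral>z. (cmod (f z))\<^sup>2 \<partial>\<sigma>)"

definition kn :: "'n pt measure \<Rightarrow> ('n pt \<Rightarrow> 'n fn) \<Rightarrow> 'n pt \<Rightarrow> 'n fn" where
  "kn \<sigma> K z = (\<lambda>w. K z w / complex_of_real (bnorm \<sigma> (K z)))"

definition lam :: "'n pt measure \<Rightarrow> ('n pt \<Rightarrow> 'n fn) \<Rightarrow> 'n pt measure" where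
  "lam \<sigma> K = density \<sigma> (\<lambda>z. ennreal ((bnorm \<sigma> (K z))\<^sup>2))"

definition rudin_forelli :: "'n pt set \<Rightarrow> 'n pt measure \<Rightarrow> ('n pt \<Rightarrow> 'n fn) \<Rightarrow> real \<Rightarrow> real \<Rightarrow> bool" where
  "rudin_forelli \<Omega> \<sigma> K r s \<longleftrightarrow> (\<exists>C::real. \<forall>z\<in>\<Omega>.
     (\<integral>\<^sup>+ w. ennreal (cmod (ip \<sigma> (K z) (K w)) powr ((r + s) / 2) /
                 (bnorm \<sigma> (K z) powr s * bnorm \<sigma> (K w) powr r)) \<partial>(lam \<sigma> K)) \<le> ennreal C)"

definition bergman_type ::
  "'n::finite pt set \<Rightarrow> ('n pt \<Rightarrow> 'n pt \<Rightarrow> real) \<Rightarrow> 'n pt measure \<Rightarrow>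
   ('n pt \<Rightarrow> 'n pt \<Rightarrow> 'n pt) \<Rightarrow> ('n pt \<Rightarrow> 'n fn) \<Rightarrow> real \<Rightarrow> bool" where
  "bergman_type \<Omega> d \<sigma> \<phi> K \<kappa> \<longleftrightarrow>
     \<comment> \<open>domain containing 0\<close>
     open \<Omega> \<and> connected \<Omega> \<and> 0 \<in> \<Omega> \<and>
     \<comment> \<open>(A.1) involutive biholomorphic automorphisms\<close>
     (\<forall>z\<in>\<Omega>. \<phi> z ` \<Omega> \<subseteq> \<Omega> \<and> holo_map_on (\<phi> z) \<Omega> \<and>
              (\<forall>w\<in>\<Omega>. \<phi> z (\<phi> z w) = w) \<and> \<phi> z 0 = z) \<and>
     \<comment> \<open>(A.2) the metric d\<close>
     Metric_space \<Omega> d \<and>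
     (\<exists>C>0. \<forall>u\<in>\<Omega>. \<forall>v\<in>\<Omega>. \<forall>z\<in>\<Omega>.
         d u v \<le> C * d (\<phi> z u) (\<phi> z v) \<and> d (\<phi> z u) (\<phi> z v) \<le> C * d u v) \<and>
     separable_space (Metric_space.mtopology \<Omega> d) \<and>
     (\<forall>z\<in>\<Omega>. \<forall>r. compactin (Metric_space.mtopology \<Omega> d) (Metric_space.mcball \<Omega> d z r)) \<and>
     \<comment> \<open>(A.3) finite Borel measure, reproducing kernel Hilbert space\<close>
     sets \<sigma> = sets (restrict_space borel \<Omega>) \<and> finite_measure \<sigma> \<and>
     (\<forall>z\<in>\<Omega>. K z \<in> bspace \<Omega> \<sigma> \<and> (\<forall>f\<in>bspace \<Omega> \<sigma>. f z = ip \<sigma> f (K z))) \<and>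
     (\<forall>X. (\<forall>n. X n \<in> bspace \<Omega> \<sigma>) \<and>
          (\<forall>e>0. \<exists>N. \<forall>m\<ge>N. \<forall>n\<ge>N. bnorm \<sigma> (\<lambda>w. X m w - X n w) < e) \<longrightarrow>
          (\<exists>g\<in>bspace \<Omega> \<sigma>. (\<lambda>n. bnorm \<sigma> (\<lambda>w. X n w - g w)) \<longlonglongrightarrow> 0)) \<and>
     continuous_map (Metric_space.mtopology \<Omega> d) euclideanreal (\<lambda>z. bnorm \<sigma> (K z)) \<and>
     \<comment> \<open>(A.4) quasi-invariance and doubling of lambda (d-balls are Borel)\<close>
     (\<exists>C>0. \<forall>z\<in>\<Omega>. \<forall>E\<in>sets \<sigma>.
         emeasure (lam \<sigma> K) E \<le> ennreal C * emeasure (lam \<sigma> K) (\<phi> z ` E) \<and>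
         emeasure (lam \<sigma> K) (\<phi> z ` E) \<le> ennreal C * emeasure (lam \<sigma> K) E) \<and>
     (\<forall>z\<in>\<Omega>. \<forall>r. Metric_space.mball \<Omega> d z r \<in> sets \<sigma>) \<and>
     (\<exists>C. \<forall>z\<in>\<Omega>. \<forall>r>0.
         emeasure (lam \<sigma> K) (Metric_space.mball \<Omega> d z (2 * r))
           \<le> ennreal C * emeasure (lam \<sigma> K) (Metric_space.mball \<Omega> d z r)) \<and>
     \<comment> \<open>(A.5)\<close>
     (\<exists>C>0. \<forall>z\<in>\<Omega>. \<forall>w\<in>\<Omega>.
         cmod (ip \<sigma> (kn \<sigma> K z) (kn \<sigma> K w)) \<le> C * (1 / bnorm \<sigma> (K (\<phi> z w))) \<and>
         1 / bnorm \<sigma> (K (\<phi> z w)) \<le> C * cmod (ip \<sigma> (kn \<sigma> K z) (kn \<sigma> K w))) \<and>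
     \<comment> \<open>(A.6) Rudin--Forelli estimates with constant kappa\<close>
     0 \<le> \<kappa> \<and> \<kappa> < 2 \<and>
     (\<kappa> > 0 \<longrightarrow> (\<forall>r s. \<kappa> < r \<and> 0 < s \<and> s < \<kappa> \<longrightarrow> rudin_forelli \<Omega> \<sigma> K r s)) \<and>
     (\<kappa> = 0 \<longrightarrow> (\<forall>r>0. rudin_forelli \<Omega> \<sigma> K r r)) \<and>
     \<comment> \<open>(A.7)\<close>
     (\<forall>M. \<exists>R. \<forall>z\<in>\<Omega>. d z 0 > R \<longrightarrow> bnorm \<sigma> (K z) > M)"

definition bounded_op :: "'n::finite pt set \<Rightarrow> 'n pt measure \<Rightarrow> ('n fn \<Rightarrow> 'n fn) \<Rightarrow> bool" where
  "bounded_op \<Omega> \<sigma> A \<longleftrightarrow>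
     (\<forall>f\<in>bspace \<Omega> \<sigma>. A f \<in> bspace \<Omega> \<sigma>) \<and>
     (\<forall>f\<in>bspace \<Omega> \<sigma>. \<forall>g\<in>bspace \<Omega> \<sigma>. A (\<lambda>w. f w + g w) = (\<lambda>w. A f w + A g w)) \<and>
     (\<forall>f\<in>bspace \<Omega> \<sigma>. \<forall>c. A (\<lambda>w. c * f w) = (\<lambda>w. c * A f w)) \<and>
     (\<exists>C. \<forall>f\<in>bspace \<Omega> \<sigma>. bnorm \<sigma> (A f) \<le> C * bnorm \<sigma> f)"

definition compact_op :: "'n::finite pt set \<Rightarrow> 'n pt measure \<Rightarrow> ('n fn \<Rightarrow> 'n fn) \<Rightarrow> bool" where
  "compact_op \<Omega> \<sigma> A \<longleftrightarrow> bounded_op \<Omega> \<sigma> A \<and>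
     (\<forall>X::nat \<Rightarrow> 'n fn. (\<forall>n. X n \<in> bspace \<Omega> \<sigma> \<and> bnorm \<sigma> (X n) \<le> 1) \<longrightarrow>
        (\<exists>(r::nat \<Rightarrow> nat) g. strict_mono r \<and> g \<in> bspace \<Omega> \<sigma> \<and>
               (\<lambda>n. bnorm \<sigma> (\<lambda>w. A (X (r n)) w - g w)) \<longlonglongrightarrow> 0))"

definition opnorm :: "'n::finite pt set \<Rightarrow> 'n pt measure \<Rightarrow> ('n fn \<Rightarrow> 'n fn) \<Rightarrow> real" where
  "opnorm \<Omega> \<sigma> A = (SUP f\<in>{f\<in>bspace \<Omega> \<sigma>. bnorm \<sigma> f \<le> 1}. bnorm \<sigma> (A f))"

definition essnorm :: "'n::finite pt set \<Rightarrow> 'n pt measure \<Rightarrow> ('n fn \<Rightarrow> 'n fn) \<Rightarrow> real" where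
  "essnorm \<Omega> \<sigma> T = (INF A\<in>{A. compact_op \<Omega> \<sigma> A}. opnorm \<Omega> \<sigma> (\<lambda>f w. T f w - A f w))"

definition hadj :: "'n::finite pt set \<Rightarrow> 'n pt measure \<Rightarrow> ('n fn \<Rightarrow> 'n fn) \<Rightarrow> ('n fn \<Rightarrow> 'n fn)" where
  "hadj \<Omega> \<sigma> A = (\<lambda>g. THE h. h \<in> bspace \<Omega> \<sigma> \<and> (\<forall>f\<in>bspace \<Omega> \<sigma>. ip \<sigma> (A f) g = ip \<sigma> f h))"

definition transl :: "'n::finite pt set \<Rightarrow> 'n pt measure \<Rightarrow> ('n pt \<Rightarrow> 'n pt \<Rightarrow> 'n pt) \<Rightarrow>
    ('n pt \<Rightarrow> 'n fn) \<Rightarrow> 'n pt \<Rightarrow> 'n fn \<Rightarrow> 'n fn" where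
  "transl \<Omega> \<sigma> \<phi> K z f = (\<lambda>w. if w \<in> \<Omega> then f (\<phi> z w) * kn \<sigma> K z w else 0)"

definition conjop :: "'n::finite pt set \<Rightarrow> 'n pt measure \<Rightarrow> ('n pt \<Rightarrow> 'n pt \<Rightarrow> 'n pt) \<Rightarrow>
    ('n pt \<Rightarrow> 'n fn) \<Rightarrow> ('n fn \<Rightarrow> 'n fn) \<Rightarrow> 'n pt \<Rightarrow> 'n fn \<Rightarrow> 'n fn" where
  "conjop \<Omega> \<sigma> \<phi> K T z =
     (\<lambda>f. transl \<Omega> \<sigma> \<phi> K z (T (hadj \<Omega> \<sigma> (transl \<Omega> \<sigma> \<phi> K z) f)))"

definition dinf :: "'n::finite pt set \<Rightarrow> ('n pt \<Rightarrow> 'n pt \<Rightarrow> real) \<Rightarrow> 'n pt filter" where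
  "dinf \<Omega> d = inf (filtercomap (\<lambda>z. d z 0) at_top) (principal \<Omega>)"

definition in_Lp :: "'n pt measure \<Rightarrow> real \<Rightarrow> 'n fn \<Rightarrow> bool" where
  "in_Lp \<sigma> p f \<longleftrightarrow> integrable \<sigma> (\<lambda>w. cmod (f w) powr p)"

definition Lp_norm :: "'n pt measure \<Rightarrow> real \<Rightarrow> 'n fn \<Rightarrow> real" where
  "Lp_norm \<sigma> p f = (\<integral>w. cmod (f w) powr p \<partial>\<sigma>) powr (1 / p)"

definition Lp_hyp :: "'n::finite pt set \<Rightarrow> 'n pt measure \<Rightarrow> ('n pt \<Rightarrow> 'n pt \<Rightarrow> 'n pt) \<Rightarrow>
    ('n pt \<Rightarrow> 'n fn) \<Rightarrow> real \<Rightarrow> ('n fn \<Rightarrow> 'n fn) \<Rightarrow> bool" where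
  "Lp_hyp \<Omega> \<sigma> \<phi> K p A \<longleftrightarrow> (\<exists>M. \<forall>z\<in>\<Omega>.
      in_Lp \<sigma> p (transl \<Omega> \<sigma> \<phi> K z (A (kn \<sigma> K z))) \<and>
      Lp_norm \<sigma> p (transl \<Omega> \<sigma> \<phi> K z (A (kn \<sigma> K z))) \<le> M)"

end

theory Submission
  imports Defs "HOL-Complex_Analysis.Great_Picard"
begin

text \<open>
  A Schur test with weight \<open>\<parallel>K\<^sub>z\<parallel>\<^sup>a\<close> shows that the part of the kernel \<open>\<langle>T K\<^sub>w, K\<^sub>z\<rangle>\<close> of \<open>T\<close> with
  \<open>d(z, w) > \<rho>\<close> has norm tending to \<open>0\<close> as \<open>\<rho> \<rightarrow> \<infinity>\<close>: the substitution \<open>z = \<phi>\<^sub>w(u)\<close> turns the row sums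
  into integrals of \<open>|U\<^sub>w T k\<^sub>w|\<close>, to which Hoelder and the Rudin-Forelli estimates apply. Hence
  \<open>\<parallel>T P g\<parallel>\<close> is controlled by the norms \<open>\<parallel>T P (1\<^bsub>D(x, 2\<rho>)\<^esub> g)\<parallel>\<close>. If \<open>g\<close> vanishes on a large ball then only centres
  \<open>x\<close> far from \<open>0\<close> matter, and cutting \<open>f\<close> to a ball gives a compact operator. For such \<open>x\<close>, the
  functions \<open>(U\<^sub>x\<^sup>*)\<^sup>-\<^sup>1 P (1\<^bsub>D(x, 2\<rho>)\<^esub> g)\<close> range over a relatively compact set independent of \<open>x\<close>, which lets the
  pointwise limsup of \<open>\<parallel>T\<^sup>x f\<parallel>\<close> bound them uniformly. Conversely \<open>U\<^sub>z\<^sup>* f \<rightarrow> 0\<close> weakly, so compact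
  perturbations do not change that limsup.
\<close>

section \<open>Baire category and the topology of the metric\<close>

text \<open>One obstacle precedes the analysis: compactness is assumed for closed balls in the
  topology of \<open>d\<close>, whereas holomorphy, Borel sets and Arzela-Ascoli refer to the
  Euclidean one. Once the two topologies are identified, \<open>d\<close> and the operator kernels
  are jointly measurable, closed \<open>d\<close>-balls are Euclidean compact, and \<open>d\<close>
  is unbounded, so that limits at infinity are not vacuous. A second obstacle is that
  \<open>U z\<close> need not be unitary; it merely has a bounded inverse \<open>V z\<close>.
  Pulling a function back from a ball about \<open>x\<close> to the origin therefore uses the
  adjoint of \<open>V x\<close>, and every such passage costs a factor \<open>C ^ 2\<close>. The
  order of choices matters. The radius of the balls is fixed by the smallness of the off-diagonal
  part alone; only then is a bound sought on balls of this radius with distant centres. This bound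
  may thus rest on compactness arguments that give no rate. All comparability constants are merged
  into one \<open>C\<close>, independent of \<open>T\<close> and \<open>p\<close>. The final
  constant \<open>4 * C ^ 6\<close> is \<open>2 * C ^ 2\<close> from averaging over balls times
  \<open>2 * C ^ 4\<close> from the bound on one ball.\<close>

definition comeager_in :: "'a::topological_space set \<Rightarrow> 'a set \<Rightarrow> bool" where
  "comeager_in \<Omega> A \<longleftrightarrow>
     (\<exists>\<G>. countable \<G> \<and> (\<forall>G\<in>\<G>. open G \<and> \<Omega> \<subseteq> closure G) \<and> \<Omega> \<inter> \<Inter>\<G> \<subseteq> A)"

lemma comeager_inI:
  assumes "countable \<G>" "\<And>G. G \<in> \<G> \<Longrightarrow> open G" "\<And>G. G \<in> \<G> \<Longrightarrow> \<Omega> \<subseteq> closure G" "\<Omega> \<inter> \<Inter>\<G> \<subseteq> A"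
  shows "comeager_in \<Omega> A"
  unfolding comeager_in_def by (rule exI[of _ \<G>]) (use assms in simp)

lemma comeager_inE:
  assumes "comeager_in \<Omega> A"
  obtains \<G> where "countable \<G>" "\<forall>G\<in>\<G>. open G \<and> \<Omega> \<subseteq> closure G" "\<Omega> \<inter> \<Inter>\<G> \<subseteq> A"
  using assms unfolding comeager_in_def by (elim exE conjE) (rule that)

lemma comeager_in_mono:
  assumes "comeager_in \<Omega> A" "A \<subseteq> B"
  shows "comeager_in \<Omega> B"
proof -
  from assms(1) obtain \<G> where "countable \<G>" "\<forall>G\<in>\<G>. open G \<and> \<Omega> \<subseteq> closure G" "\<Omega> \<inter> \<Inter>\<G> \<subseteq> A"
    by (rule comeager_inE)
  then show ?thesis
    using subset_trans[OF _ assms(2)] by (intro comeager_inI[of \<G>]) simp_all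
qed

lemma comeager_in_Inter:
  assumes "countable I" and "\<And>i. i \<in> I \<Longrightarrow> comeager_in \<Omega> (A i)"
  shows "comeager_in \<Omega> (\<Inter>i\<in>I. A i)"
proof -
  have "\<forall>i\<in>I. \<exists>\<G>. countable \<G> \<and> (\<forall>G\<in>\<G>. open G \<and> \<Omega> \<subseteq> closure G) \<and> \<Omega> \<inter> \<Inter>\<G> \<subseteq> A i"
    using assms(2) unfolding comeager_in_def by simp
  from bchoice[OF this] obtain \<G> where G: "\<forall>i\<in>I. countable (\<G> i) \<and>
      (\<forall>G\<in>\<G> i. open G \<and> \<Omega> \<subseteq> closure G) \<and> \<Omega> \<inter> \<Inter>(\<G> i) \<subseteq> A i" ..
  show ?thesis
  proof (rule comeager_inI)
    show "countable (\<Union>i\<in>I. \<G> i)" using G assms(1) by simp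
    show "\<Omega> \<inter> \<Inter>(\<Union>i\<in>I. \<G> i) \<subseteq> (\<Inter>i\<in>I. A i)"
    proof (intro INT_greatest)
      fix i assume "i \<in> I"
      then have "\<Inter>(\<Union>i\<in>I. \<G> i) \<subseteq> \<Inter>(\<G> i)" by (intro Inter_anti_mono) blast
      then have "\<Omega> \<inter> \<Inter>(\<Union>i\<in>I. \<G> i) \<subseteq> \<Omega> \<inter> \<Inter>(\<G> i)" by (intro Int_mono) auto
      also have "\<dots> \<subseteq> A i" using G \<open>i \<in> I\<close> by simp
      finally show "\<Omega> \<inter> \<Inter>(\<Union>i\<in>I. \<G> i) \<subseteq> A i" .
    qed
  qed (use G in auto)
qed

lemma comeager_in_Int:
  assumes "comeager_in \<Omega> A" "comeager_in \<Omega> B"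
  shows "comeager_in \<Omega> (A \<inter> B)"
proof -
  have "comeager_in \<Omega> (\<Inter>i\<in>{True,False}. if i then A else B)"
    by (rule comeager_in_Inter) (use assms in auto)
  then show ?thesis by (simp add: Int_commute)
qed

lemma comeager_in_meets_open:
  fixes \<Omega> :: "'a::{real_normed_vector,heine_borel} set"
  assumes "comeager_in \<Omega> A" "open W" "W \<subseteq> \<Omega>" "W \<noteq> {}"
  shows "W \<inter> A \<noteq> {}"
proof -
  from assms(1) obtain \<G> where G: "countable \<G>"
      "\<forall>G\<in>\<G>. open G \<and> \<Omega> \<subseteq> closure G" "\<Omega> \<inter> \<Inter>\<G> \<subseteq> A"
    by (rule comeager_inE)
  \<comment> \<open>Adding the exterior of \<open>\<Omega>\<close> makes each relatively dense open
    set dense in the whole space, where Baire's theorem is available; inside \<open>\<Omega>\<close>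
    nothing changes.\<close>
  let ?ext = "\<lambda>G. G \<union> - closure \<Omega>"
  have dense: "UNIV \<subseteq> closure (\<Inter>(?ext ` \<G>))"
  proof (rule Baire)
    fix T assume "T \<in> ?ext ` \<G>"
    then obtain G where GT: "G \<in> \<G>" "T = ?ext G" by blast
    have "closure \<Omega> \<subseteq> closure G" using bspec[OF G(2) GT(1)] by (simp add: closure_minimal)
    then have "UNIV \<subseteq> closure T"
      unfolding GT(2) closure_Un using closure_subset[of "- closure \<Omega>"] by blast
    moreover have "open T" using bspec[OF G(2) GT(1)] GT(2) by blast
    ultimately show "openin (top_of_set UNIV) T \<and> UNIV \<subseteq> closure T" by simp
  qed (use G(1) in simp_all)
  obtain x where x: "x \<in> W" using assms(4) by blast
  have "x \<in> closure (\<Inter>(?ext ` \<G>))" by (rule subsetD[OF dense UNIV_I])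
  then have "\<Inter>(?ext ` \<G>) \<inter> W \<noteq> {}"
    using closure_iff_nhds_not_empty[THEN iffD1, rule_format, of x _ W W] assms(2) x by simp
  then obtain y where "y \<in> W" "y \<in> \<Inter>(?ext ` \<G>)"
    by (meson IntE ex_in_conv)
  moreover have "y \<in> \<Omega>" "y \<in> closure \<Omega>"
    using subsetD[OF assms(3) \<open>y \<in> W\<close>] subsetD[OF closure_subset] by simp_all
  ultimately have "y \<in> \<Omega> \<inter> \<Inter>\<G>" by simp
  then have "y \<in> A" using G(3) by (rule rev_subsetD)
  then show ?thesis using \<open>y \<in> W\<close> IntI[of y W A] by (metis empty_iff)
qed

definition Baire_property :: "'a::topological_space set \<Rightarrow> bool" where
  "Baire_property A \<longleftrightarrow> (\<exists>U. open U \<and> comeager_in UNIV {x. x \<in> A \<longleftrightarrow> x \<in> U})"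

text \<open>The sets that are open up to a meager set form a sigma-algebra. This converts the Borel
  measurability of \<open>d\<close>-balls into Euclidean openness up to a meager set.\<close>

lemma Baire_property_borel:
  assumes "A \<in> sets borel"
  shows "Baire_property A"
proof -
  have "A \<in> sigma_sets UNIV {S. open S}" using assms by (simp add: borel_def)
  then show ?thesis
  proof (induction rule: sigma_sets.induct)
    case (Basic S)
    have "comeager_in UNIV (UNIV :: 'a set)"
      unfolding comeager_in_def by (rule exI[of _ "{}"]) simp
    then show ?case unfolding Baire_property_def using Basic by (intro exI[of _ S]) auto
  next
    case Empty
    have "comeager_in UNIV (UNIV :: 'a set)"
      unfolding comeager_in_def by (rule exI[of _ "{}"]) simp
    then show ?case unfolding Baire_property_def by (intro exI[of _ "{}"]) auto
  next
    case (Compl S)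
    then obtain U where U: "open U" "comeager_in UNIV {x. x \<in> S \<longleftrightarrow> x \<in> U}"
      unfolding Baire_property_def by blast
    \<comment> \<open>The complement of \<open>U\<close> need not be open; replacing it by its
      interior loses only the boundary of \<open>U\<close>, which is closed with dense
      complement.\<close>
    have "closure U \<union> closure (- closure U) = UNIV"
      using closure_subset[of "- closure U"] by blast
    then have "comeager_in UNIV (U \<union> - closure U)"
      unfolding comeager_in_def
      by (intro exI[of _ "{U \<union> - closure U}"]) (use U(1) in \<open>simp add: open_Un open_Compl\<close>)
    from comeager_in_Int[OF U(2) this]
    have "comeager_in UNIV {x. x \<in> UNIV - S \<longleftrightarrow> x \<in> - closure U}"
      by (rule comeager_in_mono) (use subsetD[OF closure_subset[of U]] in auto)
    then show ?case
      unfolding Baire_property_def by (intro exI[of _ "- closure U"]) auto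
  next
    case (Union F)
    then have "\<forall>i. \<exists>U. open U \<and> comeager_in UNIV {x. x \<in> F i \<longleftrightarrow> x \<in> U}"
      unfolding Baire_property_def by blast
    then obtain U where U: "\<And>i::nat. open (U i)"
        "\<And>i. comeager_in UNIV {x. x \<in> F i \<longleftrightarrow> x \<in> U i}"
      by metis
    have "comeager_in UNIV (\<Inter>i\<in>UNIV. {x. x \<in> F i \<longleftrightarrow> x \<in> U i})"
      by (rule comeager_in_Inter) (use U(2) in auto)
    then have "comeager_in UNIV {x. x \<in> \<Union>(range F) \<longleftrightarrow> x \<in> \<Union>(range U)}"
      by (rule comeager_in_mono) auto
    then show ?case
      unfolding Baire_property_def by (intro exI[of _ "\<Union>(range U)"]) (use U(1) in auto)
  qed
qed

lemma comeager_in_subset_space: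
  assumes "comeager_in UNIV A"
  shows "comeager_in \<Omega> A"
proof -
  from assms obtain \<G> where G: "countable \<G>" "\<forall>G\<in>\<G>. open G \<and> UNIV \<subseteq> closure G" "UNIV \<inter> \<Inter>\<G> \<subseteq> A"
    by (rule comeager_inE)
  show ?thesis
  proof (rule comeager_inI[OF G(1)])
    show "\<Omega> \<inter> \<Inter>\<G> \<subseteq> A" using G(3) by blast
    fix H assume "H \<in> \<G>"
    then have "open H" "UNIV \<subseteq> closure H" using G(2) by blast+
    then show "open H" "\<Omega> \<subseteq> closure H" by auto
  qed
qed

text \<open>An involution is its own inverse, so continuity alone makes \<open>f\<close> a
  homeomorphism of \<open>\<Omega>\<close>, and homeomorphisms preserve dense open sets.\<close>

lemma comeager_in_involution:
  assumes "open \<Omega>" "f ` \<Omega> \<subseteq> \<Omega>" "continuous_on \<Omega> f" "\<And>w. w \<in> \<Omega> \<Longrightarrow> f (f w) = w"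
    and "comeager_in \<Omega> A"
  shows "comeager_in \<Omega> {w \<in> \<Omega>. f w \<in> A}"
proof -
  from assms(5) obtain \<G> where G: "countable \<G>"
      "\<forall>G\<in>\<G>. open G \<and> \<Omega> \<subseteq> closure G" "\<Omega> \<inter> \<Inter>\<G> \<subseteq> A"
    by (rule comeager_inE)
  have pre: "open {w \<in> \<Omega>. f w \<in> W}" if "open W" for W
    using continuous_open_preimage[OF assms(3,1) that] by (simp add: vimage_def Int_def)
  let ?pre = "\<lambda>G. {w \<in> \<Omega>. f w \<in> G}"
  have "\<Omega> \<subseteq> closure (?pre G)" if "G \<in> \<G>" for G
  proof
    fix x assume x: "x \<in> \<Omega>"
    show "x \<in> closure (?pre G)"
      unfolding closure_iff_nhds_not_empty
    proof (intro allI impI)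
      fix Y S assume "S \<subseteq> Y" "x \<in> S" "open S"
      have "open (?pre (S \<inter> \<Omega>))" using \<open>open S\<close> assms(1) by (intro pre) blast
      moreover have "f x \<in> ?pre (S \<inter> \<Omega>)" using x assms \<open>x \<in> S\<close> by auto
      moreover have "f x \<in> closure G" using x assms(2) bspec[OF G(2) that] by blast
      ultimately have "G \<inter> ?pre (S \<inter> \<Omega>) \<noteq> {}"
        by (meson closure_iff_nhds_not_empty order_refl)
      then obtain y where "y \<in> G" "y \<in> \<Omega>" "f y \<in> S" by blast
      then have "f y \<in> ?pre G \<inter> Y" using assms \<open>S \<subseteq> Y\<close> by auto
      then show "?pre G \<inter> Y \<noteq> {}" by blast
    qed
  qed
  moreover have "\<Omega> \<inter> \<Inter>(?pre ` \<G>) \<subseteq> {w \<in> \<Omega>. f w \<in> A}"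
    using G(3) assms(2) by auto
  ultimately show ?thesis
    unfolding comeager_in_def
    by (intro exI[of _ "?pre ` \<G>"]) (use G(1,2) pre in auto)
qed

text \<open>The metric \<open>d\<close> is not assumed to induce the Euclidean topology; that it does follows from
  homogeneity by two Baire category arguments.\<close>

locale homogeneous_metric = Metric_space \<Omega> d
  for \<Omega> :: "'a::euclidean_space set" and d +
  fixes \<phi> :: "'a \<Rightarrow> 'a \<Rightarrow> 'a" and c0 :: 'a and C :: real
  assumes open_dom: "open \<Omega>" and base: "c0 \<in> \<Omega>"
    and \<phi>_in: "\<And>z w. z \<in> \<Omega> \<Longrightarrow> w \<in> \<Omega> \<Longrightarrow> \<phi> z w \<in> \<Omega>"
    and \<phi>_cont: "\<And>z. z \<in> \<Omega> \<Longrightarrow> continuous_on \<Omega> (\<phi> z)"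
    and \<phi>_inv: "\<And>z w. z \<in> \<Omega> \<Longrightarrow> w \<in> \<Omega> \<Longrightarrow> \<phi> z (\<phi> z w) = w"
    and \<phi>_base: "\<And>z. z \<in> \<Omega> \<Longrightarrow> \<phi> z c0 = z"
    and C_ge: "C \<ge> 1"
    and d_\<phi>: "\<And>u v z. u \<in> \<Omega> \<Longrightarrow> v \<in> \<Omega> \<Longrightarrow> z \<in> \<Omega> \<Longrightarrow> d (\<phi> z u) (\<phi> z v) \<le> C * d u v"
    and sep: "separable_space mtopology"
    and ball_borel: "\<And>z r. z \<in> \<Omega> \<Longrightarrow> mball z r \<in> sets borel"
    and cball_compact: "\<And>z r. z \<in> \<Omega> \<Longrightarrow> compactin mtopology (mcball z r)"
begin

lemma \<phi>_self: "z \<in> \<Omega> \<Longrightarrow> \<phi> z z = c0"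
  using \<phi>_inv \<phi>_base base by metis

lemma d_\<phi>': "u \<in> \<Omega> \<Longrightarrow> v \<in> \<Omega> \<Longrightarrow> z \<in> \<Omega> \<Longrightarrow> d u v \<le> C * d (\<phi> z u) (\<phi> z v)"
  using d_\<phi>[of "\<phi> z u" "\<phi> z v" z] by (simp add: \<phi>_in \<phi>_inv)

lemma open_\<phi>_preimage:
  assumes "z \<in> \<Omega>" "open W"
  shows "open {w \<in> \<Omega>. \<phi> z w \<in> W}"
  using continuous_open_preimage[OF \<phi>_cont[OF assms(1)] open_dom assms(2)]
  by (simp add: vimage_def Int_def)

lemma comeager_\<phi>: "z \<in> \<Omega> \<Longrightarrow> comeager_in \<Omega> A \<Longrightarrow> comeager_in \<Omega> {w \<in> \<Omega>. \<phi> z w \<in> A}"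
  by (rule comeager_in_involution[OF open_dom _ \<phi>_cont]) (use \<phi>_in \<phi>_inv in auto)

text \<open>First category argument. By separability countably many \<open>d\<close>-balls of radius
  \<open>s\<close> cover \<open>\<Omega>\<close>, and each is open up to a meager set. A generic
  point \<open>x\<close> lies in one of them and in its open representative, so near
  \<open>x\<close> generic points are within \<open>2 * s\<close> of \<open>x\<close>;
  \<open>\<phi> x\<close> carries this to the base point. An exceptional meager set remains.\<close>

lemma mball_locally_comeager:
  assumes "r > 0"
  obtains \<delta> where "\<delta> > 0" "comeager_in \<Omega> {w \<in> \<Omega>. w \<in> ball c0 \<delta> \<longrightarrow> d w c0 \<le> r}"
proof -
  define s where "s = r / (2 * C)"
  have s: "s > 0" "2 * C * s = r" using assms C_ge by (auto simp: s_def)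
  obtain Q where Q: "countable Q" "Q \<subseteq> \<Omega>" "mtopology closure_of Q = \<Omega>"
    using sep unfolding separable_space_def by auto
  have cover: "\<exists>q\<in>Q. x \<in> mball q s" if "x \<in> \<Omega>" for x
  proof -
    have "x \<in> mtopology closure_of Q" using Q that by simp
    then obtain y where "y \<in> Q" "y \<in> mball x s" using s(1) by (auto simp: metric_closure_of)
    then show ?thesis using commute by (intro bexI[of _ y]) auto
  qed
  have "\<forall>q\<in>Q. \<exists>U. open U \<and> comeager_in UNIV {x. x \<in> mball q s \<longleftrightarrow> x \<in> U}"
    using Baire_property_borel[OF ball_borel] Q(2) unfolding Baire_property_def by blast
  then obtain U where U: "\<And>q. q \<in> Q \<Longrightarrow> open (U q)"
      "\<And>q. q \<in> Q \<Longrightarrow> comeager_in \<Omega> {x. x \<in> mball q s \<longleftrightarrow> x \<in> U q}"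
    by (metis comeager_in_subset_space)
  let ?A = "\<Inter>q\<in>Q. {x. x \<in> mball q s \<longleftrightarrow> x \<in> U q}"
  have A: "comeager_in \<Omega> ?A"
    by (rule comeager_in_Inter[OF Q(1)]) (rule U(2))
  from comeager_in_meets_open[OF this open_dom] base obtain x where x: "x \<in> \<Omega>" "x \<in> ?A" by blast
  with cover obtain q where q: "q \<in> Q" "x \<in> mball q s" by blast
  define V where "V = U q \<inter> \<Omega>"
  have V: "open V" "x \<in> V" "V \<subseteq> \<Omega>" using U(1) q open_dom x by (auto simp: V_def)
  let ?W = "{w \<in> \<Omega>. \<phi> x w \<in> V}"
  have "open ?W" "c0 \<in> ?W"
    using open_\<phi>_preimage[OF x(1) V(1)] base V(2) \<phi>_base x(1) by auto
  then obtain \<delta> where \<delta>: "\<delta> > 0" "ball c0 \<delta> \<subseteq> ?W" by (meson openE)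
  show ?thesis
  proof (rule that[OF \<delta>(1)], rule comeager_in_mono[OF comeager_\<phi>[OF x(1) A]], safe)
    fix w assume w: "w \<in> \<Omega>" "\<phi> x w \<in> ?A" "w \<in> ball c0 \<delta>"
    then have "\<phi> x w \<in> V" using \<delta>(2) by blast
    then have "\<phi> x w \<in> mball q s" using w q(1) by (auto simp: V_def)
    then have "d (\<phi> x w) x < 2 * s"
      using q(2) triangle'[of "\<phi> x w" q x] by (auto simp: commute)
    then have "d w c0 \<le> C * (2 * s)"
      using d_\<phi>'[of w c0 x] C_ge w(1) base x(1) \<phi>_base
      by (smt (verit, best) mult_left_mono)
    then show "d w c0 \<le> r" using s(2) by simp
  qed
qed

text \<open>Second category argument, removing the exceptional set. If suitable Euclidean balls
  around \<open>z\<close> and \<open>z'\<close> overlap, a generic point of the overlap is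
  \<open>d\<close>-close to both centres, so \<open>d z z'\<close> itself is small. The radius that
  is suitable depends on \<open>z\<close>; Baire's theorem supplies an open set in which one radius
  works on a dense subset.\<close>

lemma base_euclidean_nbhd:
  assumes "r > 0"
  obtains W where "open W" "c0 \<in> W" "W \<subseteq> \<Omega>" "\<And>w. w \<in> W \<Longrightarrow> d c0 w < r"
proof -
  \<comment> \<open>Three jumps of length \<open>2 * C * s\<close> and one transport by
    \<open>\<phi> v\<close> give \<open>6 * C * C * s\<close>; the 7 makes the final inequality
    strict.\<close>
  define s where "s = r / (7 * C * C)"
  have s: "s > 0" "7 * C * C * s = r" using assms C_ge by (auto simp: s_def)
  obtain \<delta> where \<delta>: "\<delta> > 0" "comeager_in \<Omega> {w \<in> \<Omega>. w \<in> ball c0 \<delta> \<longrightarrow> d w c0 \<le> s}"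
    using mball_locally_comeager[OF s(1)] .
  \<comment> \<open>The radius \<open>e\<close> is suitable at \<open>z\<close>: after transport by
    \<open>\<phi> z\<close>, generic points of the Euclidean ball are within \<open>C * s\<close> of
    \<open>z\<close> for \<open>d\<close>.\<close>
  define N where "N z e \<longleftrightarrow> e > 0 \<and> ball z e \<subseteq> \<Omega> \<and> \<phi> z ` ball z e \<subseteq> ball c0 \<delta>" for z e
  have N_ex: "\<exists>e. N z e" if "z \<in> \<Omega>" for z
  proof -
    have "open {w \<in> \<Omega>. \<phi> z w \<in> ball c0 \<delta>}" using open_\<phi>_preimage[OF that] by blast
    moreover have "z \<in> {w \<in> \<Omega>. \<phi> z w \<in> ball c0 \<delta>}" using that \<delta>(1) \<phi>_self by simp
    ultimately obtain e where "e > 0" "ball z e \<subseteq> {w \<in> \<Omega>. \<phi> z w \<in> ball c0 \<delta>}" by (meson openE)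
    then show ?thesis unfolding N_def by (intro exI[of _ e]) auto
  qed
  have N_mono: "N z e'" if "N z e" "0 < e'" "e' \<le> e" for z e e'
    using that subset_ball[OF that(3), of z] unfolding N_def by blast
  have near: "comeager_in \<Omega> {y \<in> \<Omega>. y \<in> ball z e \<longrightarrow> d z y \<le> C * s}" if "N z e" for z e
  proof -
    have z: "z \<in> \<Omega>" using that unfolding N_def by (meson centre_in_ball subsetD)
    show ?thesis
    proof (rule comeager_in_mono[OF comeager_\<phi>[OF z \<delta>(2)]], intro subsetI CollectI conjI impI)
      fix y assume "y \<in> {w \<in> \<Omega>. \<phi> z w \<in> {w \<in> \<Omega>. w \<in> ball c0 \<delta> \<longrightarrow> d w c0 \<le> s}}"
      then have y0: "y \<in> \<Omega>" "\<phi> z y \<in> ball c0 \<delta> \<longrightarrow> d (\<phi> z y) c0 \<le> s" by auto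
      then show "y \<in> \<Omega>" by simp
      assume "y \<in> ball z e"
      with y0 have y: "y \<in> \<Omega>" "y \<in> ball z e" "\<phi> z y \<in> ball c0 \<delta> \<longrightarrow> d (\<phi> z y) c0 \<le> s" by auto
      then have "d (\<phi> z y) c0 \<le> s" using that unfolding N_def by blast
      then show "d z y \<le> C * s"
        using d_\<phi>'[OF y(1) z z] \<phi>_self[OF z] C_ge commute[of z y]
        by (smt (verit, best) mult_left_mono)
    qed
  qed
  have close: "d z z' \<le> 2 * C * s" if N: "N z e" "N z' e'" and int: "ball z e \<inter> ball z' e' \<noteq> {}"
    for z z' e e'
  proof -
    have in\<Omega>: "z \<in> \<Omega>" "z' \<in> \<Omega>" using N unfolding N_def by (meson centre_in_ball subsetD)+
    have "ball z e \<inter> ball z' e' \<subseteq> \<Omega>" using N unfolding N_def by blast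
    from comeager_in_meets_open[OF comeager_in_Int[OF near[OF N(1)] near[OF N(2)]]
        open_Int[OF open_ball open_ball] this int]
    obtain y where "y \<in> \<Omega>" "d z y \<le> C * s" "d z' y \<le> C * s" by auto
    then show ?thesis using triangle'[of z y z'] in\<Omega> by (auto simp: commute)
  qed
  define \<Omega>' where "\<Omega>' m = {z \<in> \<Omega>. N z (1 / Suc m)}" for m :: nat
  have cover: "\<exists>m. z \<in> \<Omega>' m" if z: "z \<in> \<Omega>" for z
  proof -
    obtain e where e: "N z e" using N_ex[OF z] ..
    then have "e > 0" unfolding N_def by simp
    then obtain m where m: "1 / real (Suc m) < e" by (rule nat_approx_posE)
    then have "N z (1 / real (Suc m))" by (intro N_mono[OF e]) auto
    then show ?thesis using z unfolding \<Omega>'_def by blast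
  qed
  \<comment> \<open>Otherwise the complements of the closures of the sets \<open>\<Omega>' m\<close>
    are all dense in \<open>\<Omega>\<close>, and a point common to them would have no suitable
    radius.\<close>
  have "\<exists>m V. open V \<and> V \<noteq> {} \<and> V \<subseteq> \<Omega> \<and> V \<subseteq> closure (\<Omega>' m)"
  proof (rule ccontr)
    assume "\<not> ?thesis"
    then have no: False if "open V" "V \<noteq> {}" "V \<subseteq> \<Omega>" "V \<subseteq> closure (\<Omega>' m)" for V m
      using that by metis
    have dense: "\<Omega> \<subseteq> closure (- closure (\<Omega>' m))" for m
    proof
      fix x assume x: "x \<in> \<Omega>"
      show "x \<in> closure (- closure (\<Omega>' m))"
        unfolding closure_iff_nhds_not_empty
      proof (intro allI impI)
        fix Y S assume S: "S \<subseteq> Y" "x \<in> S" "open S"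
        have "\<not> S \<inter> \<Omega> \<subseteq> closure (\<Omega>' m)"
          using no[of "S \<inter> \<Omega>" m] open_Int[OF S(3) open_dom] x S(2) by auto
        then show "- closure (\<Omega>' m) \<inter> Y \<noteq> {}" using S(1) by auto
      qed
    qed
    have "comeager_in \<Omega> (\<Inter>m\<in>UNIV. - closure (\<Omega>' m))"
    proof (rule comeager_in_Inter)
      show "comeager_in \<Omega> (- closure (\<Omega>' m))" for m
        by (rule comeager_inI[of "{- closure (\<Omega>' m)}"]) (use dense in \<open>auto simp: open_Compl\<close>)
    qed simp
    from comeager_in_meets_open[OF this open_dom] base obtain x
      where "x \<in> \<Omega>" "\<forall>m. x \<notin> closure (\<Omega>' m)" by auto
    then show False using cover[of x] subsetD[OF closure_subset] by auto
  qed
  then obtain m V where mV: "open V" "V \<noteq> {}" "V \<subseteq> \<Omega>" "V \<subseteq> closure (\<Omega>' m)" by metis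
  then obtain v where v: "v \<in> V" by blast
  then obtain \<tau>0 where \<tau>0: "\<tau>0 > 0" "ball v \<tau>0 \<subseteq> V" using mV(1) by (meson openE)
  define \<tau> where "\<tau> = min \<tau>0 (1 / (2 * Suc m))"
  have \<tau>: "\<tau> > 0" "ball v \<tau> \<subseteq> V" "2 * \<tau> \<le> 1 / Suc m"
  proof -
    show "\<tau> > 0" using \<tau>0(1) by (simp add: \<tau>_def)
    have "ball v \<tau> \<subseteq> ball v \<tau>0" by (rule subset_ball) (simp add: \<tau>_def)
    then show "ball v \<tau> \<subseteq> V" using \<tau>0(2) by (rule subset_trans)
    have "\<tau> \<le> 1 / (2 * Suc m)" by (simp add: \<tau>_def)
    then show "2 * \<tau> \<le> 1 / Suc m" by (simp add: field_simps)
  qed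
  have approx: "\<exists>z'\<in>\<Omega>' m \<inter> ball v \<tau>. d z z' \<le> 2 * C * s" if z: "z \<in> ball v \<tau>" for z
  proof -
    have z\<Omega>: "z \<in> \<Omega>" using z \<tau>(2) mV(3) by blast
    then obtain e where e: "N z e" using N_ex by blast
    have "z \<in> ball z e \<inter> ball v \<tau>" using e z unfolding N_def by simp
    moreover have "z \<in> closure (\<Omega>' m)" using z \<tau>(2) mV(4) by blast
    ultimately have "\<Omega>' m \<inter> (ball z e \<inter> ball v \<tau>) \<noteq> {}"
      by (meson closure_iff_nhds_not_empty open_Int open_ball order_refl)
    then obtain z' where z': "z' \<in> \<Omega>' m" "z' \<in> ball z e" "z' \<in> ball v \<tau>" by blast
    then have "d z z' \<le> 2 * C * s"
      by (intro close[OF e, of z' "1 / Suc m"]) (auto simp: \<Omega>'_def)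
    then show ?thesis using z' by blast
  qed
  \<comment> \<open>The chain runs through \<open>v\<close>, \<open>a\<close>, \<open>b\<close>,
    \<open>z\<close>. The outer jumps come from density; the middle one is possible because
    \<open>a\<close> and \<open>b\<close> share the radius \<open>1 / Suc m\<close> and lie within
    \<open>2 * \<tau>\<close> of each other.\<close>
  have diam: "d v z \<le> 6 * C * s" if z: "z \<in> ball v \<tau>" for z
  proof -
    have "v \<in> ball v \<tau>" using \<tau> by simp
    then obtain a where a: "a \<in> \<Omega>' m" "a \<in> ball v \<tau>" "d v a \<le> 2 * C * s" using approx by blast
    obtain b where b: "b \<in> \<Omega>' m" "b \<in> ball v \<tau>" "d z b \<le> 2 * C * s" using approx z by blast
    have "dist a b < 1 / Suc m"
      using a(2) b(2) \<tau>(3) dist_triangle2[of a b v] by (simp add: dist_commute)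
    then have "b \<in> ball a (1 / Suc m) \<inter> ball b (1 / Suc m)" by simp
    then have "d a b \<le> 2 * C * s"
      using a(1) b(1) close[of a "1 / Suc m" b "1 / Suc m"] unfolding \<Omega>'_def by blast
    moreover have "{v, a, b, z} \<subseteq> \<Omega>" using a b v mV(3) z \<tau>(2) by (auto simp: \<Omega>'_def)
    ultimately show ?thesis
      using a(3) b(3) triangle[of v a z] triangle[of a b z] commute[of b z] by auto
  qed
  have v\<Omega>: "v \<in> \<Omega>" using v mV by blast
  let ?W = "{w \<in> \<Omega>. \<phi> v w \<in> ball v \<tau>}"
  show ?thesis
  proof (rule that[of ?W])
    show "open ?W" using open_\<phi>_preimage[OF v\<Omega>] by blast
    show "c0 \<in> ?W" using base v\<Omega> \<phi>_base \<tau>(1) by simp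
    fix w assume w: "w \<in> ?W"
    have "d c0 w \<le> C * d v (\<phi> v w)" using d_\<phi>'[of c0 w v] w base v\<Omega> \<phi>_base by simp
    also have "\<dots> \<le> C * (6 * C * s)" using diam w C_ge by (intro mult_left_mono) auto
    also have "\<dots> < 7 * C * C * s" using s(1) C_ge by simp
    finally show "d c0 w < r" using s(2) by simp
  qed auto
qed

text \<open>\<open>\<phi> z\<close> sends \<open>z\<close> to \<open>c0\<close> and distorts
  \<open>d\<close> by a factor of at most \<open>C\<close>, so the neighbourhoods found at the base
  point can be moved to any point.\<close>

lemma openin_imp_open:
  assumes "openin mtopology U"
  shows "open U"
proof (subst open_subopen, intro ballI)
  fix z assume z: "z \<in> U"
  then obtain r where r: "r > 0" "mball z r \<subseteq> U" and z\<Omega>: "z \<in> \<Omega>"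
    using assms unfolding openin_mtopology by blast
  obtain W where W: "open W" "c0 \<in> W" "W \<subseteq> \<Omega>" "\<And>w. w \<in> W \<Longrightarrow> d c0 w < r / C"
    using base_euclidean_nbhd[of "r / C"] r(1) C_ge by auto
  have "open {w \<in> \<Omega>. \<phi> z w \<in> W}" using open_\<phi>_preimage[OF z\<Omega> W(1)] .
  moreover have "z \<in> {w \<in> \<Omega>. \<phi> z w \<in> W}" using z\<Omega> \<phi>_self W(2) by simp
  moreover have "{w \<in> \<Omega>. \<phi> z w \<in> W} \<subseteq> U"
  proof
    fix w assume w: "w \<in> {w \<in> \<Omega>. \<phi> z w \<in> W}"
    have "d z w \<le> C * d c0 (\<phi> z w)" using d_\<phi>'[of z w z] w z\<Omega> \<phi>_self by simp
    moreover have "d c0 (\<phi> z w) < r / C" using W(4) w by blast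
    ultimately have "d z w < r" using C_ge by (simp add: field_simps)
    then show "w \<in> U" using r(2) w z\<Omega> by auto
  qed
  ultimately show "\<exists>T. open T \<and> z \<in> T \<and> T \<subseteq> U" by blast
qed

lemma compact_imp_compactin:
  assumes "compact L" "L \<subseteq> \<Omega>"
  shows "compactin mtopology L"
proof -
  have "continuous_map (top_of_set \<Omega>) mtopology id"
    unfolding continuous_map_def
  proof (intro conjI allI impI)
    fix U assume U: "openin mtopology U"
    then have "{x \<in> topspace (top_of_set \<Omega>). id x \<in> U} = U" using openin_subset by fastforce
    then show "openin (top_of_set \<Omega>) {x \<in> topspace (top_of_set \<Omega>). id x \<in> U}"
      using openin_imp_open[OF U] openin_subset[OF U] by (simp add: openin_open_eq[OF open_dom])
  qed auto
  moreover have "compactin (top_of_set \<Omega>) L"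
    using assms by (simp add: compactin_subtopology)
  ultimately show ?thesis using image_compactin by force
qed

text \<open>A Euclidean compact subset is compact, hence closed, in the topology of
  \<open>d\<close>. That topology is locally compact and Hausdorff, so by Baire some member
  \<open>L n\<close> of a Euclidean compact exhaustion has an interior point for \<open>d\<close>.
  At such a point the two topologies agree, and homogeneity spreads this over
  \<open>\<Omega>\<close>.\<close>

lemma open_imp_openin:
  assumes "open V" "V \<subseteq> \<Omega>"
  shows "openin mtopology V"
proof -
  have haus: "Hausdorff_space mtopology" by (rule Hausdorff_space_mtopology)
  obtain L where L: "\<And>n::nat. compact (L n)" "\<And>n. L n \<subseteq> \<Omega>" "\<Omega> = (\<Union>n. L n)"
    using open_Union_compact_subsets[OF open_dom] by (metis (no_types))
  have cpt: "compactin mtopology T" if "compact T" "T \<subseteq> \<Omega>" for T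
    using compact_imp_compactin that .
  have "locally_compact_space mtopology"
    unfolding locally_compact_space_def
  proof
    fix x assume "x \<in> topspace mtopology"
    then show "\<exists>U K. openin mtopology U \<and> compactin mtopology K \<and> x \<in> U \<and> U \<subseteq> K"
      using cball_compact[of x 1] mball_subset_mcball[of x 1]
      by (intro exI[of _ "mball x 1"] exI[of _ "mcball x 1"]) auto
  qed
  moreover have "mtopology interior_of (\<Union>(range L)) \<noteq> {}"
    using L(3) base by (metis empty_iff interior_of_openin openin_topspace topspace_mtopology)
  ultimately obtain n where n: "mtopology interior_of (L n) \<noteq> {}"
    using Baire_category_alt[of mtopology "range L"] regular_space_mtopology
      compactin_imp_closedin[OF haus cpt[OF L(1,2)]] by auto
  then obtain v S where "openin mtopology S" "v \<in> S" "S \<subseteq> L n" unfolding interior_of_def by blast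
  then obtain r0 where v: "r0 > 0" "mball v r0 \<subseteq> L n" "v \<in> \<Omega>"
    unfolding openin_mtopology by (meson subset_trans subsetD)
  \<comment> \<open>The part of \<open>L n\<close> outside \<open>S\<close> is compact, hence
    \<open>d\<close>-closed, so a small \<open>d\<close>-ball at \<open>v\<close> avoids it while
    staying inside \<open>L n\<close>.\<close>
  have local: "\<exists>r>0. mball v r \<subseteq> S" if S: "open S" "v \<in> S" for S
  proof -
    have "compact (L n - S)" using L(1) S(1) by (simp add: compact_diff)
    then have "closedin mtopology (L n - S)"
      using cpt L(2) by (intro compactin_imp_closedin[OF haus]) blast
    then have "openin mtopology (mball v r0 - (L n - S))" by (intro openin_diff) auto
    moreover have "v \<in> mball v r0 - (L n - S)" using v S by simp
    ultimately obtain r where "r > 0" "mball v r \<subseteq> mball v r0 - (L n - S)"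
      unfolding openin_mtopology by blast
    then show ?thesis using v(2) by blast
  qed
  show ?thesis
    unfolding openin_mtopology
  proof (intro conjI assms(2) allI impI)
    fix z assume z: "z \<in> V"
    then have z\<Omega>: "z \<in> \<Omega>" using assms by blast
    \<comment> \<open>\<open>\<phi> v\<close> sends \<open>v\<close> to \<open>c0\<close>, which
      \<open>\<phi> z\<close> sends to \<open>z\<close>; the two maps together cost a factor
      \<open>C * C\<close>.\<close>
    let ?S = "{y \<in> \<Omega>. \<phi> v y \<in> {w \<in> \<Omega>. \<phi> z w \<in> V}}"
    have "open ?S" using open_\<phi>_preimage[OF v(3) open_\<phi>_preimage[OF z\<Omega> assms(1)]] .
    moreover have "v \<in> ?S" using v(3) \<phi>_self base \<phi>_base z\<Omega> z by simp
    ultimately obtain r where r: "r > 0" "mball v r \<subseteq> ?S" using local by blast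
    show "\<exists>r>0. mball z r \<subseteq> V"
    proof (intro exI conjI subsetI)
      show "r / (C * C) > 0" using r C_ge by simp
      fix w assume w: "w \<in> mball z (r / (C * C))"
      then have w\<Omega>: "w \<in> \<Omega>" by simp
      let ?y = "\<phi> v (\<phi> z w)"
      have "d v ?y \<le> C * d c0 (\<phi> z w)"
        using d_\<phi>[of c0 "\<phi> z w" v] base \<phi>_in[OF z\<Omega> w\<Omega>] v(3) \<phi>_base by simp
      also have "\<dots> \<le> C * (C * d z w)"
        using d_\<phi>[of z w z] z\<Omega> w\<Omega> \<phi>_self C_ge by (intro mult_left_mono) auto
      also have "\<dots> < r" using w C_ge by (simp add: field_simps)
      finally have "?y \<in> mball v r" using v(3) \<phi>_in z\<Omega> w\<Omega> by simp
      then have "?y \<in> ?S" using r(2) by (rule rev_subsetD)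
      then show "w \<in> V" using \<phi>_inv \<phi>_in z\<Omega> w\<Omega> v(3) by simp
    qed
  qed
qed

lemma openin_mtopology_iff: "openin mtopology U \<longleftrightarrow> open U \<and> U \<subseteq> \<Omega>"
  using openin_imp_open open_imp_openin openin_subset by fastforce

lemma mtopology_eq: "mtopology = top_of_set \<Omega>"
  unfolding topology_eq openin_mtopology_iff openin_open_eq[OF open_dom] by blast

lemma compact_mcball: "z \<in> \<Omega> \<Longrightarrow> compact (mcball z r)"
  using cball_compact[of z r] unfolding mtopology_eq by (simp add: compactin_subtopology)

text \<open>If \<open>d\<close> were bounded, \<open>\<Omega>\<close> would be a single closed
  \<open>d\<close>-ball, hence Euclidean compact as well as open, which is impossible for a nonempty
  set.\<close>

lemma unbounded: "\<exists>z\<in>\<Omega>. d z c0 > R"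
proof (rule ccontr)
  assume "\<not> ?thesis"
  then have far: "d z c0 \<le> R" if "z \<in> \<Omega>" for z using that by (meson not_le)
  have "mcball c0 R = \<Omega>" using far base commute[of c0] by auto
  then have "compact \<Omega>" using compact_mcball[OF base] by metis
  moreover from this have "\<Omega> = UNIV"
    using open_dom base clopen[of \<Omega>] compact_imp_closed[of \<Omega>] by auto
  ultimately show False using not_compact_UNIV[where ?'a = 'a] by simp
qed

end

section \<open>Holomorphic and square-integrable functions\<close>

lemma cholo_on_const: "open S \<Longrightarrow> cholo_on (\<lambda>_. c) S"
  unfolding cholo_on_def by (auto intro!: exI[of _ "\<lambda>_. 0"])

lemma cholo_on_add:
  assumes "cholo_on f S" "cholo_on g S"
  shows "cholo_on (\<lambda>w. f w + g w) S"
  unfolding cholo_on_def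
proof (intro conjI ballI)
  show "open S" using assms(1) by (simp add: cholo_on_def)
  fix z assume z: "z \<in> S"
  obtain L where L: "(f has_derivative L) (at z)" "\<forall>(c::complex) x. L (c *s x) = c * L x"
    using assms(1) z unfolding cholo_on_def by auto
  obtain L' where L': "(g has_derivative L') (at z)" "\<forall>(c::complex) x. L' (c *s x) = c * L' x"
    using assms(2) z unfolding cholo_on_def by auto
  show "\<exists>L. ((\<lambda>w. f w + g w) has_derivative L) (at z) \<and> (\<forall>(c::complex) x. L (c *s x) = c * L x)"
    by (rule exI[of _ "\<lambda>h. L h + L' h"]) (use has_derivative_add[OF L(1) L'(1)] L(2) L'(2) in \<open>auto simp: algebra_simps\<close>)
qed

lemma cholo_on_mult:
  assumes "cholo_on f S" "cholo_on g S"
  shows "cholo_on (\<lambda>w. f w * g w) S"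
  unfolding cholo_on_def
proof (intro conjI ballI)
  show "open S" using assms(1) by (simp add: cholo_on_def)
  fix z assume z: "z \<in> S"
  obtain L where L: "(f has_derivative L) (at z)" "\<forall>(c::complex) x. L (c *s x) = c * L x"
    using assms(1) z unfolding cholo_on_def by auto
  obtain L' where L': "(g has_derivative L') (at z)" "\<forall>(c::complex) x. L' (c *s x) = c * L' x"
    using assms(2) z unfolding cholo_on_def by auto
  show "\<exists>L. ((\<lambda>w. f w * g w) has_derivative L) (at z) \<and> (\<forall>(c::complex) x. L (c *s x) = c * L x)"
    by (rule exI[of _ "\<lambda>h. f z * L' h + L h * g z"])
      (use has_derivative_mult[OF L(1) L'(1)] L(2) L'(2) in \<open>auto simp: algebra_simps\<close>)
qed

lemma cholo_on_cmult: "cholo_on f S \<Longrightarrow> cholo_on (\<lambda>w. c * f w) S"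
  by (rule cholo_on_mult[OF cholo_on_const]) (auto simp: cholo_on_def)

lemma cholo_on_inverse:
  assumes "cholo_on f S" "\<And>z. z \<in> S \<Longrightarrow> f z \<noteq> 0"
  shows "cholo_on (\<lambda>w. inverse (f w)) S"
  unfolding cholo_on_def
proof (intro conjI ballI)
  show "open S" using assms(1) by (simp add: cholo_on_def)
  fix z assume z: "z \<in> S"
  obtain L where L: "(f has_derivative L) (at z)" "\<forall>(c::complex) x. L (c *s x) = c * L x"
    using assms(1) z unfolding cholo_on_def by auto
  show "\<exists>L. ((\<lambda>w. inverse (f w)) has_derivative L) (at z) \<and> (\<forall>(c::complex) x. L (c *s x) = c * L x)"
    by (rule exI[of _ "\<lambda>h. - (inverse (f z) * L h * inverse (f z))"])
      (use Deriv.has_derivative_inverse[OF assms(2)[OF z] L(1)] L(2) in auto)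
qed

lemma cholo_on_cong:
  assumes "cholo_on f S" "\<And>z. z \<in> S \<Longrightarrow> f z = g z"
  shows "cholo_on g S"
  unfolding cholo_on_def
proof (intro conjI ballI)
  show S: "open S" using assms(1) by (simp add: cholo_on_def)
  fix z assume z: "z \<in> S"
  obtain L where L: "(f has_derivative L) (at z)" "\<forall>(c::complex) x. L (c *s x) = c * L x"
    using assms(1) z unfolding cholo_on_def by auto
  show "\<exists>L. (g has_derivative L) (at z) \<and> (\<forall>(c::complex) x. L (c *s x) = c * L x)"
    by (rule exI[of _ L]) (use has_derivative_transform_within_open[OF L(1) S z] assms(2) L(2) in auto)
qed

lemma has_derivative_vec_lambda:
  fixes F :: "complex ^ 'n::finite \<Rightarrow> complex ^ 'm::finite"
  assumes "\<And>i. ((\<lambda>w. F w $ i) has_derivative (\<lambda>h. L i h)) (at z)"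
  shows "(F has_derivative (\<lambda>h. \<chi> i. L i h)) (at z)"
proof -
  have "bounded_linear (\<lambda>x::complex. axis i x :: complex ^ 'm)" for i
  proof (rule bounded_linear_intro[where K = 1])
    show "axis i (x + y) = (axis i x + axis i y :: complex ^ 'm)" for x y
      by (simp add: axis_def vec_eq_iff)
    show "axis i (r *\<^sub>R x) = (r *\<^sub>R axis i x :: complex ^ 'm)" for r and x :: complex
      by (simp add: axis_def vec_eq_iff)
    show "norm (axis i x :: complex ^ 'm) \<le> norm x * 1" for x
      by (simp add: norm_vec_def L2_set_def axis_def if_distrib[where f = norm] if_distrib[where f = "\<lambda>x. x\<^sup>2"] cong: if_cong)
  qed
  then have "((\<lambda>w. \<Sum>i\<in>UNIV. axis i (F w $ i)) has_derivative (\<lambda>h. \<Sum>i\<in>UNIV. axis i (L i h))) (at z)"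
    by (intro has_derivative_sum bounded_linear.has_derivative[OF _ assms])
  moreover have "(\<Sum>i\<in>UNIV. axis i (v i)) = (\<chi> i. v i)" for v :: "'m \<Rightarrow> complex"
    by (simp add: vec_eq_iff axis_def if_distrib sum.delta cong: if_cong)
  ultimately show ?thesis by simp
qed

lemma cholo_on_compose:
  assumes f: "cholo_on f S" and F: "holo_map_on F S" and FS: "F ` S \<subseteq> S"
  shows "cholo_on (\<lambda>w. f (F w)) S"
  unfolding cholo_on_def
proof (intro conjI ballI)
  show "open S" using f by (simp add: cholo_on_def)
  fix z assume z: "z \<in> S"
  have "\<forall>i. \<exists>L. ((\<lambda>w. F w $ i) has_derivative L) (at z) \<and> (\<forall>(c::complex) x. L (c *s x) = c * L x)"
    using F z unfolding holo_map_on_def cholo_on_def by auto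
  then obtain M where M: "\<And>i. ((\<lambda>w. F w $ i) has_derivative M i) (at z)"
      "\<And>i (c::complex) x. M i (c *s x) = c * M i x" by metis
  have FD: "(F has_derivative (\<lambda>h. \<chi> i. M i h)) (at z)"
    by (rule has_derivative_vec_lambda[OF M(1)])
  obtain L where L: "(f has_derivative L) (at (F z))" "\<forall>(c::complex) x. L (c *s x) = c * L x"
  proof -
    have "F z \<in> S" using z FS by auto
    then show ?thesis using f that unfolding cholo_on_def by auto
  qed
  have "(\<chi> i. M i (c *s x)) = c *s (\<chi> i. M i x)" for c x
    by (simp add: M(2) vec_eq_iff)
  then show "\<exists>L. ((\<lambda>w. f (F w)) has_derivative L) (at z) \<and> (\<forall>(c::complex) x. L (c *s x) = c * L x)"
    by (intro exI[of _ "\<lambda>h. L (\<chi> i. M i h)"]) (use has_derivative_compose[OF FD L(1)] L(2) in auto)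
qed

lemma cholo_on_imp_continuous_on: "cholo_on f S \<Longrightarrow> continuous_on S f"
  unfolding cholo_on_def
  by (meson continuous_at_imp_continuous_on has_derivative_continuous)

lemma holo_map_on_imp_continuous_on: "holo_map_on F S \<Longrightarrow> continuous_on S F"
  unfolding holo_map_on_def
  using continuous_on_vec_lambda[of S "\<lambda>i w. F w $ i"] cholo_on_imp_continuous_on by auto

text \<open>These are functions, not classes modulo null sets, so \<open>bnorm\<close> is only a
  seminorm here; it becomes a norm on \<open>bspace\<close>, where point evaluations are
  bounded.\<close>

definition sqint :: "'n::finite pt measure \<Rightarrow> 'n fn set" where
  "sqint \<sigma> = {f \<in> borel_measurable \<sigma>. integrable \<sigma> (\<lambda>z. (cmod (f z))\<^sup>2)}"

lemma sqint_measurable [measurable_dest]: "f \<in> sqint \<sigma> \<Longrightarrow> f \<in> borel_measurable \<sigma>"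
  by (simp add: sqint_def)

lemma sqint_integrable: "f \<in> sqint \<sigma> \<Longrightarrow> integrable \<sigma> (\<lambda>z. (cmod (f z))\<^sup>2)"
  by (simp add: sqint_def)

lemma sqint_mult_integrable:
  assumes "f \<in> sqint \<sigma>" "g \<in> sqint \<sigma>"
  shows "integrable \<sigma> (\<lambda>z. cmod (f z) * cmod (g z))"
proof (rule Bochner_Integration.integrable_bound)
  show "integrable \<sigma> (\<lambda>z. (cmod (f z))\<^sup>2 + (cmod (g z))\<^sup>2)"
    using assms by (simp add: sqint_integrable)
  show "(\<lambda>z. cmod (f z) * cmod (g z)) \<in> borel_measurable \<sigma>"
    using assms by (auto dest!: sqint_measurable)
  show "AE z in \<sigma>. norm (cmod (f z) * cmod (g z)) \<le> norm ((cmod (f z))\<^sup>2 + (cmod (g z))\<^sup>2)"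
  proof (rule AE_I2)
    fix z
    have "2 * (cmod (f z) * cmod (g z)) \<le> (cmod (f z))\<^sup>2 + (cmod (g z))\<^sup>2"
      using sum_squares_bound[of "cmod (f z)" "cmod (g z)"] by (simp add: mult.assoc)
    moreover have "0 \<le> cmod (f z) * cmod (g z)" by simp
    ultimately show "norm (cmod (f z) * cmod (g z)) \<le> norm ((cmod (f z))\<^sup>2 + (cmod (g z))\<^sup>2)"
      by (simp only: real_norm_def abs_of_nonneg sum_power2_ge_zero)
  qed
qed

lemma ip_integrable:
  assumes "f \<in> sqint \<sigma>" "g \<in> sqint \<sigma>"
  shows "integrable \<sigma> (\<lambda>z. f z * cnj (g z))"
proof (rule Bochner_Integration.integrable_bound[OF sqint_mult_integrable[OF assms]])
  have [measurable]: "f \<in> borel_measurable \<sigma>" "g \<in> borel_measurable \<sigma>"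
    using assms by (auto dest!: sqint_measurable)
  have "(\<lambda>z. cnj (g z)) \<in> borel_measurable \<sigma>"
    by (rule borel_measurable_continuous_on[where f = cnj]) (auto intro: continuous_intros)
  then show "(\<lambda>z. f z * cnj (g z)) \<in> borel_measurable \<sigma>" by measurable
qed (simp add: norm_mult)

lemma bnorm_nonneg [simp]: "bnorm \<sigma> f \<ge> 0"
  by (simp add: bnorm_def)

lemma bnorm_sq: "(bnorm \<sigma> f)\<^sup>2 = (\<integral>z. (cmod (f z))\<^sup>2 \<partial>\<sigma>)"
  by (simp add: bnorm_def)

lemma nn_bnorm: "f \<in> sqint \<sigma> \<Longrightarrow> (\<integral>\<^sup>+z. ennreal ((cmod (f z))\<^sup>2) \<partial>\<sigma>) = ennreal ((bnorm \<sigma> f)\<^sup>2)"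
  unfolding bnorm_sq by (rule nn_integral_eq_integral) (auto simp: sqint_integrable)

lemma sqintI_nn:
  assumes "f \<in> borel_measurable \<sigma>" "(\<integral>\<^sup>+z. ennreal ((cmod (f z))\<^sup>2) \<partial>\<sigma>) \<le> ennreal (c\<^sup>2)" "c \<ge> 0"
  shows "f \<in> sqint \<sigma>" "bnorm \<sigma> f \<le> c"
proof -
  have "integrable \<sigma> (\<lambda>z. (cmod (f z))\<^sup>2)"
    using assms by (intro integrableI_bounded) (auto intro: le_less_trans)
  then show f: "f \<in> sqint \<sigma>" using assms(1) by (simp add: sqint_def)
  have "(bnorm \<sigma> f)\<^sup>2 \<le> c\<^sup>2" using assms(2) unfolding nn_bnorm[OF f] by (simp add: ennreal_le_iff)
  then show "bnorm \<sigma> f \<le> c" using assms(3) by (rule power2_le_imp_le)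
qed

lemma sqint_add:
  assumes "f \<in> sqint \<sigma>" "g \<in> sqint \<sigma>"
  shows "(\<lambda>z. f z + g z) \<in> sqint \<sigma>"
proof -
  have [measurable]: "f \<in> borel_measurable \<sigma>" "g \<in> borel_measurable \<sigma>"
    using assms by (auto dest!: sqint_measurable)
  have "integrable \<sigma> (\<lambda>z. (cmod (f z + g z))\<^sup>2)"
  proof (rule Bochner_Integration.integrable_bound)
    show "integrable \<sigma> (\<lambda>z. 2 * (cmod (f z))\<^sup>2 + 2 * (cmod (g z))\<^sup>2)"
      using assms by (simp add: sqint_integrable)
    show "AE z in \<sigma>. norm ((cmod (f z + g z))\<^sup>2) \<le> norm (2 * (cmod (f z))\<^sup>2 + 2 * (cmod (g z))\<^sup>2)"
    proof (rule AE_I2)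
      fix z
      have "(cmod (f z + g z))\<^sup>2 \<le> (cmod (f z) + cmod (g z))\<^sup>2"
        by (intro power_mono norm_triangle_ineq) simp
      also have "\<dots> \<le> 2 * (cmod (f z))\<^sup>2 + 2 * (cmod (g z))\<^sup>2"
        using sum_squares_bound[of "cmod (f z)" "cmod (g z)"] by (simp add: power2_sum)
      finally show "norm ((cmod (f z + g z))\<^sup>2) \<le> norm (2 * (cmod (f z))\<^sup>2 + 2 * (cmod (g z))\<^sup>2)"
        by simp
    qed
  qed measurable
  then show ?thesis by (simp add: sqint_def)
qed

lemma sqint_cmult: "f \<in> sqint \<sigma> \<Longrightarrow> (\<lambda>z. c * f z) \<in> sqint \<sigma>"
  by (auto simp: sqint_def norm_mult power_mult_distrib)

lemma sqint_diff: "f \<in> sqint \<sigma> \<Longrightarrow> g \<in> sqint \<sigma> \<Longrightarrow> (\<lambda>z. f z - g z) \<in> sqint \<sigma>"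
  using sqint_add[of f \<sigma> "\<lambda>z. -1 * g z"] sqint_cmult[of g \<sigma> "-1"] by simp

lemma sqint_zero: "(\<lambda>_. 0) \<in> sqint \<sigma>"
  by (simp add: sqint_def)

lemma ip_add_left:
  "f \<in> sqint \<sigma> \<Longrightarrow> g \<in> sqint \<sigma> \<Longrightarrow> h \<in> sqint \<sigma> \<Longrightarrow> ip \<sigma> (\<lambda>z. f z + g z) h = ip \<sigma> f h + ip \<sigma> g h"
  unfolding ip_def by (simp add: distrib_right ip_integrable)

lemma ip_diff_left:
  "f \<in> sqint \<sigma> \<Longrightarrow> g \<in> sqint \<sigma> \<Longrightarrow> h \<in> sqint \<sigma> \<Longrightarrow> ip \<sigma> (\<lambda>z. f z - g z) h = ip \<sigma> f h - ip \<sigma> g h"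
  unfolding ip_def by (simp add: left_diff_distrib ip_integrable)

lemma ip_cmult_left: "ip \<sigma> (\<lambda>z. c * f z) h = c * ip \<sigma> f h"
  unfolding ip_def by (simp add: mult.assoc)

lemma ip_cnj: "ip \<sigma> g f = cnj (ip \<sigma> f g)"
  unfolding ip_def by (subst Bochner_Integration.integral_cnj[symmetric]) (simp add: mult.commute)

lemma ip_add_right:
  "f \<in> sqint \<sigma> \<Longrightarrow> g \<in> sqint \<sigma> \<Longrightarrow> h \<in> sqint \<sigma> \<Longrightarrow> ip \<sigma> h (\<lambda>z. f z + g z) = ip \<sigma> h f + ip \<sigma> h g"
  by (subst (1 2 3) ip_cnj) (simp add: ip_add_left)

lemma ip_diff_right:
  "f \<in> sqint \<sigma> \<Longrightarrow> g \<in> sqint \<sigma> \<Longrightarrow> h \<in> sqint \<sigma> \<Longrightarrow> ip \<sigma> h (\<lambda>z. f z - g z) = ip \<sigma> h f - ip \<sigma> h g"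
  by (subst (1 2 3) ip_cnj) (simp add: ip_diff_left)

lemma ip_cmult_right: "ip \<sigma> h (\<lambda>z. c * f z) = cnj c * ip \<sigma> h f"
  by (subst (1 2) ip_cnj) (simp add: ip_cmult_left)

lemma ip_self: "ip \<sigma> f f = complex_of_real ((bnorm \<sigma> f)\<^sup>2)"
  unfolding ip_def bnorm_sq by (simp flip: integral_complex_of_real add: complex_norm_square[symmetric])

lemma integral_mult_le_bnorm:
  assumes "f \<in> sqint \<sigma>" "g \<in> sqint \<sigma>"
  shows "(\<integral>z. cmod (f z) * cmod (g z) \<partial>\<sigma>) \<le> bnorm \<sigma> f * bnorm \<sigma> g"
proof -
  have [measurable]: "f \<in> borel_measurable \<sigma>" "g \<in> borel_measurable \<sigma>"
    using assms by (auto dest!: sqint_measurable)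
  let ?I = "\<integral>z. cmod (f z) * cmod (g z) \<partial>\<sigma>"
  have I: "ennreal ?I = (\<integral>\<^sup>+z. ennreal (cmod (f z)) * ennreal (cmod (g z)) \<partial>\<sigma>)"
    by (subst nn_integral_eq_integral[symmetric]) (auto simp: sqint_mult_integrable[OF assms] ennreal_mult)
  have "ennreal (?I\<^sup>2) = (ennreal ?I)\<^sup>2" by (simp add: ennreal_power)
  also have "\<dots> \<le> (\<integral>\<^sup>+z. (ennreal (cmod (f z)))\<^sup>2 \<partial>\<sigma>) * (\<integral>\<^sup>+z. (ennreal (cmod (g z)))\<^sup>2 \<partial>\<sigma>)"
    unfolding I by (rule Cauchy_Schwarz_nn_integral) measurable
  also have "\<dots> = ennreal ((bnorm \<sigma> f)\<^sup>2) * ennreal ((bnorm \<sigma> g)\<^sup>2)"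
    by (simp add: ennreal_power nn_bnorm[OF assms(1)] nn_bnorm[OF assms(2)])
  also have "\<dots> = ennreal ((bnorm \<sigma> f * bnorm \<sigma> g)\<^sup>2)"
    by (simp add: ennreal_mult power_mult_distrib)
  finally have "?I\<^sup>2 \<le> (bnorm \<sigma> f * bnorm \<sigma> g)\<^sup>2" by (simp add: ennreal_le_iff)
  then show ?thesis by (rule power2_le_imp_le) simp
qed

lemma norm_ip_le:
  assumes "f \<in> sqint \<sigma>" "g \<in> sqint \<sigma>"
  shows "cmod (ip \<sigma> f g) \<le> bnorm \<sigma> f * bnorm \<sigma> g"
proof -
  have "cmod (ip \<sigma> f g) \<le> (\<integral>z. cmod (f z * cnj (g z)) \<partial>\<sigma>)"
    unfolding ip_def by (rule integral_norm_bound)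
  also have "\<dots> \<le> bnorm \<sigma> f * bnorm \<sigma> g"
    using integral_mult_le_bnorm[OF assms] by (simp add: norm_mult)
  finally show ?thesis .
qed

lemma bnorm_add_sq:
  assumes "f \<in> sqint \<sigma>" "g \<in> sqint \<sigma>"
  shows "(bnorm \<sigma> (\<lambda>z. f z + g z))\<^sup>2 = (bnorm \<sigma> f)\<^sup>2 + 2 * Re (ip \<sigma> f g) + (bnorm \<sigma> g)\<^sup>2"
proof -
  have "complex_of_real ((bnorm \<sigma> (\<lambda>z. f z + g z))\<^sup>2)
      = ip \<sigma> f f + ip \<sigma> f g + (ip \<sigma> g f + ip \<sigma> g g)"
    unfolding ip_self[symmetric] using assms
    by (simp add: ip_add_left ip_add_right sqint_add)
  also have "\<dots> = complex_of_real ((bnorm \<sigma> f)\<^sup>2 + 2 * Re (ip \<sigma> f g) + (bnorm \<sigma> g)\<^sup>2)"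
    by (simp add: ip_self ip_cnj[of \<sigma> g f] complex_eq_iff)
  finally show ?thesis by (simp only: of_real_eq_iff)
qed

lemma bnorm_cmult: "bnorm \<sigma> (\<lambda>z. c * f z) = cmod c * bnorm \<sigma> f"
  by (simp add: bnorm_def norm_mult power_mult_distrib real_sqrt_mult)

lemma bnorm_diff_sq:
  assumes "f \<in> sqint \<sigma>" "g \<in> sqint \<sigma>"
  shows "(bnorm \<sigma> (\<lambda>z. f z - g z))\<^sup>2 = (bnorm \<sigma> f)\<^sup>2 - 2 * Re (ip \<sigma> f g) + (bnorm \<sigma> g)\<^sup>2"
  using bnorm_add_sq[OF assms(1) sqint_cmult[OF assms(2), of "-1"]]
    ip_cmult_right[of \<sigma> f "-1" g] bnorm_cmult[of \<sigma> "-1" g] by simp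

lemma bnorm_triangle:
  assumes "f \<in> sqint \<sigma>" "g \<in> sqint \<sigma>"
  shows "bnorm \<sigma> (\<lambda>z. f z + g z) \<le> bnorm \<sigma> f + bnorm \<sigma> g"
proof (rule power2_le_imp_le)
  have "Re (ip \<sigma> f g) \<le> bnorm \<sigma> f * bnorm \<sigma> g"
    using complex_Re_le_cmod norm_ip_le[OF assms] by (rule order_trans)
  then show "(bnorm \<sigma> (\<lambda>z. f z + g z))\<^sup>2 \<le> (bnorm \<sigma> f + bnorm \<sigma> g)\<^sup>2"
    unfolding bnorm_add_sq[OF assms] by (simp add: power2_sum)
qed simp

lemma bnorm_minus_commute: "bnorm \<sigma> (\<lambda>z. f z - g z) = bnorm \<sigma> (\<lambda>z. g z - f z)"
  by (simp add: bnorm_def norm_minus_commute)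

lemma bnorm_triangle_diff:
  assumes "f \<in> sqint \<sigma>" "g \<in> sqint \<sigma>" "h \<in> sqint \<sigma>"
  shows "bnorm \<sigma> (\<lambda>z. f z - h z) \<le> bnorm \<sigma> (\<lambda>z. f z - g z) + bnorm \<sigma> (\<lambda>z. g z - h z)"
  using bnorm_triangle[OF sqint_diff[OF assms(1,2)] sqint_diff[OF assms(2,3)]] by simp

lemma bnorm_le_diff:
  assumes "f \<in> sqint \<sigma>" "g \<in> sqint \<sigma>"
  shows "bnorm \<sigma> f \<le> bnorm \<sigma> (\<lambda>z. f z - g z) + bnorm \<sigma> g"
  using bnorm_triangle[OF sqint_diff[OF assms] assms(2)] by simp

lemma bnorm_diff_le:
  assumes "f \<in> sqint \<sigma>" "g \<in> sqint \<sigma>"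
  shows "bnorm \<sigma> (\<lambda>z. f z - g z) \<le> bnorm \<sigma> f + bnorm \<sigma> g"
  using bnorm_triangle[OF assms(1) sqint_cmult[OF assms(2), of "-1"]] bnorm_cmult[of \<sigma> "-1" g] by simp

lemma bnorm_zero [simp]: "bnorm \<sigma> (\<lambda>_. 0) = 0"
  by (simp add: bnorm_def)

section \<open>The reproducing kernel Hilbert space\<close>

locale bergman =
  fixes \<Omega> :: "('n::finite) pt set" and d :: "'n pt \<Rightarrow> 'n pt \<Rightarrow> real"
    and \<sigma> :: "'n pt measure" and \<phi> :: "'n pt \<Rightarrow> 'n pt \<Rightarrow> 'n pt"
    and K :: "'n pt \<Rightarrow> 'n fn" and \<kappa> :: real
  assumes bergman: "bergman_type \<Omega> d \<sigma> \<phi> K \<kappa>"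
begin

abbreviation "B \<equiv> bspace \<Omega> \<sigma>"
abbreviation "nK z \<equiv> bnorm \<sigma> (K z)"
abbreviation "Lm \<equiv> lam \<sigma> K"
abbreviation "Db \<equiv> Metric_space.mball \<Omega> d"
abbreviation "U \<equiv> transl \<Omega> \<sigma> \<phi> K"

lemma open_dom: "open \<Omega>" and base: "0 \<in> \<Omega>"
  and metric: "Metric_space \<Omega> d"
  and \<phi>_image: "z \<in> \<Omega> \<Longrightarrow> \<phi> z ` \<Omega> \<subseteq> \<Omega>"
  and \<phi>_holo: "z \<in> \<Omega> \<Longrightarrow> holo_map_on (\<phi> z) \<Omega>"
  and \<phi>_inv: "z \<in> \<Omega> \<Longrightarrow> w \<in> \<Omega> \<Longrightarrow> \<phi> z (\<phi> z w) = w"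
  and \<phi>_base: "z \<in> \<Omega> \<Longrightarrow> \<phi> z 0 = z"
  and sets_\<sigma>: "sets \<sigma> = sets (restrict_space borel \<Omega>)"
  and finite_\<sigma>: "finite_measure \<sigma>"
  and K_in: "z \<in> \<Omega> \<Longrightarrow> K z \<in> B"
  and reproducing: "z \<in> \<Omega> \<Longrightarrow> f \<in> B \<Longrightarrow> f z = ip \<sigma> f (K z)"
  and ball_sets: "z \<in> \<Omega> \<Longrightarrow> Db z r \<in> sets \<sigma>"
  and \<kappa>_range: "0 \<le> \<kappa>" "\<kappa> < 2"
  and rudin_forelli_pos: "\<kappa> > 0 \<Longrightarrow> \<kappa> < r \<Longrightarrow> 0 < s \<Longrightarrow> s < \<kappa> \<Longrightarrow> rudin_forelli \<Omega> \<sigma> K r s"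
  and rudin_forelli_zero: "\<kappa> = 0 \<Longrightarrow> r > 0 \<Longrightarrow> rudin_forelli \<Omega> \<sigma> K r r"
  using bergman unfolding bergman_type_def by - (elim conjE; simp; fail)+

lemma complete:
  assumes "\<And>n. X n \<in> B" "\<And>e. e > 0 \<Longrightarrow> \<exists>N. \<forall>m\<ge>N. \<forall>n\<ge>N. bnorm \<sigma> (\<lambda>w. X m w - X n w) < e"
  obtains g where "g \<in> B" "(\<lambda>n. bnorm \<sigma> (\<lambda>w. X n w - g w)) \<longlonglongrightarrow> 0"
proof -
  have "\<forall>X. (\<forall>n. X n \<in> B) \<and>
          (\<forall>e>0. \<exists>N. \<forall>m\<ge>N. \<forall>n\<ge>N. bnorm \<sigma> (\<lambda>w. X m w - X n w) < e) \<longrightarrow>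
          (\<exists>g\<in>B. (\<lambda>n. bnorm \<sigma> (\<lambda>w. X n w - g w)) \<longlonglongrightarrow> 0)"
    using bergman unfolding bergman_type_def by (elim conjE)
  then have "\<exists>g\<in>B. (\<lambda>n. bnorm \<sigma> (\<lambda>w. X n w - g w)) \<longlonglongrightarrow> 0" using assms by simp
  then show ?thesis using that by blast
qed

lemma norm_K_unbounded: "\<exists>R. \<forall>z\<in>\<Omega>. d z 0 > R \<longrightarrow> nK z > M"
  using bergman unfolding bergman_type_def by (elim conjE) simp

lemma ex_constant:
  "\<exists>C\<ge>1.
     (\<forall>u\<in>\<Omega>. \<forall>v\<in>\<Omega>. \<forall>z\<in>\<Omega>. d (\<phi> z u) (\<phi> z v) \<le> C * d u v) \<and>
     (\<forall>z\<in>\<Omega>. \<forall>E\<in>sets \<sigma>. emeasure Lm (\<phi> z ` E) \<le> ennreal C * emeasure Lm E) \<and>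
     (\<forall>z\<in>\<Omega>. \<forall>r>0. emeasure Lm (Db z (2 * r)) \<le> ennreal C * emeasure Lm (Db z r)) \<and>
     (\<forall>z\<in>\<Omega>. \<forall>w\<in>\<Omega>. cmod (ip \<sigma> (kn \<sigma> K z) (kn \<sigma> K w)) \<le> C * (1 / nK (\<phi> z w)) \<and>
         1 / nK (\<phi> z w) \<le> C * cmod (ip \<sigma> (kn \<sigma> K z) (kn \<sigma> K w)))"
proof -
  obtain C1 where C1: "\<forall>u\<in>\<Omega>. \<forall>v\<in>\<Omega>. \<forall>z\<in>\<Omega>.
         d u v \<le> C1 * d (\<phi> z u) (\<phi> z v) \<and> d (\<phi> z u) (\<phi> z v) \<le> C1 * d u v"
    using bergman unfolding bergman_type_def by (elim conjE exE)
  obtain C2 where C2: "\<forall>z\<in>\<Omega>. \<forall>E\<in>sets \<sigma>.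
         emeasure Lm E \<le> ennreal C2 * emeasure Lm (\<phi> z ` E) \<and>
         emeasure Lm (\<phi> z ` E) \<le> ennreal C2 * emeasure Lm E"
    using bergman unfolding bergman_type_def by (elim conjE exE)
  obtain C3 where C3: "\<forall>z\<in>\<Omega>. \<forall>r>0.
      emeasure Lm (Db z (2 * r)) \<le> ennreal C3 * emeasure Lm (Db z r)"
    using bergman unfolding bergman_type_def by (elim conjE exE)
  obtain C4 where C4: "\<forall>z\<in>\<Omega>. \<forall>w\<in>\<Omega>.
         cmod (ip \<sigma> (kn \<sigma> K z) (kn \<sigma> K w)) \<le> C4 * (1 / nK (\<phi> z w)) \<and>
         1 / nK (\<phi> z w) \<le> C4 * cmod (ip \<sigma> (kn \<sigma> K z) (kn \<sigma> K w))"
    using bergman unfolding bergman_type_def by (elim conjE exE)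
  define C where "C = max 1 (max C1 (max C2 (max C3 C4)))"
  have C: "C \<ge> 1" "C \<ge> C1" "C \<ge> C2" "C \<ge> C3" "C \<ge> C4" by (auto simp: C_def)
  interpret Metric_space \<Omega> d by (rule metric)
  have "d (\<phi> z u) (\<phi> z v) \<le> C * d u v" if "u \<in> \<Omega>" "v \<in> \<Omega>" "z \<in> \<Omega>" for u v z
    using C1 that mult_right_mono[OF C(2) nonneg[of u v]] by (meson order_trans)
  moreover have "emeasure Lm (\<phi> z ` E) \<le> ennreal C * emeasure Lm E" if "z \<in> \<Omega>" "E \<in> sets \<sigma>" for z E
    using C2 that mult_right_mono[OF ennreal_leI[OF C(3)], of "emeasure Lm E"] by (meson order_trans zero_le)
  moreover have "emeasure Lm (Db z (2 * r)) \<le> ennreal C * emeasure Lm (Db z r)" if "z \<in> \<Omega>" "r > 0" for z r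
    using C3 that mult_right_mono[OF ennreal_leI[OF C(4)], of "emeasure Lm (Db z r)"] by (meson order_trans zero_le)
  moreover have "cmod (ip \<sigma> (kn \<sigma> K z) (kn \<sigma> K w)) \<le> C * (1 / nK (\<phi> z w))" if "z \<in> \<Omega>" "w \<in> \<Omega>" for z w
    using C4 that mult_right_mono[OF C(5), of "1 / nK (\<phi> z w)"] by (meson order_trans zero_le_divide_1_iff bnorm_nonneg)
  moreover have "1 / nK (\<phi> z w) \<le> C * cmod (ip \<sigma> (kn \<sigma> K z) (kn \<sigma> K w))" if "z \<in> \<Omega>" "w \<in> \<Omega>" for z w
    using C4 that mult_right_mono[OF C(5), of "cmod (ip \<sigma> (kn \<sigma> K z) (kn \<sigma> K w))"] by (meson order_trans norm_ge_zero)
  ultimately show ?thesis using C(1) by (intro exI[of _ C]) simp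
qed

text \<open>Fixed by the space alone, which gives the uniformity in \<open>T\<close> and
  \<open>p\<close> of the norm equivalence. For \<open>d\<close> and for \<lambda> one inequality is
  recorded; the reverse one follows because each \<open>\<phi> z\<close> is an involution.\<close>

definition "C = (SOME C. C \<ge> 1 \<and>
     (\<forall>u\<in>\<Omega>. \<forall>v\<in>\<Omega>. \<forall>z\<in>\<Omega>. d (\<phi> z u) (\<phi> z v) \<le> C * d u v) \<and>
     (\<forall>z\<in>\<Omega>. \<forall>E\<in>sets \<sigma>. emeasure Lm (\<phi> z ` E) \<le> ennreal C * emeasure Lm E) \<and>
     (\<forall>z\<in>\<Omega>. \<forall>r>0. emeasure Lm (Db z (2 * r)) \<le> ennreal C * emeasure Lm (Db z r)) \<and>
     (\<forall>z\<in>\<Omega>. \<forall>w\<in>\<Omega>. cmod (ip \<sigma> (kn \<sigma> K z) (kn \<sigma> K w)) \<le> C * (1 / nK (\<phi> z w)) \<and>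
         1 / nK (\<phi> z w) \<le> C * cmod (ip \<sigma> (kn \<sigma> K z) (kn \<sigma> K w))))"

lemma C_ge: "C \<ge> 1"
  and d_\<phi>: "u \<in> \<Omega> \<Longrightarrow> v \<in> \<Omega> \<Longrightarrow> z \<in> \<Omega> \<Longrightarrow> d (\<phi> z u) (\<phi> z v) \<le> C * d u v"
  and emeasure_\<phi>: "z \<in> \<Omega> \<Longrightarrow> E \<in> sets \<sigma> \<Longrightarrow> emeasure Lm (\<phi> z ` E) \<le> ennreal C * emeasure Lm E"
  and doubling: "z \<in> \<Omega> \<Longrightarrow> r > 0 \<Longrightarrow> emeasure Lm (Db z (2 * r)) \<le> ennreal C * emeasure Lm (Db z r)"
  and ip_kn_le: "z \<in> \<Omega> \<Longrightarrow> w \<in> \<Omega> \<Longrightarrow> cmod (ip \<sigma> (kn \<sigma> K z) (kn \<sigma> K w)) \<le> C * (1 / nK (\<phi> z w))"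
  and ip_kn_ge: "z \<in> \<Omega> \<Longrightarrow> w \<in> \<Omega> \<Longrightarrow> 1 / nK (\<phi> z w) \<le> C * cmod (ip \<sigma> (kn \<sigma> K z) (kn \<sigma> K w))"
  using someI_ex[OF ex_constant, folded C_def] by simp_all

lemma \<phi>_in: "z \<in> \<Omega> \<Longrightarrow> w \<in> \<Omega> \<Longrightarrow> \<phi> z w \<in> \<Omega>"
  using \<phi>_image by (simp add: image_subset_iff)

lemma \<phi>_cont: "z \<in> \<Omega> \<Longrightarrow> continuous_on \<Omega> (\<phi> z)"
  by (rule holo_map_on_imp_continuous_on[OF \<phi>_holo])

lemma space_\<sigma>: "space \<sigma> = \<Omega>"
  using sets_eq_imp_space_eq[OF sets_\<sigma>] by (simp add: space_restrict_space)

lemma borel_dom: "\<Omega> \<in> sets borel"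
  using open_dom by simp

lemma sets_\<sigma>_iff: "E \<in> sets \<sigma> \<longleftrightarrow> E \<in> sets borel \<and> E \<subseteq> \<Omega>"
  unfolding sets_\<sigma> by (subst sets_restrict_space_iff) (auto simp: borel_dom)

sublocale hm: homogeneous_metric \<Omega> d \<phi> 0 C
proof -
  interpret Metric_space \<Omega> d by (rule metric)
  show "homogeneous_metric \<Omega> d \<phi> 0 C"
  proof (unfold_locales, goal_cases)
    case (9)
    show ?case using bergman unfolding bergman_type_def by (elim conjE)
  next
    case (10 z r)
    then show ?case using ball_sets sets_\<sigma>_iff by simp
  next
    case (11 z r)
    have "\<forall>z\<in>\<Omega>. \<forall>r. compactin mtopology (mcball z r)"
      using bergman unfolding bergman_type_def by (elim conjE)
    then show ?case using 11 by simp
  qed (use open_dom base \<phi>_in \<phi>_cont \<phi>_inv \<phi>_base C_ge d_\<phi> in auto)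
qed

lemma B_holo: "f \<in> B \<Longrightarrow> cholo_on f \<Omega>"
  and B_sqint: "f \<in> B \<Longrightarrow> f \<in> sqint \<sigma>"
  and B_off: "f \<in> B \<Longrightarrow> z \<notin> \<Omega> \<Longrightarrow> f z = 0"
  by (simp_all add: bspace_def sqint_def)

lemma B_continuous: "f \<in> B \<Longrightarrow> continuous_on \<Omega> f"
  by (rule cholo_on_imp_continuous_on[OF B_holo])

lemma measurable_\<sigma>_continuous:
  "continuous_on \<Omega> (f :: _ \<Rightarrow> 'b::topological_space) \<Longrightarrow> f \<in> borel_measurable \<sigma>"
  using borel_measurable_continuous_on_restrict[of \<Omega> f] measurable_cong_sets[OF sets_\<sigma> refl] by auto

lemma BI:
  assumes "cholo_on f \<Omega>" "\<And>z. z \<notin> \<Omega> \<Longrightarrow> f z = 0" "f \<in> sqint \<sigma>"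
  shows "f \<in> B"
  using assms by (simp add: bspace_def sqint_def)

lemma B_add: "f \<in> B \<Longrightarrow> g \<in> B \<Longrightarrow> (\<lambda>w. f w + g w) \<in> B"
  by (rule BI) (simp_all add: cholo_on_add sqint_add B_holo B_sqint B_off)

lemma B_cmult: "f \<in> B \<Longrightarrow> (\<lambda>w. c * f w) \<in> B"
  by (rule BI) (simp_all add: cholo_on_cmult sqint_cmult B_holo B_sqint B_off)

lemma B_diff: "f \<in> B \<Longrightarrow> g \<in> B \<Longrightarrow> (\<lambda>w. f w - g w) \<in> B"
  using B_add[of f "\<lambda>w. -1 * g w"] B_cmult[of g "-1"] by simp

lemma B_zero: "(\<lambda>_. 0) \<in> B"
  by (rule BI) (simp_all add: cholo_on_const sqint_zero open_dom)

lemma eval_le: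
  assumes "f \<in> B" "z \<in> \<Omega>"
  shows "cmod (f z) \<le> bnorm \<sigma> f * nK z"
  using norm_ip_le[OF B_sqint[OF assms(1)] B_sqint[OF K_in[OF assms(2)]]]
  by (simp add: reproducing[OF assms(2,1)])

lemma B_eqI:
  assumes "f \<in> B" "g \<in> B" "\<And>z. z \<in> \<Omega> \<Longrightarrow> f z = g z"
  shows "f = g"
proof
  show "f z = g z" for z
    using assms B_off[of f z] B_off[of g z] by (cases "z \<in> \<Omega>") auto
qed

lemma B_eq_ipI:
  assumes "f \<in> B" "g \<in> B" "\<And>h. h \<in> B \<Longrightarrow> ip \<sigma> h f = ip \<sigma> h g"
  shows "f = g"
proof (rule B_eqI[OF assms(1,2)])
  fix z assume z: "z \<in> \<Omega>"
  show "f z = g z"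
    using reproducing[OF z assms(1)] reproducing[OF z assms(2)] assms(3)[OF K_in[OF z]]
    by (simp add: ip_cnj[of \<sigma> _ "K z"])
qed

section \<open>The constant function and the non-vanishing of the kernel\<close>

definition "one = (\<lambda>w. if w \<in> \<Omega> then 1 else 0 :: complex)"

lemma one_in: "one \<in> B"
proof (rule BI)
  show "cholo_on one \<Omega>"
    by (rule cholo_on_cong[OF cholo_on_const[OF open_dom, of 1]]) (simp add: one_def)
  have "one \<in> borel_measurable \<sigma>"
    by (rule measurable_\<sigma>_continuous) (simp add: one_def cong: continuous_on_cong)
  moreover have "integrable \<sigma> (\<lambda>z. (cmod (one z))\<^sup>2)"
    using finite_measure.integrable_const[OF finite_\<sigma>, of "1::real"]
    by (rule Bochner_Integration.integrable_cong[THEN iffD1, rotated -1]) (auto simp: one_def space_\<sigma>)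
  ultimately show "one \<in> sqint \<sigma>" by (simp add: sqint_def)
qed (simp add: one_def)

text \<open>Since \<sigma> is finite, the constant function lies in the space; evaluating it keeps
  \<open>nK z\<close> uniformly away from zero.\<close>

lemma one_le: "z \<in> \<Omega> \<Longrightarrow> 1 \<le> bnorm \<sigma> one * nK z"
  using eval_le[OF one_in, of z] by (simp add: one_def)

lemma n_pos: "z \<in> \<Omega> \<Longrightarrow> nK z > 0"
  using one_le[of z] bnorm_nonneg[of \<sigma> "K z"] by (cases "nK z = 0") (auto simp: less_le)

lemma inverse_n_le: "z \<in> \<Omega> \<Longrightarrow> 1 / nK z \<le> bnorm \<sigma> one"
  using one_le[of z] n_pos[of z] by (simp add: field_simps)

lemma bnorm_one_pos: "bnorm \<sigma> one > 0"
  using one_le[OF base] bnorm_nonneg[of \<sigma> one] by (cases "bnorm \<sigma> one = 0") (auto simp: less_le)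

lemma K_sym: "z \<in> \<Omega> \<Longrightarrow> w \<in> \<Omega> \<Longrightarrow> K z w = cnj (K w z)"
  using reproducing[of w "K z"] reproducing[of z "K w"] K_in ip_cnj[of \<sigma> "K z" "K w"] by simp

lemma K_diag: "z \<in> \<Omega> \<Longrightarrow> K z z = complex_of_real ((nK z)\<^sup>2)"
  using reproducing[of z "K z"] K_in ip_self by simp

lemma cmod_ip_K: "z \<in> \<Omega> \<Longrightarrow> w \<in> \<Omega> \<Longrightarrow> cmod (ip \<sigma> (K z) (K w)) = cmod (K z w)"
  using reproducing[of w "K z"] K_in by simp

lemma cmod_ip_kn:
  assumes "z \<in> \<Omega>" "w \<in> \<Omega>"
  shows "cmod (ip \<sigma> (kn \<sigma> K z) (kn \<sigma> K w)) = cmod (K z w) / (nK z * nK w)"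
proof -
  have k: "kn \<sigma> K z = (\<lambda>u. complex_of_real (1 / nK z) * K z u)" for z
    by (simp add: kn_def)
  show ?thesis unfolding k ip_cmult_left ip_cmult_right
    using assms by (simp add: norm_mult cmod_ip_K norm_divide)
qed

lemma K_le: "z \<in> \<Omega> \<Longrightarrow> w \<in> \<Omega> \<Longrightarrow> cmod (K z w) \<le> C * (nK z * nK w / nK (\<phi> z w))"
  using ip_kn_le[of z w] n_pos[of z] n_pos[of w] by (simp add: cmod_ip_kn field_simps)

lemma K_ge: "z \<in> \<Omega> \<Longrightarrow> w \<in> \<Omega> \<Longrightarrow> nK z * nK w / nK (\<phi> z w) \<le> C * cmod (K z w)"
  using ip_kn_ge[of z w] n_pos[of z] n_pos[of w] n_pos[OF \<phi>_in, of z w] by (simp add: cmod_ip_kn field_simps)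

text \<open>The lower half of the kernel comparison excludes zeros, so that the inverse of a
  translation may divide by the kernel.\<close>

lemma K_nonzero:
  assumes "z \<in> \<Omega>" "w \<in> \<Omega>"
  shows "K z w \<noteq> 0"
proof
  assume "K z w = 0"
  moreover have "nK z * nK w / nK (\<phi> z w) > 0" using assms n_pos \<phi>_in by simp
  ultimately show False using K_ge[OF assms] by simp
qed

lemma n_continuous: "continuous_on \<Omega> (\<lambda>z. nK z)"
proof -
  have "continuous_map hm.mtopology euclideanreal (\<lambda>z. nK z)"
    using bergman unfolding bergman_type_def by (elim conjE)
  then show ?thesis by (simp add: hm.mtopology_eq)
qed

text \<open>Expanding the square leaves only \<open>nK v\<close> and the values
  \<open>K w v\<close>. The former is continuous because \<open>d\<close> induces the Euclidean
  topology, the latter because \<open>K w\<close> is holomorphic.\<close>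

lemma K_tendsto:
  assumes w: "w \<in> \<Omega>"
  shows "((\<lambda>v. bnorm \<sigma> (\<lambda>u. K v u - K w u)) \<longlongrightarrow> 0) (at w within \<Omega>)"
proof -
  have sq: "(bnorm \<sigma> (\<lambda>u. K v u - K w u))\<^sup>2 = (nK v)\<^sup>2 - 2 * Re (K w v) + (nK w)\<^sup>2" if "v \<in> \<Omega>" for v
  proof -
    have "ip \<sigma> (K v) (K w) = K v w" using reproducing[OF w K_in[OF that]] by simp
    then show ?thesis
      using bnorm_diff_sq[OF B_sqint[OF K_in[OF that]] B_sqint[OF K_in[OF w]]] K_sym[OF that w] by simp
  qed
  have "((\<lambda>v. (nK v)\<^sup>2 - 2 * Re (K w v) + (nK w)\<^sup>2) \<longlongrightarrow> (nK w)\<^sup>2 - 2 * Re (K w w) + (nK w)\<^sup>2) (at w within \<Omega>)"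
    using n_continuous B_continuous[OF K_in[OF w]] w
    by (intro tendsto_intros) (auto simp: continuous_on_def)
  then have "((\<lambda>v. (nK v)\<^sup>2 - 2 * Re (K w v) + (nK w)\<^sup>2) \<longlongrightarrow> 0) (at w within \<Omega>)"
    by (simp add: K_diag[OF w])
  then have "((\<lambda>v. (bnorm \<sigma> (\<lambda>u. K v u - K w u))\<^sup>2) \<longlongrightarrow> 0) (at w within \<Omega>)"
    by (rule Lim_transform_eventually) (simp add: eventually_at_filter sq)
  then have "((\<lambda>v. sqrt ((bnorm \<sigma> (\<lambda>u. K v u - K w u))\<^sup>2)) \<longlongrightarrow> sqrt 0) (at w within \<Omega>)"
    by (rule tendsto_real_sqrt)
  then show ?thesis by simp
qed

text \<open>The representing element minimizes \<open>\<parallel>f\<parallel>\<^sup>2 - 2 Re (l f)\<close>.\<close>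

lemma riesz:
  assumes add: "\<And>f g. f \<in> B \<Longrightarrow> g \<in> B \<Longrightarrow> l (\<lambda>w. f w + g w) = l f + l g"
    and scale: "\<And>f c. f \<in> B \<Longrightarrow> l (\<lambda>w. c * f w) = c * l f"
    and bound: "\<And>f. f \<in> B \<Longrightarrow> cmod (l f) \<le> M * bnorm \<sigma> f" and "M \<ge> 0"
  obtains h where "h \<in> B" "\<And>f. f \<in> B \<Longrightarrow> l f = ip \<sigma> f h" "bnorm \<sigma> h \<le> M"
proof -
  define J where "J f = (bnorm \<sigma> f)\<^sup>2 - 2 * Re (l f)" for f
  have diff: "l (\<lambda>w. f w - g w) = l f - l g" if "f \<in> B" "g \<in> B" for f g
    using add[OF that(1) B_cmult[OF that(2), of "-1"]] scale[OF that(2), of "-1"] by simp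
  have J_ge: "J f \<ge> - M\<^sup>2" if "f \<in> B" for f
  proof -
    have "Re (l f) \<le> M * bnorm \<sigma> f" using bound[OF that] complex_Re_le_cmod order_trans by blast
    moreover have "0 \<le> (bnorm \<sigma> f - M)\<^sup>2" by simp
    ultimately show ?thesis unfolding J_def by (simp add: power2_diff algebra_simps)
  qed
  define j where "j = (INF f\<in>B. J f)"
  have bdd: "bdd_below (J ` B)" using J_ge by (intro bdd_belowI[of _ "- M\<^sup>2"]) auto
  have j_le: "j \<le> J f" if "f \<in> B" for f unfolding j_def using bdd that by (rule cINF_lower)
  have "\<exists>f\<in>B. J f < j + 1 / Suc k" for k :: nat
  proof -
    have "j < j + 1 / Suc k" by simp
    then show ?thesis unfolding j_def using B_zero bdd by (subst (asm) cINF_less_iff) auto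
  qed
  then obtain X where X: "\<And>k. X k \<in> B" "\<And>k. J (X k) < j + 1 / Suc k" by metis
  \<comment> \<open>Parallelogram law: the value of \<open>J\<close> at the midpoint is at least
    \<open>j\<close>, while its values at both ends are almost \<open>j\<close>.\<close>
  have cauchy: "(bnorm \<sigma> (\<lambda>w. X a w - X b w))\<^sup>2 \<le> 2 / Suc a + 2 / Suc b" for a b
  proof -
    note sq = B_sqint[OF X(1)]
    let ?m = "\<lambda>w. (1/2) * (X a w + X b w)"
    have m: "?m \<in> B" by (intro B_cmult B_add X(1))
    have "4 * J ?m = (bnorm \<sigma> (\<lambda>w. X a w + X b w))\<^sup>2 - 4 * Re (l (X a)) - 4 * Re (l (X b))"
      unfolding J_def bnorm_cmult scale[OF B_add[OF X(1) X(1)]] add[OF X(1) X(1)]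
      by (simp add: power_mult_distrib power_divide field_simps)
    then have "(bnorm \<sigma> (\<lambda>w. X a w - X b w))\<^sup>2 = 2 * J (X a) + 2 * J (X b) - 4 * J ?m"
      unfolding J_def[of "X a"] J_def[of "X b"] bnorm_diff_sq[OF sq sq] bnorm_add_sq[OF sq sq] by simp
    also have "\<dots> \<le> 2 * (j + 1 / Suc a) + 2 * (j + 1 / Suc b) - 4 * j"
      using X(2)[of a] X(2)[of b] j_le[OF m] by argo
    finally show ?thesis by simp
  qed
  obtain h where h: "h \<in> B" "(\<lambda>n. bnorm \<sigma> (\<lambda>w. X n w - h w)) \<longlonglongrightarrow> 0"
  proof (rule complete[of X])
    fix e :: real assume e: "e > 0"
    then have "e\<^sup>2 / 4 > 0" by simp
    then obtain N where N: "1 / real (Suc N) < e\<^sup>2 / 4" by (rule nat_approx_posE)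
    have "bnorm \<sigma> (\<lambda>w. X a w - X b w) < e" if "a \<ge> N" "b \<ge> N" for a b
    proof -
      have "1 / real (Suc a) \<le> 1 / real (Suc N)" "1 / real (Suc b) \<le> 1 / real (Suc N)"
        using that by (auto intro!: frac_le)
      then have "(bnorm \<sigma> (\<lambda>w. X a w - X b w))\<^sup>2 < e\<^sup>2" using cauchy[of a b] N by linarith
      then show ?thesis using e by (simp add: power_less_imp_less_base)
    qed
    then show "\<exists>N. \<forall>m\<ge>N. \<forall>n\<ge>N. bnorm \<sigma> (\<lambda>w. X m w - X n w) < e" by blast
  qed (use X in auto)
  have J_h: "J h \<le> j"
  proof (rule field_le_epsilon)
    have "(\<lambda>k. J (X k)) \<longlonglongrightarrow> J h"
    proof -
      have b: "(\<lambda>k. bnorm \<sigma> (X k)) \<longlonglongrightarrow> bnorm \<sigma> h"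
      proof (rule LIM_zero_cancel, rule tendsto_rabs_zero_cancel, rule tendsto_sandwich[OF _ _ tendsto_const h(2)])
        show "\<forall>\<^sub>F k in sequentially. \<bar>bnorm \<sigma> (X k) - bnorm \<sigma> h\<bar> \<le> bnorm \<sigma> (\<lambda>w. X k w - h w)"
          using bnorm_le_diff[OF B_sqint[OF X(1)] B_sqint[OF h(1)]]
            bnorm_le_diff[OF B_sqint[OF h(1)] B_sqint[OF X(1)]]
          by (intro always_eventually allI) (simp add: abs_le_iff bnorm_minus_commute[of _ h] algebra_simps)
      qed simp
      have l: "(\<lambda>k. l (X k)) \<longlonglongrightarrow> l h"
      proof (rule LIM_zero_cancel, rule tendsto_norm_zero_cancel, rule tendsto_sandwich[OF _ _ tendsto_const])
        show "(\<lambda>k. M * bnorm \<sigma> (\<lambda>w. X k w - h w)) \<longlonglongrightarrow> 0"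
          using tendsto_mult_right_zero[OF h(2)] by simp
        show "\<forall>\<^sub>F k in sequentially. cmod (l (X k) - l h) \<le> M * bnorm \<sigma> (\<lambda>w. X k w - h w)"
          using bound[OF B_diff[OF X(1) h(1)]] by (simp add: diff[OF X(1) h(1)])
      qed auto
      show ?thesis unfolding J_def by (intro tendsto_intros b l)
    qed
    moreover fix e :: real assume e: "e > 0"
    moreover obtain N where N: "1 / real (Suc N) < e" using e by (rule nat_approx_posE)
    have "J (X k) \<le> j + e" if "k \<ge> N" for k
    proof -
      have "1 / real (Suc k) \<le> 1 / real (Suc N)" using that by (auto intro!: frac_le)
      then show ?thesis using X(2)[of k] N by linarith
    qed
    ultimately show "J h \<le> j + e" by (intro LIMSEQ_le_const2) auto
  qed
  have re: "Re (l f) = Re (ip \<sigma> f h)" if f: "f \<in> B" for f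
  proof -
    let ?a = "Re (ip \<sigma> h f) - Re (l f)"
    have quad: "2 * t * ?a + t\<^sup>2 * (bnorm \<sigma> f)\<^sup>2 \<ge> 0" for t :: real
    proof -
      let ?g = "\<lambda>w. complex_of_real t * f w"
      have g: "?g \<in> B" by (rule B_cmult[OF f])
      have "j \<le> J (\<lambda>w. h w + ?g w)" by (intro j_le B_add h(1) g)
      also have "\<dots> = J h + (2 * t * ?a + t\<^sup>2 * (bnorm \<sigma> f)\<^sup>2)"
        unfolding J_def bnorm_add_sq[OF B_sqint[OF h(1)] B_sqint[OF g]] add[OF h(1) g] scale[OF f]
          ip_cmult_right bnorm_cmult by (simp add: power_mult_distrib algebra_simps)
      finally show ?thesis using J_h by linarith
    qed
    have "?a = 0"
    proof (rule ccontr)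
      assume a: "?a \<noteq> 0"
      \<comment> \<open>The quadratic in \<open>t\<close> is tested at \<open>t = - ?a / c\<close>;
        the added 1 keeps \<open>c\<close> positive when \<open>f\<close> has norm 0.\<close>
      define c where "c = (bnorm \<sigma> f)\<^sup>2 + 1"
      have c: "c > 0" "(bnorm \<sigma> f)\<^sup>2 < c" by (simp_all add: c_def add_nonneg_pos)
      have "0 \<le> 2 * (- ?a / c) * ?a + (- ?a / c)\<^sup>2 * (bnorm \<sigma> f)\<^sup>2" by (rule quad)
      also have "\<dots> \<le> 2 * (- ?a / c) * ?a + (- ?a / c)\<^sup>2 * c"
        using c by (intro add_left_mono mult_left_mono) auto
      also have "\<dots> = - ?a\<^sup>2 / c" using c by (simp add: power2_eq_square field_simps)
      also have "\<dots> < 0" using a c by (simp add: divide_neg_pos)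
      finally show False by simp
    qed
    then show ?thesis by (simp add: ip_cnj[of \<sigma> h f])
  qed
  have rep: "l f = ip \<sigma> f h" if f: "f \<in> B" for f
  proof (rule complex_eqI)
    show "Re (l f) = Re (ip \<sigma> f h)" by (rule re[OF f])
    \<comment> \<open>By complex linearity, equality of real parts at \<open>\<i>\<close> times
      \<open>f\<close> is equality of imaginary parts at \<open>f\<close>.\<close>
    have "Re (\<i> * l f) = Re (\<i> * ip \<sigma> f h)"
      using re[OF B_cmult[OF f, of \<i>]] by (simp only: scale[OF f] ip_cmult_left)
    then show "Im (l f) = Im (ip \<sigma> f h)" by simp
  qed
  have "bnorm \<sigma> h \<le> M"
  proof (cases "bnorm \<sigma> h = 0")
    case False
    then have pos: "bnorm \<sigma> h > 0" using bnorm_nonneg[of \<sigma> h] by linarith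
    have "bnorm \<sigma> h * bnorm \<sigma> h \<le> M * bnorm \<sigma> h"
      using bound[OF h(1)] rep[OF h(1)] ip_self[of \<sigma> h]
      by (simp add: norm_power power2_eq_square norm_mult del: of_real_power)
    then show ?thesis using pos by simp
  qed (use \<open>M \<ge> 0\<close> in simp)
  from that[OF h(1) rep this] show ?thesis .
qed

end

section \<open>Projection, adjoints and translations\<close>

lemma eventually_withinI: "(\<And>q. q \<in> S \<Longrightarrow> Q q) \<Longrightarrow> eventually Q (at p within S)"
  by (simp add: eventually_at_filter)

context bergman
begin

text \<open>The orthogonal projection of \<open>sqint \<sigma>\<close> onto the space, obtained by
  representing the pairing with \<open>g\<close>. Pairings with \<open>B\<close> determine an
  element of \<open>B\<close>, so the choice is unique.\<close>

definition "P g = (SOME h. h \<in> B \<and> (\<forall>f\<in>B. ip \<sigma> f h = ip \<sigma> f g) \<and> bnorm \<sigma> h \<le> bnorm \<sigma> g)"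

lemma P_props:
  assumes g: "g \<in> sqint \<sigma>"
  shows P_in: "P g \<in> B" and ip_P: "f \<in> B \<Longrightarrow> ip \<sigma> f (P g) = ip \<sigma> f g"
    and bnorm_P: "bnorm \<sigma> (P g) \<le> bnorm \<sigma> g"
proof -
  obtain h where "h \<in> B" "\<And>f. f \<in> B \<Longrightarrow> ip \<sigma> f g = ip \<sigma> f h" "bnorm \<sigma> h \<le> bnorm \<sigma> g"
  proof (rule riesz[where l = "\<lambda>f. ip \<sigma> f g" and M = "bnorm \<sigma> g"])
    show "cmod (ip \<sigma> f g) \<le> bnorm \<sigma> g * bnorm \<sigma> f" if "f \<in> B" for f
      using norm_ip_le[OF B_sqint[OF that] g] by (simp add: mult.commute)
  qed (auto simp: ip_add_left ip_cmult_left B_sqint g)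
  then have "\<exists>h. h \<in> B \<and> (\<forall>f\<in>B. ip \<sigma> f h = ip \<sigma> f g) \<and> bnorm \<sigma> h \<le> bnorm \<sigma> g" by auto
  from someI_ex[OF this, folded P_def]
  show "P g \<in> B" "f \<in> B \<Longrightarrow> ip \<sigma> f (P g) = ip \<sigma> f g" "bnorm \<sigma> (P g) \<le> bnorm \<sigma> g" by auto
qed

lemma P_add: "f \<in> sqint \<sigma> \<Longrightarrow> g \<in> sqint \<sigma> \<Longrightarrow> P (\<lambda>w. f w + g w) = (\<lambda>w. P f w + P g w)"
  by (rule B_eq_ipI) (simp_all add: P_in B_add ip_P sqint_add ip_add_right B_sqint)

lemma P_cmult: "f \<in> sqint \<sigma> \<Longrightarrow> P (\<lambda>w. c * f w) = (\<lambda>w. c * P f w)"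
  by (rule B_eq_ipI) (simp_all add: P_in B_cmult ip_P sqint_cmult ip_cmult_right)

lemma P_of_B: "f \<in> B \<Longrightarrow> P f = f"
  by (rule B_eq_ipI) (simp_all add: P_in ip_P B_sqint)

lemma sqint_indicator:
  assumes "f \<in> sqint \<sigma>" "E \<in> sets \<sigma>"
  shows "(\<lambda>w. indicator E w * f w) \<in> sqint \<sigma>" "bnorm \<sigma> (\<lambda>w. indicator E w * f w) \<le> bnorm \<sigma> f"
proof -
  have [measurable]: "f \<in> borel_measurable \<sigma>" using assms(1) by (auto dest!: sqint_measurable)
  have "(\<lambda>w. indicator E w * f w) \<in> borel_measurable \<sigma>" using assms(2) by measurable
  moreover have "(\<integral>\<^sup>+z. ennreal ((cmod (indicator E z * f z))\<^sup>2) \<partial>\<sigma>) \<le> ennreal ((bnorm \<sigma> f)\<^sup>2)"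
    unfolding nn_bnorm[OF assms(1), symmetric] by (intro nn_integral_mono) (auto simp: indicator_def)
  ultimately show "(\<lambda>w. indicator E w * f w) \<in> sqint \<sigma>" "bnorm \<sigma> (\<lambda>w. indicator E w * f w) \<le> bnorm \<sigma> f"
    using sqintI_nn[OF _ _ bnorm_nonneg[of \<sigma> f]] by blast+
qed

section \<open>Bounded operators, their adjoints and their integral kernels\<close>

abbreviation "bop \<equiv> bounded_op \<Omega> \<sigma>"
abbreviation "adj \<equiv> hadj \<Omega> \<sigma>"

lemma bop_in: "bop A \<Longrightarrow> f \<in> B \<Longrightarrow> A f \<in> B"
  and bop_add: "bop A \<Longrightarrow> f \<in> B \<Longrightarrow> g \<in> B \<Longrightarrow> A (\<lambda>w. f w + g w) = (\<lambda>w. A f w + A g w)"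
  and bop_cmult: "bop A \<Longrightarrow> f \<in> B \<Longrightarrow> A (\<lambda>w. c * f w) = (\<lambda>w. c * A f w)"
  by (simp_all add: bounded_op_def)

lemma bop_diff: "bop A \<Longrightarrow> f \<in> B \<Longrightarrow> g \<in> B \<Longrightarrow> A (\<lambda>w. f w - g w) = (\<lambda>w. A f w - A g w)"
  using bop_add[of A f "\<lambda>w. -1 * g w"] bop_cmult[of A g "-1"] B_cmult[of g "-1"] by simp

lemma bop_zero: "bop A \<Longrightarrow> A (\<lambda>_. 0) = (\<lambda>_. 0)"
  using bop_cmult[OF _ B_zero, of A 0] by simp

lemma bop_bound:
  assumes "bop A"
  obtains M where "M \<ge> 0" "\<forall>f\<in>B. bnorm \<sigma> (A f) \<le> M * bnorm \<sigma> f"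
proof -
  obtain M where M: "\<forall>f\<in>B. bnorm \<sigma> (A f) \<le> M * bnorm \<sigma> f" using assms by (auto simp: bounded_op_def)
  show ?thesis
  proof (rule that[of "max M 0"], goal_cases)
    case 2
    have "bnorm \<sigma> (A f) \<le> max M 0 * bnorm \<sigma> f" if "f \<in> B" for f
      using bspec[OF M that] mult_right_mono[of M "max M 0" "bnorm \<sigma> f"] by simp
    then show ?case by simp
  qed simp
qed

lemma bopI:
  assumes "\<And>f. f \<in> B \<Longrightarrow> A f \<in> B"
    and "\<And>f g. f \<in> B \<Longrightarrow> g \<in> B \<Longrightarrow> A (\<lambda>w. f w + g w) = (\<lambda>w. A f w + A g w)"
    and "\<And>f c. f \<in> B \<Longrightarrow> A (\<lambda>w. c * f w) = (\<lambda>w. c * A f w)"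
    and "\<And>f. f \<in> B \<Longrightarrow> bnorm \<sigma> (A f) \<le> M * bnorm \<sigma> f"
  shows "bop A"
  unfolding bounded_op_def using assms by (auto intro: exI[of _ M])

text \<open>\<open>hadj\<close> is a definite description: \<open>riesz\<close> gives existence and
  \<open>B_eq_ipI\<close> uniqueness. The bound \<open>M\<close> is carried along to get explicit
  constants for the adjoints of translations.\<close>

lemma adj_ex:
  assumes A: "bop A" and M: "M \<ge> 0" "\<And>f. f \<in> B \<Longrightarrow> bnorm \<sigma> (A f) \<le> M * bnorm \<sigma> f" and g: "g \<in> B"
  shows "adj A g \<in> B \<and> (\<forall>f\<in>B. ip \<sigma> (A f) g = ip \<sigma> f (adj A g)) \<and> bnorm \<sigma> (adj A g) \<le> M * bnorm \<sigma> g"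
proof -
  obtain h where h: "h \<in> B" "\<And>f. f \<in> B \<Longrightarrow> ip \<sigma> (A f) g = ip \<sigma> f h" "bnorm \<sigma> h \<le> M * bnorm \<sigma> g"
  proof (rule riesz[where l = "\<lambda>f. ip \<sigma> (A f) g" and M = "M * bnorm \<sigma> g"])
    show "cmod (ip \<sigma> (A f) g) \<le> M * bnorm \<sigma> g * bnorm \<sigma> f" if f: "f \<in> B" for f
    proof -
      have "cmod (ip \<sigma> (A f) g) \<le> bnorm \<sigma> (A f) * bnorm \<sigma> g"
        by (rule norm_ip_le[OF B_sqint[OF bop_in[OF A f]] B_sqint[OF g]])
      also have "\<dots> \<le> (M * bnorm \<sigma> f) * bnorm \<sigma> g" by (intro mult_right_mono M(2) f bnorm_nonneg)
      finally show ?thesis by (simp add: mult_ac)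
    qed
  qed (use A g M in \<open>simp_all add: bop_add bop_cmult ip_add_left ip_cmult_left B_sqint bop_in\<close>)
  have "adj A g = h"
    unfolding hadj_def
  proof (rule the_equality)
    show "h \<in> B \<and> (\<forall>f\<in>B. ip \<sigma> (A f) g = ip \<sigma> f h)" using h by simp
    fix h' assume "h' \<in> B \<and> (\<forall>f\<in>B. ip \<sigma> (A f) g = ip \<sigma> f h')"
    then show "h' = h" using h by (intro B_eq_ipI) auto
  qed
  then show ?thesis using h by simp
qed

lemma adj_props:
  assumes "bop A" "g \<in> B"
  shows adj_in: "adj A g \<in> B" and ip_adj: "f \<in> B \<Longrightarrow> ip \<sigma> (A f) g = ip \<sigma> f (adj A g)"
proof -
  obtain M where "M \<ge> 0" "\<forall>f\<in>B. bnorm \<sigma> (A f) \<le> M * bnorm \<sigma> f" using bop_bound[OF assms(1)] .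
  then show "adj A g \<in> B" "f \<in> B \<Longrightarrow> ip \<sigma> (A f) g = ip \<sigma> f (adj A g)"
    using adj_ex[OF assms(1) _ _ assms(2), of M] by simp_all
qed

lemma bnorm_adj:
  "bop A \<Longrightarrow> M \<ge> 0 \<Longrightarrow> (\<And>f. f \<in> B \<Longrightarrow> bnorm \<sigma> (A f) \<le> M * bnorm \<sigma> f) \<Longrightarrow> g \<in> B \<Longrightarrow>
    bnorm \<sigma> (adj A g) \<le> M * bnorm \<sigma> g"
  using adj_ex by simp

lemma bop_adj:
  assumes A: "bop A"
  shows "bop (adj A)"
proof -
  obtain M where M': "M \<ge> 0" "\<forall>f\<in>B. bnorm \<sigma> (A f) \<le> M * bnorm \<sigma> f" using bop_bound[OF A] .
  note M = M'(1) bspec[OF M'(2)]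
  show ?thesis
  proof (rule bopI)
    show "adj A (\<lambda>w. f w + g w) = (\<lambda>w. adj A f w + adj A g w)" if "f \<in> B" "g \<in> B" for f g
      by (rule B_eq_ipI)
        (use A that in \<open>simp_all add: adj_in B_add ip_adj[symmetric] ip_add_right B_sqint bop_in\<close>)
    show "adj A (\<lambda>w. c * f w) = (\<lambda>w. c * adj A f w)" if "f \<in> B" for f c
      by (rule B_eq_ipI)
        (use A that in \<open>simp_all add: adj_in B_cmult ip_adj[symmetric] ip_cmult_right\<close>)
    show "bnorm \<sigma> (adj A f) \<le> M * bnorm \<sigma> f" if "f \<in> B" for f
      by (rule bnorm_adj[OF A M that])
  qed (simp add: adj_in A)
qed

text \<open>This transposes the kernel: row sums for \<open>T\<close> in the Schur test become
  column sums for its adjoint, to which the second integrability hypothesis applies.\<close>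

lemma kernel_adj:
  assumes A: "bop A" and "z \<in> \<Omega>" "w \<in> \<Omega>"
  shows "A (K w) z = cnj (adj A (K z) w)"
proof -
  have "A (K w) z = ip \<sigma> (K w) (adj A (K z))"
    using assms by (simp add: reproducing[OF assms(2)] bop_in K_in ip_adj)
  also have "\<dots> = cnj (adj A (K z) w)"
    using assms by (subst ip_cnj) (simp add: reproducing[OF assms(3)] adj_in K_in)
  finally show ?thesis .
qed

lemma op_P_eq_integral:
  assumes A: "bop A" and g: "g \<in> sqint \<sigma>" and z: "z \<in> \<Omega>"
  shows "integrable \<sigma> (\<lambda>w. g w * A (K w) z)" "A (P g) z = (\<integral>w. g w * A (K w) z \<partial>\<sigma>)"
proof -
  note Kz = K_in[OF z]
  have eq: "g w * cnj (adj A (K z) w) = g w * A (K w) z" if "w \<in> space \<sigma>" for w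
    using kernel_adj[OF A z, of w] that by (simp add: space_\<sigma>)
  show "integrable \<sigma> (\<lambda>w. g w * A (K w) z)"
    using ip_integrable[OF g B_sqint[OF adj_in[OF A Kz]]]
    by (rule Bochner_Integration.integrable_cong[THEN iffD1, rotated -1]) (simp_all add: eq)
  have "A (P g) z = ip \<sigma> (P g) (adj A (K z))"
    using A g z by (simp add: reproducing[OF z] bop_in P_in K_in ip_adj)
  also have "\<dots> = ip \<sigma> g (adj A (K z))"
    using A g Kz by (subst (1 2) ip_cnj) (simp add: ip_P adj_in)
  also have "\<dots> = (\<integral>w. g w * A (K w) z \<partial>\<sigma>)"
    unfolding ip_def by (rule Bochner_Integration.integral_cong) (simp_all add: eq)
  finally show "A (P g) z = (\<integral>w. g w * A (K w) z \<partial>\<sigma>)" .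
qed

text \<open>\<open>K w\<close> depends on \<open>w\<close> continuously in norm, and evaluation at
  \<open>z\<close> costs the locally bounded factor \<open>nK z\<close>, so the dependence on
  \<open>w\<close> is locally uniform in \<open>z\<close>. Joint continuity provides the
  measurability that Tonelli requires.\<close>

lemma kernel_continuous:
  assumes A: "bop A"
  shows "continuous_on (\<Omega> \<times> \<Omega>) (\<lambda>(z, w). A (K w) z)"
  unfolding continuous_on_def
proof
  fix p assume "p \<in> \<Omega> \<times> \<Omega>"
  then obtain z w where p: "p = (z, w)" "z \<in> \<Omega>" "w \<in> \<Omega>" by auto
  let ?F = "at p within \<Omega> \<times> \<Omega>"
  obtain M where M': "M \<ge> 0" "\<forall>f\<in>B. bnorm \<sigma> (A f) \<le> M * bnorm \<sigma> f" using bop_bound[OF A] .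
  note M = M'(1) bspec[OF M'(2)]
  have comp1: "((\<lambda>q. h (fst q)) \<longlongrightarrow> h z) ?F" if "continuous_on \<Omega> h" for h :: "_ \<Rightarrow> 'c::topological_space"
  proof -
    have "continuous_on (\<Omega> \<times> \<Omega>) (\<lambda>q. h (fst q))"
      by (rule continuous_on_compose2[OF that]) (auto intro: continuous_intros)
    then show ?thesis using p by (auto simp: continuous_on_def)
  qed
  have "continuous_on \<Omega> (\<lambda>v. bnorm \<sigma> (\<lambda>u. K v u - K w u))"
    unfolding continuous_on_def
  proof
    fix v assume v: "v \<in> \<Omega>"
    have le: "\<bar>bnorm \<sigma> (\<lambda>u. K v' u - K w u) - bnorm \<sigma> (\<lambda>u. K v u - K w u)\<bar>
        \<le> bnorm \<sigma> (\<lambda>u. K v' u - K v u)" if "v' \<in> \<Omega>" for v'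
      using bnorm_triangle_diff[of "K v'" \<sigma> "K v" "K w"] bnorm_triangle_diff[of "K v" \<sigma> "K v'" "K w"]
        that v p(3) bnorm_minus_commute[of \<sigma> "K v" "K v'"] by (simp add: B_sqint K_in abs_le_iff)
    show "((\<lambda>v. bnorm \<sigma> (\<lambda>u. K v u - K w u)) \<longlongrightarrow> bnorm \<sigma> (\<lambda>u. K v u - K w u)) (at v within \<Omega>)"
    proof (rule LIM_zero_cancel, rule tendsto_rabs_zero_cancel, rule tendsto_sandwich[OF _ _ tendsto_const K_tendsto[OF v]])
      show "\<forall>\<^sub>F v' in at v within \<Omega>. \<bar>bnorm \<sigma> (\<lambda>u. K v' u - K w u) - bnorm \<sigma> (\<lambda>u. K v u - K w u)\<bar>
        \<le> bnorm \<sigma> (\<lambda>u. K v' u - K v u)"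
        by (rule eventually_withinI) (rule le)
    qed simp
  qed
  then have "continuous_on (\<Omega> \<times> \<Omega>) (\<lambda>q. bnorm \<sigma> (\<lambda>u. K (snd q) u - K w u))"
    by (rule continuous_on_compose2) (auto intro: continuous_intros)
  then have "((\<lambda>q. bnorm \<sigma> (\<lambda>u. K (snd q) u - K w u)) \<longlongrightarrow> 0) ?F"
  proof -
    assume "continuous_on (\<Omega> \<times> \<Omega>) (\<lambda>q. bnorm \<sigma> (\<lambda>u. K (snd q) u - K w u))"
    then have "((\<lambda>q. bnorm \<sigma> (\<lambda>u. K (snd q) u - K w u)) \<longlongrightarrow> bnorm \<sigma> (\<lambda>u. K (snd p) u - K w u)) ?F"
      using p unfolding continuous_on_def by blast
    then show ?thesis by (simp add: p(1))
  qed
  then have lim1: "((\<lambda>q. M * bnorm \<sigma> (\<lambda>u. K (snd q) u - K w u) * nK (fst q)) \<longlongrightarrow> M * 0 * nK z) ?F"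
    by (intro tendsto_intros comp1 n_continuous)
  have lim2: "((\<lambda>q. A (K w) (fst q)) \<longlongrightarrow> A (K w) z) ?F"
    by (intro comp1 B_continuous bop_in[OF A] K_in p)
  have "((\<lambda>q. A (K (snd q)) (fst q) - A (K w) (fst q)) \<longlongrightarrow> 0) ?F"
  proof (rule tendsto_norm_zero_cancel, rule tendsto_sandwich[OF _ _ tendsto_const])
    show "((\<lambda>q. M * bnorm \<sigma> (\<lambda>u. K (snd q) u - K w u) * nK (fst q)) \<longlongrightarrow> 0) ?F" using lim1 by simp
    have "cmod (A (K w') z' - A (K w) z') \<le> M * bnorm \<sigma> (\<lambda>u. K w' u - K w u) * nK z'"
      if "z' \<in> \<Omega>" "w' \<in> \<Omega>" for z' w'
    proof -
      have D: "(\<lambda>u. K w' u - K w u) \<in> B" by (intro B_diff K_in that p)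
      have "cmod (A (K w') z' - A (K w) z') = cmod (A (\<lambda>u. K w' u - K w u) z')"
        using that p by (simp add: bop_diff[OF A] K_in)
      also have "\<dots> \<le> bnorm \<sigma> (A (\<lambda>u. K w' u - K w u)) * nK z'"
        by (rule eval_le[OF bop_in[OF A D] that(1)])
      also have "\<dots> \<le> M * bnorm \<sigma> (\<lambda>u. K w' u - K w u) * nK z'"
        by (intro mult_right_mono M(2) D bnorm_nonneg)
      finally show ?thesis .
    qed
    then show "\<forall>\<^sub>F q in ?F. norm (A (K (snd q)) (fst q) - A (K w) (fst q))
        \<le> M * bnorm \<sigma> (\<lambda>u. K (snd q) u - K w u) * nK (fst q)"
      by (intro eventually_withinI) auto
  qed simp
  from tendsto_add[OF this lim2]
  show "((\<lambda>(z, w). A (K w) z) \<longlongrightarrow> (case p of (z, w) \<Rightarrow> A (K w) z)) ?F"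
    by (simp add: p(1) case_prod_beta')
qed

lemma measurable_pair_continuous:
  assumes "continuous_on (\<Omega> \<times> \<Omega>) (f :: _ \<Rightarrow> 'b::topological_space)"
  shows "f \<in> borel_measurable (\<sigma> \<Otimes>\<^sub>M \<sigma>)"
proof -
  have id [measurable]: "(\<lambda>x. x) \<in> borel_measurable \<sigma>"
    by (rule measurable_\<sigma>_continuous) (rule continuous_on_id)
  have "(\<lambda>p. (fst p, snd p)) \<in> measurable (\<sigma> \<Otimes>\<^sub>M \<sigma>) (borel \<Otimes>\<^sub>M borel)"
    using measurable_compose[OF measurable_fst id, of \<sigma>] measurable_compose[OF measurable_snd id, of \<sigma>]
    by (rule measurable_Pair)
  then have "(\<lambda>p. p) \<in> borel_measurable (\<sigma> \<Otimes>\<^sub>M \<sigma>)" by (simp add: borel_prod)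
  then have "(\<lambda>p. p) \<in> measurable (\<sigma> \<Otimes>\<^sub>M \<sigma>) (restrict_space borel (\<Omega> \<times> \<Omega>))"
    by (intro measurable_restrict_space2) (auto simp: space_pair_measure space_\<sigma>)
  from measurable_compose[OF this borel_measurable_continuous_on_restrict[OF assms]]
  show ?thesis .
qed

text \<open>\<open>d\<close>-balls are Euclidean open, and the triangle inequality then gives
  continuity in both variables. It makes the off-diagonal region \<open>d z w > R\<close> measurable
  in the product.\<close>

lemma d_continuous: "continuous_on (\<Omega> \<times> \<Omega>) (\<lambda>(z, w). d z w)"
proof -
  have one: "((\<lambda>v. d v w) \<longlongrightarrow> 0) (at w within \<Omega>)" if "w \<in> \<Omega>" for w
  proof (rule tendstoI)
    fix e :: real assume e: "e > 0"
    have "openin hm.mtopology (Db w e)" by simp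
    then have "open (Db w e)" by (simp add: hm.openin_mtopology_iff)
    then have "eventually (\<lambda>v. v \<in> Db w e) (at w within \<Omega>)"
      using e that by (intro eventually_at_topological[THEN iffD2] exI[of _ "Db w e"]) auto
    then show "eventually (\<lambda>v. dist (d v w) 0 < e) (at w within \<Omega>)"
      by (rule eventually_mono) (auto simp: hm.commute)
  qed
  show ?thesis
    unfolding continuous_on_def
  proof
    fix p assume "p \<in> \<Omega> \<times> \<Omega>"
    then obtain z w where p: "p = (z, w)" "z \<in> \<Omega>" "w \<in> \<Omega>" by auto
    let ?F = "at p within \<Omega> \<times> \<Omega>"
    have f1: "filterlim fst (nhds z) ?F" and f2: "filterlim snd (nhds w) ?F"
      using tendsto_fst[OF tendsto_ident_at, of p "\<Omega> \<times> \<Omega>"] tendsto_snd[OF tendsto_ident_at, of p "\<Omega> \<times> \<Omega>"] p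
      by auto
    have ev: "\<forall>\<^sub>F q in ?F. fst q \<in> \<Omega> \<and> snd q \<in> \<Omega>" by (rule eventually_withinI) auto
    have l: "((\<lambda>q. d (h q) u) \<longlongrightarrow> 0) ?F"
      if "filterlim h (nhds u) ?F" "u \<in> \<Omega>" "\<forall>\<^sub>F q in ?F. h q \<in> \<Omega>" for h u
    proof (rule tendstoI)
      fix e :: real assume e: "e > 0"
      have "openin hm.mtopology (Db u e)" by simp
      then have "open (Db u e)" by (simp add: hm.openin_mtopology_iff)
      then have "eventually (\<lambda>q. h q \<in> Db u e) ?F"
        using that e by (intro topological_tendstoD[OF that(1)]) auto
      then show "eventually (\<lambda>q. dist (d (h q) u) 0 < e) ?F"
        by (rule eventually_mono) (auto simp: hm.commute)
    qed
    have "((\<lambda>q. d (fst q) z + d (snd q) w) \<longlongrightarrow> 0 + 0) ?F"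
      by (intro tendsto_add l f1 f2 p eventually_mono[OF ev]) auto
    then have "((\<lambda>q. d (fst q) z + d (snd q) w) \<longlongrightarrow> 0) ?F" by simp
    moreover have "\<bar>d z' w' - d z w\<bar> \<le> d z' z + d w' w" if "z' \<in> \<Omega>" "w' \<in> \<Omega>" for z' w'
      using hm.triangle[of z' z w'] hm.triangle[of z w w'] hm.triangle[of z z' w] hm.triangle[of z' w' w]
        that p hm.commute[of z z'] hm.commute[of w w'] by (simp add: abs_le_iff)
    ultimately have "((\<lambda>q. \<bar>d (fst q) (snd q) - d z w\<bar>) \<longlongrightarrow> 0) ?F"
      by (intro tendsto_sandwich[OF _ _ tendsto_const, where g = "\<lambda>q. \<bar>d (fst q) (snd q) - d z w\<bar>"])
        (auto intro!: eventually_withinI)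
    then show "((\<lambda>(z, w). d z w) \<longlongrightarrow> (case p of (z, w) \<Rightarrow> d z w)) ?F"
      by (subst (asm) tendsto_rabs_zero_iff) (simp add: p(1) case_prod_beta' LIM_zero_iff)
  qed
qed

lemma n_measurable [measurable]: "(\<lambda>z. nK z) \<in> borel_measurable \<sigma>"
  by (rule measurable_\<sigma>_continuous[OF n_continuous])

lemma \<phi>_measurable: "z \<in> \<Omega> \<Longrightarrow> \<phi> z \<in> measurable \<sigma> \<sigma>"
proof -
  assume z: "z \<in> \<Omega>"
  have "\<phi> z \<in> borel_measurable \<sigma>" by (rule measurable_\<sigma>_continuous[OF \<phi>_cont[OF z]])
  then have "\<phi> z \<in> measurable \<sigma> (restrict_space borel \<Omega>)"
    using \<phi>_in[OF z] by (intro measurable_restrict_space2) (auto simp: space_\<sigma>)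
  then show ?thesis using measurable_cong_sets[OF refl sets_\<sigma>] by blast
qed

section \<open>Integration against \<lambda>, change of variables and translations\<close>

lemma sets_Lm [measurable_cong]: "sets Lm = sets \<sigma>"
  by (simp add: lam_def)

lemma nn_integral_Lm:
  assumes "f \<in> borel_measurable \<sigma>"
  shows "(\<integral>\<^sup>+z. f z \<partial>Lm) = (\<integral>\<^sup>+z. ennreal ((nK z)\<^sup>2) * f z \<partial>\<sigma>)"
  unfolding lam_def using assms by (intro nn_integral_density) measurable

lemma nn_integral_Lm_inverse:
  assumes "f \<in> borel_measurable \<sigma>"
  shows "(\<integral>\<^sup>+z. f z \<partial>\<sigma>) = (\<integral>\<^sup>+z. ennreal (1 / (nK z)\<^sup>2) * f z \<partial>Lm)"
proof -
  have "ennreal ((nK z)\<^sup>2) * (ennreal (1 / (nK z)\<^sup>2) * f z) = f z" if "z \<in> space \<sigma>" for z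
    using n_pos[of z] that by (simp add: mult.assoc[symmetric] ennreal_mult[symmetric] space_\<sigma>)
  then show ?thesis
    using assms by (subst nn_integral_Lm) (auto intro!: nn_integral_cong)
qed

text \<open>The involution identifies preimages with images, so the quasi-invariance assumed for
  sets says that the image measure of \<lambda> under \<open>\<phi> z\<close> is at most
  \<open>C\<close> times \<lambda>.\<close>

lemma nn_integral_\<phi>:
  assumes z: "z \<in> \<Omega>" and f: "f \<in> borel_measurable \<sigma>"
  shows "(\<integral>\<^sup>+w. f (\<phi> z w) \<partial>Lm) \<le> ennreal C * (\<integral>\<^sup>+w. f w \<partial>Lm)"
proof -
  have m: "\<phi> z \<in> measurable Lm Lm"
    using \<phi>_measurable[OF z] measurable_cong_sets[OF sets_Lm sets_Lm] by blast
  have fL: "f \<in> borel_measurable Lm" using f by simp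
  have "(\<integral>\<^sup>+w. f (\<phi> z w) \<partial>Lm) = (\<integral>\<^sup>+w. f w \<partial>distr Lm Lm (\<phi> z))"
    by (rule nn_integral_distr[symmetric, OF m]) (simp add: fL)
  also have "\<dots> \<le> (\<integral>\<^sup>+w. f w \<partial>scale_measure (ennreal C) Lm)"
  proof (rule nn_integral_mono_measure)
    have "emeasure (distr Lm Lm (\<phi> z)) E \<le> ennreal C * emeasure Lm E" if E: "E \<in> sets Lm" for E
    proof -
      have "\<phi> z -` E \<inter> space Lm = \<phi> z ` E"
      proof -
        have "E \<subseteq> \<Omega>" using E[unfolded sets_Lm] sets_\<sigma>_iff[of E] by simp
        moreover have "space Lm = \<Omega>" by (simp add: lam_def space_\<sigma>)
        ultimately show ?thesis using z \<phi>_in[OF z] \<phi>_inv[OF z]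
          by (auto intro: rev_image_eqI)
      qed
      then show ?thesis using E emeasure_\<phi>[OF z, of E] m by (simp add: emeasure_distr sets_Lm)
    qed
    then show "distr Lm Lm (\<phi> z) \<le> scale_measure (ennreal C) Lm"
      by (subst le_measure) auto
  qed simp
  also have "\<dots> = ennreal C * (\<integral>\<^sup>+w. f w \<partial>Lm)" by (rule nn_integral_scale_measure[OF fL])
  finally show ?thesis .
qed

text \<open>Dividing by \<open>nK\<close> turns the norm for \<sigma> into one for \<lambda>, which
  composition with \<open>\<phi> z\<close> preserves up to a constant. An arbitrary dominated
  \<open>F\<close> is allowed, so that one estimate serves \<open>U z\<close>, \<open>V z\<close>
  and truncated translates.\<close>

lemma bnorm_\<phi>_le:
  assumes z: "z \<in> \<Omega>" and f: "f \<in> sqint \<sigma>" and F: "F \<in> borel_measurable \<sigma>"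
    and le: "\<And>w. w \<in> \<Omega> \<Longrightarrow> cmod (F w) \<le> C * (cmod (f (\<phi> z w)) * nK w / nK (\<phi> z w))"
  shows "F \<in> sqint \<sigma>" "bnorm \<sigma> F \<le> C\<^sup>2 * bnorm \<sigma> f"
proof -
  have [measurable]: "f \<in> borel_measurable \<sigma>" using f by (auto dest!: sqint_measurable)
  let ?G = "\<lambda>w. ennreal (C\<^sup>2 * ((cmod (f w))\<^sup>2 / (nK w)\<^sup>2))"
  have G: "?G \<in> borel_measurable \<sigma>" by measurable
  have G\<phi>: "(\<lambda>w. ?G (\<phi> z w)) \<in> borel_measurable \<sigma>"
    by (rule measurable_compose[OF \<phi>_measurable[OF z] G])
  have "(\<integral>\<^sup>+w. ennreal ((cmod (F w))\<^sup>2) \<partial>\<sigma>) \<le> (\<integral>\<^sup>+w. ennreal ((nK w)\<^sup>2) * ?G (\<phi> z w) \<partial>\<sigma>)"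
  proof (rule nn_integral_mono)
    fix w assume "w \<in> space \<sigma>"
    then have w: "w \<in> \<Omega>" by (simp add: space_\<sigma>)
    have "(cmod (F w))\<^sup>2 \<le> (C * (cmod (f (\<phi> z w)) * nK w / nK (\<phi> z w)))\<^sup>2"
      by (intro power_mono le w) simp
    also have "\<dots> = (nK w)\<^sup>2 * (C\<^sup>2 * ((cmod (f (\<phi> z w)))\<^sup>2 / (nK (\<phi> z w))\<^sup>2))"
      by (simp add: power_mult_distrib power_divide)
    finally show "ennreal ((cmod (F w))\<^sup>2) \<le> ennreal ((nK w)\<^sup>2) * ?G (\<phi> z w)"
      by (simp add: ennreal_mult[symmetric] ennreal_leI)
  qed
  also have "\<dots> = (\<integral>\<^sup>+w. ?G (\<phi> z w) \<partial>Lm)" by (rule nn_integral_Lm[symmetric, OF G\<phi>])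
  also have "\<dots> \<le> ennreal C * (\<integral>\<^sup>+w. ?G w \<partial>Lm)" by (rule nn_integral_\<phi>[OF z G])
  also have "(\<integral>\<^sup>+w. ?G w \<partial>Lm) = (\<integral>\<^sup>+w. ennreal (C\<^sup>2) * ennreal ((cmod (f w))\<^sup>2) \<partial>\<sigma>)"
    unfolding nn_integral_Lm[OF G]
    by (intro nn_integral_cong) (use n_pos in \<open>auto simp: space_\<sigma> ennreal_mult[symmetric] less_le\<close>)
  also have "\<dots> = ennreal (C\<^sup>2) * ennreal ((bnorm \<sigma> f)\<^sup>2)"
    by (simp add: nn_integral_cmult nn_bnorm[OF f])
  also have "ennreal C * (ennreal (C\<^sup>2) * ennreal ((bnorm \<sigma> f)\<^sup>2)) = ennreal (C^3 * (bnorm \<sigma> f)\<^sup>2)"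
    using C_ge by (simp add: ennreal_mult[symmetric] power2_eq_square power3_eq_cube mult_ac)
  \<comment> \<open>The pointwise bound contributes \<open>C ^ 2\<close> to the squared norm and the
    change of variables another \<open>C\<close>; rounding \<open>C ^ 3\<close> up to
    \<open>C ^ 4\<close> leaves a clean square root.\<close>
  also have "\<dots> \<le> ennreal ((C\<^sup>2 * bnorm \<sigma> f)\<^sup>2)"
    using C_ge power_increasing[of 3 4 C]
    by (intro ennreal_leI) (simp add: power_mult_distrib mult_right_mono flip: power_mult)
  finally show "F \<in> sqint \<sigma>" "bnorm \<sigma> F \<le> C\<^sup>2 * bnorm \<sigma> f"
    using sqintI_nn[OF F, of "C\<^sup>2 * bnorm \<sigma> f"] C_ge by auto
qed

text \<open>\<open>V z\<close> is the inverse of \<open>U z\<close>; the operator \<open>U z\<close> itself is an involution only up to the factor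
  \<open>k\<^sub>z(\<phi>\<^sub>z(w)) k\<^sub>z(w)\<close>, whose modulus is merely comparable to \<open>1\<close>.\<close>

definition V where "V z f = (\<lambda>w. if w \<in> \<Omega> then f (\<phi> z w) * inverse (kn \<sigma> K z (\<phi> z w)) else 0)"

lemma cmod_kn: "cmod (kn \<sigma> K z w) = cmod (K z w) / nK z"
  by (simp add: kn_def norm_divide)

lemma cmod_kn_le: "z \<in> \<Omega> \<Longrightarrow> w \<in> \<Omega> \<Longrightarrow> cmod (kn \<sigma> K z w) \<le> C * (nK w / nK (\<phi> z w))"
  unfolding cmod_kn using K_le[of z w] n_pos[of z] by (simp add: field_simps)

lemma cmod_kn_ge: "z \<in> \<Omega> \<Longrightarrow> w \<in> \<Omega> \<Longrightarrow> nK w / nK (\<phi> z w) \<le> C * cmod (kn \<sigma> K z w)"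
  unfolding cmod_kn using K_ge[of z w] n_pos[of z] by (simp add: field_simps)

lemma kn_nonzero: "z \<in> \<Omega> \<Longrightarrow> w \<in> \<Omega> \<Longrightarrow> kn \<sigma> K z w \<noteq> 0"
  using K_nonzero[of z w] n_pos[of z] by (simp add: kn_def)

lemma kn_eq: "kn \<sigma> K z = (\<lambda>w. complex_of_real (1 / nK z) * K z w)"
  by (simp add: kn_def)

lemma kn_in: "z \<in> \<Omega> \<Longrightarrow> kn \<sigma> K z \<in> B"
  unfolding kn_eq by (rule B_cmult[OF K_in])

lemma cmod_inverse_kn_le:
  assumes "z \<in> \<Omega>" "w \<in> \<Omega>"
  shows "cmod (inverse (kn \<sigma> K z (\<phi> z w))) \<le> C * (nK w / nK (\<phi> z w))"
proof -
  have "nK (\<phi> z w) / nK w \<le> C * cmod (kn \<sigma> K z (\<phi> z w))"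
    using cmod_kn_ge[OF assms(1) \<phi>_in[OF assms]] assms by (simp add: \<phi>_inv)
  moreover have "nK w > 0" "nK (\<phi> z w) > 0" "cmod (kn \<sigma> K z (\<phi> z w)) > 0"
    using assms n_pos \<phi>_in kn_nonzero by auto
  ultimately show ?thesis unfolding norm_inverse by (simp add: field_simps)
qed

lemma U_props:
  assumes z: "z \<in> \<Omega>" and f: "f \<in> B"
  shows U_in: "U z f \<in> B" and bnorm_U: "bnorm \<sigma> (U z f) \<le> C\<^sup>2 * bnorm \<sigma> f"
    and cmod_U_le: "w \<in> \<Omega> \<Longrightarrow> cmod (U z f w) \<le> C * (cmod (f (\<phi> z w)) * nK w / nK (\<phi> z w))"
proof -
  have hol: "cholo_on (U z f) \<Omega>"
  proof (rule cholo_on_cong)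
    show "cholo_on (\<lambda>w. f (\<phi> z w) * kn \<sigma> K z w) \<Omega>"
      by (intro cholo_on_mult cholo_on_compose[OF B_holo[OF f] \<phi>_holo[OF z] \<phi>_image[OF z]] B_holo[OF kn_in[OF z]])
  qed (simp add: transl_def)
  have le: "cmod (U z f w) \<le> C * (cmod (f (\<phi> z w)) * nK w / nK (\<phi> z w))" if "w \<in> \<Omega>" for w
    using mult_left_mono[OF cmod_kn_le[OF z that], of "cmod (f (\<phi> z w))"] that
    by (simp add: transl_def norm_mult mult_ac)
  note b = bnorm_\<phi>_le[OF z B_sqint[OF f] measurable_\<sigma>_continuous[OF cholo_on_imp_continuous_on[OF hol]] le]
  show "U z f \<in> B" by (rule BI[OF hol _ b(1)]) (simp_all add: transl_def)
  show "bnorm \<sigma> (U z f) \<le> C\<^sup>2 * bnorm \<sigma> f" by (rule b(2))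
  show "w \<in> \<Omega> \<Longrightarrow> cmod (U z f w) \<le> C * (cmod (f (\<phi> z w)) * nK w / nK (\<phi> z w))" by (rule le)
qed

lemma V_props:
  assumes z: "z \<in> \<Omega>" and f: "f \<in> B"
  shows V_in: "V z f \<in> B" and bnorm_V: "bnorm \<sigma> (V z f) \<le> C\<^sup>2 * bnorm \<sigma> f"
    and cmod_V_le: "w \<in> \<Omega> \<Longrightarrow> cmod (V z f w) \<le> C * (cmod (f (\<phi> z w)) * nK w / nK (\<phi> z w))"
proof -
  have hol: "cholo_on (V z f) \<Omega>"
  proof (rule cholo_on_cong)
    have "cholo_on (\<lambda>w. inverse (kn \<sigma> K z w)) \<Omega>"
      by (rule cholo_on_inverse[OF B_holo[OF kn_in[OF z]] kn_nonzero[OF z]])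
    then show "cholo_on (\<lambda>w. f (\<phi> z w) * inverse (kn \<sigma> K z (\<phi> z w))) \<Omega>"
      using cholo_on_compose[OF _ \<phi>_holo[OF z] \<phi>_image[OF z]] B_holo[OF f] by (intro cholo_on_mult) auto
  qed (simp add: V_def)
  have le: "cmod (V z f w) \<le> C * (cmod (f (\<phi> z w)) * nK w / nK (\<phi> z w))" if "w \<in> \<Omega>" for w
    using mult_left_mono[OF cmod_inverse_kn_le[OF z that], of "cmod (f (\<phi> z w))"] that
    by (simp add: V_def norm_mult mult_ac)
  note b = bnorm_\<phi>_le[OF z B_sqint[OF f] measurable_\<sigma>_continuous[OF cholo_on_imp_continuous_on[OF hol]] le]
  show "V z f \<in> B" by (rule BI[OF hol _ b(1)]) (simp_all add: V_def)
  show "bnorm \<sigma> (V z f) \<le> C\<^sup>2 * bnorm \<sigma> f" by (rule b(2))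
  show "w \<in> \<Omega> \<Longrightarrow> cmod (V z f w) \<le> C * (cmod (f (\<phi> z w)) * nK w / nK (\<phi> z w))" by (rule le)
qed

lemma V_U: "z \<in> \<Omega> \<Longrightarrow> f \<in> B \<Longrightarrow> V z (U z f) = f"
  by (rule B_eqI[OF V_in[OF _ U_in]])
    (simp_all add: V_def transl_def \<phi>_in \<phi>_inv kn_nonzero)

lemma bop_U: "z \<in> \<Omega> \<Longrightarrow> bop (U z)"
  by (rule bopI[OF U_in _ _ bnorm_U]) (auto simp: transl_def algebra_simps fun_eq_iff)

lemma bop_V: "z \<in> \<Omega> \<Longrightarrow> bop (V z)"
  by (rule bopI[OF V_in _ _ bnorm_V]) (auto simp: V_def algebra_simps fun_eq_iff)

lemma bnorm_adj_U: "z \<in> \<Omega> \<Longrightarrow> f \<in> B \<Longrightarrow> bnorm \<sigma> (adj (U z) f) \<le> C\<^sup>2 * bnorm \<sigma> f"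
  by (rule bnorm_adj[OF bop_U _ bnorm_U]) auto

lemma bnorm_adj_V: "z \<in> \<Omega> \<Longrightarrow> f \<in> B \<Longrightarrow> bnorm \<sigma> (adj (V z) f) \<le> C\<^sup>2 * bnorm \<sigma> f"
  by (rule bnorm_adj[OF bop_V _ bnorm_V]) auto

text \<open>The adjoint of the identity \<open>V z (U z f) = f\<close>. It solves
  \<open>adj (U z) h = f\<close> with control of the norm of \<open>h\<close>, which is how
  functions localized near \<open>z\<close> are pulled back to a fixed compact family.\<close>

lemma adj_U_adj_V: "z \<in> \<Omega> \<Longrightarrow> f \<in> B \<Longrightarrow> adj (U z) (adj (V z) f) = f"
  by (rule B_eq_ipI)
    (simp_all add: adj_in bop_U bop_V ip_adj[symmetric] U_in V_U)

lemma bnorm_le_U: "z \<in> \<Omega> \<Longrightarrow> f \<in> B \<Longrightarrow> bnorm \<sigma> f \<le> C\<^sup>2 * bnorm \<sigma> (U z f)"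
  using bnorm_V[OF _ U_in, of z z f] by (simp add: V_U)

end

section \<open>Decay of the kernel away from the diagonal\<close>

text \<open>Cauchy-Schwarz with \<open>R z w\<close> split between the weight \<open>h w\<close> and
  its inverse, then Tonelli: the row bound controls the first factor, the column bound the second.
  Working with nonnegative integrals avoids questions of integrability.\<close>

lemma schur_test:
  fixes R :: "'a \<Rightarrow> 'a \<Rightarrow> real" and h g :: "'a \<Rightarrow> real"
  assumes M: "sigma_finite_measure M"
    and R [measurable]: "(\<lambda>(z, w). R z w) \<in> borel_measurable (M \<Otimes>\<^sub>M M)"
    and h [measurable]: "h \<in> borel_measurable M" and g [measurable]: "g \<in> borel_measurable M"
    and R_nonneg: "\<And>z w. R z w \<ge> 0" and h_pos: "\<And>z. z \<in> space M \<Longrightarrow> h z > 0"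
    and g_nonneg: "\<And>z. g z \<ge> 0" and \<epsilon>: "\<epsilon> \<ge> 0"
    and row: "\<And>z. z \<in> space M \<Longrightarrow> (\<integral>\<^sup>+w. ennreal (R z w * h w) \<partial>M) \<le> ennreal (\<epsilon> * h z)"
    and col: "\<And>w. w \<in> space M \<Longrightarrow> (\<integral>\<^sup>+z. ennreal (R z w * h z) \<partial>M) \<le> ennreal (\<epsilon> * h w)"
  shows "(\<integral>\<^sup>+z. (\<integral>\<^sup>+w. ennreal (R z w * g w) \<partial>M)\<^sup>2 \<partial>M) \<le> ennreal (\<epsilon>\<^sup>2) * (\<integral>\<^sup>+w. ennreal ((g w)\<^sup>2) \<partial>M)"
proof -
  interpret M: sigma_finite_measure M by (rule M)
  interpret MM: pair_sigma_finite M M by unfold_locales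
  have row1 [measurable]: "(\<lambda>w. R z w) \<in> borel_measurable M" if "z \<in> space M" for z
    using measurable_compose[OF measurable_Pair1'[OF that] R] by simp
  have col1 [measurable]: "(\<lambda>z. R z w) \<in> borel_measurable M" if "w \<in> space M" for w
    using measurable_compose[OF measurable_Pair2'[OF that] R] by simp
  let ?F = "\<lambda>z w. ennreal (\<epsilon> * h z * (R z w / h w * (g w)\<^sup>2))"
  have "(\<integral>\<^sup>+w. ennreal (R z w * g w) \<partial>M)\<^sup>2 \<le> (\<integral>\<^sup>+w. ?F z w \<partial>M)" if z: "z \<in> space M" for z
  proof -
    note [measurable] = row1[OF z]
    have "(\<integral>\<^sup>+w. ennreal (R z w * g w) \<partial>M)
        = (\<integral>\<^sup>+w. ennreal (sqrt (R z w * h w)) * ennreal (sqrt (R z w / h w) * g w) \<partial>M)"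
    proof (rule nn_integral_cong)
      fix w assume "w \<in> space M"
      then have h: "h w > 0" by (rule h_pos)
      then have "sqrt (R z w * h w) * sqrt (R z w / h w) = R z w"
        using R_nonneg[of z w] by (simp flip: real_sqrt_mult)
      then have eq: "R z w * g w = sqrt (R z w * h w) * (sqrt (R z w / h w) * g w)"
        by (simp only: mult.assoc[symmetric])
      show "ennreal (R z w * g w) = ennreal (sqrt (R z w * h w)) * ennreal (sqrt (R z w / h w) * g w)"
        unfolding eq using R_nonneg[of z w] h g_nonneg[of w] by (subst ennreal_mult[symmetric]) auto
    qed
    then have "(\<integral>\<^sup>+w. ennreal (R z w * g w) \<partial>M)\<^sup>2 \<le>
        (\<integral>\<^sup>+w. (ennreal (sqrt (R z w * h w)))\<^sup>2 \<partial>M) * (\<integral>\<^sup>+w. (ennreal (sqrt (R z w / h w) * g w))\<^sup>2 \<partial>M)"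
      by (simp only:) (rule Cauchy_Schwarz_nn_integral; measurable)
    also have "(\<integral>\<^sup>+w. (ennreal (sqrt (R z w * h w)))\<^sup>2 \<partial>M) = (\<integral>\<^sup>+w. ennreal (R z w * h w) \<partial>M)"
      by (intro nn_integral_cong) (use R_nonneg h_pos in \<open>auto simp: ennreal_power less_imp_le\<close>)
    also have "(\<integral>\<^sup>+w. (ennreal (sqrt (R z w / h w) * g w))\<^sup>2 \<partial>M) = (\<integral>\<^sup>+w. ennreal (R z w / h w * (g w)\<^sup>2) \<partial>M)"
      by (intro nn_integral_cong)
        (use R_nonneg h_pos g_nonneg in \<open>auto simp: ennreal_power power_mult_distrib less_imp_le\<close>)
    also have "(\<integral>\<^sup>+w. ennreal (R z w * h w) \<partial>M) * (\<integral>\<^sup>+w. ennreal (R z w / h w * (g w)\<^sup>2) \<partial>M)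
        \<le> ennreal (\<epsilon> * h z) * (\<integral>\<^sup>+w. ennreal (R z w / h w * (g w)\<^sup>2) \<partial>M)"
      by (intro mult_right_mono row z) simp
    also have "\<dots> = (\<integral>\<^sup>+w. ennreal (\<epsilon> * h z) * ennreal (R z w / h w * (g w)\<^sup>2) \<partial>M)"
      by (rule nn_integral_cmult[symmetric]) measurable
    also have "\<dots> = (\<integral>\<^sup>+w. ?F z w \<partial>M)"
      using h_pos[OF z] \<epsilon> R_nonneg h_pos
      by (intro nn_integral_cong) (subst ennreal_mult[symmetric], auto simp: less_imp_le)
    finally show ?thesis .
  qed
  then have "(\<integral>\<^sup>+z. (\<integral>\<^sup>+w. ennreal (R z w * g w) \<partial>M)\<^sup>2 \<partial>M) \<le> (\<integral>\<^sup>+z. (\<integral>\<^sup>+w. ?F z w \<partial>M) \<partial>M)"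
    by (rule nn_integral_mono)
  also have "\<dots> = (\<integral>\<^sup>+w. (\<integral>\<^sup>+z. ?F z w \<partial>M) \<partial>M)"
    by (rule MM.Fubini'[symmetric]) measurable
  also have "\<dots> \<le> (\<integral>\<^sup>+w. ennreal (\<epsilon>\<^sup>2) * ennreal ((g w)\<^sup>2) \<partial>M)"
  proof (rule nn_integral_mono)
    fix w assume w: "w \<in> space M"
    note [measurable] = col1[OF w]
    have h: "h w > 0" by (rule h_pos[OF w])
    have "(\<integral>\<^sup>+z. ?F z w \<partial>M) = (\<integral>\<^sup>+z. ennreal (\<epsilon> * (g w)\<^sup>2 / h w) * ennreal (R z w * h z) \<partial>M)"
    proof (rule nn_integral_cong)
      fix z assume "z \<in> space M"
      then have hz: "h z > 0" by (rule h_pos)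
      have "\<epsilon> * h z * (R z w / h w * (g w)\<^sup>2) = (\<epsilon> * (g w)\<^sup>2 / h w) * (R z w * h z)"
        by (simp add: field_simps)
      then show "?F z w = ennreal (\<epsilon> * (g w)\<^sup>2 / h w) * ennreal (R z w * h z)"
        using h hz \<epsilon> R_nonneg[of z w] by (simp only:) (subst ennreal_mult, auto)
    qed
    also have "\<dots> = ennreal (\<epsilon> * (g w)\<^sup>2 / h w) * (\<integral>\<^sup>+z. ennreal (R z w * h z) \<partial>M)"
      by (rule nn_integral_cmult) measurable
    also have "\<dots> \<le> ennreal (\<epsilon> * (g w)\<^sup>2 / h w) * ennreal (\<epsilon> * h w)"
      by (intro mult_left_mono col w) simp
    also have "\<dots> = ennreal (\<epsilon>\<^sup>2) * ennreal ((g w)\<^sup>2)"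
      using h \<epsilon> by (simp add: ennreal_mult[symmetric] power2_eq_square mult_ac)
    finally show "(\<integral>\<^sup>+z. ?F z w \<partial>M) \<le> ennreal (\<epsilon>\<^sup>2) * ennreal ((g w)\<^sup>2)" .
  qed
  also have "\<dots> = ennreal (\<epsilon>\<^sup>2) * (\<integral>\<^sup>+w. ennreal ((g w)\<^sup>2) \<partial>M)"
    by (rule nn_integral_cmult) measurable
  finally show ?thesis .
qed

text \<open>The parameter \<open>t\<close> makes one term as small as desired at the expense of the
  other; in the kernel estimate the enlarged term is then beaten by the distance from the
  diagonal.\<close>

lemma Youngs_inequality_scaled:
  fixes p q t x y :: real
  assumes "p > 1" "q > 1" "1/p + 1/q = 1" "t > 0" "x \<ge> 0" "y \<ge> 0"
  shows "x * y \<le> t powr p * x powr p + t powr (-q) * y powr q"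
proof -
  have "x * y = (t * x) * (y / t)" using assms(4) by simp
  also have "\<dots> \<le> (t * x) powr p / p + (y / t) powr q / q"
    by (rule Youngs_inequality) (use assms in auto)
  also have "\<dots> \<le> (t * x) powr p + (y / t) powr q"
    using assms by (intro add_mono) (simp_all add: divide_le_eq mult_le_cancel_left1)
  also have "\<dots> = t powr p * x powr p + t powr (-q) * y powr q"
    using assms by (simp add: powr_mult powr_divide powr_minus field_simps)
  finally show ?thesis .
qed

context bergman
begin

text \<open>The exponent condition on \<open>p\<close> is what leaves room for the gain \<open>e > 0\<close>.\<close>

lemma rudin_forelli_exponents:
  assumes "p > (4 - \<kappa>) / (2 - \<kappa>)" "q = p / (p - 1)"
  obtains r s e where "rudin_forelli \<Omega> \<sigma> K r s" "e > 0" "r + s + 2 * e = 2 * (2 - q)" "r > 0" "s > 0"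
    "p > 2" "1 < q" "q < 2" "1/p + 1/q = 1"
proof -
  have "(4 - \<kappa>) / (2 - \<kappa>) = 1 + 2 / (2 - \<kappa>)" using \<kappa>_range by (simp add: field_simps)
  moreover have "2 / (2 - \<kappa>) \<ge> 1" using \<kappa>_range by simp
  ultimately have p: "p > 2" "p - 1 > 2 / (2 - \<kappa>)" using assms(1) by auto
  have "1 / (p - 1) < (2 - \<kappa>) / 2"
    using p \<kappa>_range by (simp add: field_simps)
  moreover have q1: "q = 1 + 1 / (p - 1)" using p(1) by (simp add: assms(2) field_simps)
  ultimately have q: "q < 2 - \<kappa> / 2" "q > 1" using p(1) by auto
  have conj: "1/p + 1/q = 1" using p(1) by (simp add: assms(2) field_simps)
  \<comment> \<open>The hypothesis on \<open>p\<close> amounts to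
    \<open>\<kappa> < 2 * (2 - q)\<close> for the conjugate exponent \<open>q\<close>. The slack
    \<open>\<delta>\<close> is to be shared among \<open>r\<close>, \<open>s\<close> and the gain
    \<open>2 * e\<close>.\<close>
  define \<delta> where "\<delta> = 2 * (2 - q) - \<kappa>"
  have \<delta>: "\<delta> > 0" using q by (simp add: \<delta>_def)
  show ?thesis
  proof (cases "\<kappa> = 0")
    case True
    show ?thesis
      by (rule that[of "\<delta>/4" "\<delta>/4" "\<delta>/4"])
        (use True rudin_forelli_zero[OF True, of "\<delta>/4"] \<delta> p q conj in \<open>auto simp: \<delta>_def field_simps\<close>)
  next
    case False
    then have k: "\<kappa> > 0" using \<kappa>_range by simp
    \<comment> \<open>With \<open>r = \<kappa> + \<delta>/4\<close> the identity for the exponents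
      leaves \<open>2 * e = 3 * \<delta>/4 - s\<close>, so \<open>s\<close> must lie below
      \<open>\<kappa>\<close> and also be small compared with \<open>\<delta>\<close>.\<close>
    define s where "s = min (\<kappa>/2) (\<delta>/4)"
    have s: "s > 0" "s < \<kappa>" "s \<le> \<delta>/4" using k \<delta> by (auto simp: s_def)
    have "rudin_forelli \<Omega> \<sigma> K (\<kappa> + \<delta>/4) s"
      by (rule rudin_forelli_pos) (use k s \<delta> in auto)
    moreover have "(3 * \<delta>/4 - s) / 2 > 0" using s \<delta> by simp
    moreover have "\<kappa> + \<delta>/4 + s + 2 * ((3 * \<delta>/4 - s) / 2) = 2 * (2 - q)"
      unfolding \<delta>_def by (simp add: field_simps)
    moreover have "\<kappa> + \<delta>/4 > 0" "q < 2" using k \<delta> q \<kappa>_range by auto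
    ultimately show ?thesis using that s(1) p(1) q(2) conj by blast
  qed
qed

lemma rudin_forelli_bound:
  assumes "rudin_forelli \<Omega> \<sigma> K r s"
  obtains D where "D \<ge> 0" "\<forall>w\<in>\<Omega>. (\<integral>\<^sup>+z. ennreal (cmod (K w z) powr ((r + s) / 2) /
     (nK w powr s * nK z powr r)) \<partial>Lm) \<le> ennreal D"
proof -
  obtain D where D: "\<forall>z\<in>\<Omega>. (\<integral>\<^sup>+ w. ennreal (cmod (ip \<sigma> (K z) (K w)) powr ((r + s) / 2) /
                 (nK z powr s * nK w powr r)) \<partial>Lm) \<le> ennreal D"
    using assms unfolding rudin_forelli_def by blast
  show ?thesis
  proof (rule that[of "max D 0"])
    show "\<forall>w\<in>\<Omega>. (\<integral>\<^sup>+z. ennreal (cmod (K w z) powr ((r + s) / 2) /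
     (nK w powr s * nK z powr r)) \<partial>Lm) \<le> ennreal (max D 0)"
    proof
      fix w assume w: "w \<in> \<Omega>"
      have "(\<integral>\<^sup>+z. ennreal (cmod (K w z) powr ((r + s) / 2) / (nK w powr s * nK z powr r)) \<partial>Lm)
          = (\<integral>\<^sup>+z. ennreal (cmod (ip \<sigma> (K w) (K z)) powr ((r + s) / 2) / (nK w powr s * nK z powr r)) \<partial>Lm)"
        using w by (intro nn_integral_cong) (simp add: lam_def space_\<sigma> cmod_ip_K)
      also have "\<dots> \<le> ennreal D" using D w by blast
      finally show "(\<integral>\<^sup>+z. ennreal (cmod (K w z) powr ((r + s) / 2) / (nK w powr s * nK z powr r)) \<partial>Lm)
        \<le> ennreal (max D 0)" by (rule order_trans) (simp add: ennreal_leI)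
    qed
  qed simp
qed

lemma d_measurable:
  "(\<lambda>(z, w). d z w) \<in> borel_measurable (\<sigma> \<Otimes>\<^sub>M \<sigma>)"
  "w \<in> \<Omega> \<Longrightarrow> (\<lambda>z. d z w) \<in> borel_measurable \<sigma>"
proof -
  show *: "(\<lambda>(z, w). d z w) \<in> borel_measurable (\<sigma> \<Otimes>\<^sub>M \<sigma>)"
    by (rule measurable_pair_continuous[OF d_continuous])
  show "(\<lambda>z. d z w) \<in> borel_measurable \<sigma>" if "w \<in> \<Omega>"
    using measurable_compose[OF measurable_Pair2'[of w \<sigma> \<sigma>] *] that by (simp add: space_\<sigma>)
qed

lemma B_measurable: "f \<in> B \<Longrightarrow> f \<in> borel_measurable \<sigma>"
  by (simp add: bspace_def)

text \<open>The exponent \<open>1 - 2/p\<close> is dictated by the substitution: its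
  \<open>p\<close>-th power becomes \<open>nK z powr (p - 2)\<close>, which with the density
  \<open>(nK z)\<^sup>2\<close> of \<lambda> makes \<open>nK z powr p\<close>. This is the weight
  that turns the composed function into \<open>U w (S (kn \<sigma> K w))\<close> up to
  constants.\<close>

lemma Lp_change_of_variables:
  assumes S: "bop S" and p: "p > 0"
    and hyp: "Lp_hyp \<Omega> \<sigma> \<phi> K p S"
  obtains M where "M \<ge> 0" "\<forall>w\<in>\<Omega>. (\<integral>\<^sup>+z. ennreal ((cmod (S (kn \<sigma> K w) z) *
      nK (\<phi> w z) powr (1 - 2/p) / nK z) powr p) \<partial>Lm) \<le> ennreal M"
proof -
  obtain M where M: "\<forall>z\<in>\<Omega>. in_Lp \<sigma> p (U z (S (kn \<sigma> K z))) \<and> Lp_norm \<sigma> p (U z (S (kn \<sigma> K z))) \<le> M"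
    using hyp unfolding Lp_hyp_def by blast
  define M' where "M' = max M 0"
  show ?thesis
  proof (rule that[of "C * (C powr p * M' powr p)"])
    show "0 \<le> C * (C powr p * M' powr p)" using C_ge by simp
    show "\<forall>w\<in>\<Omega>. (\<integral>\<^sup>+z. ennreal ((cmod (S (kn \<sigma> K w) z) * nK (\<phi> w z) powr (1 - 2/p) / nK z) powr p) \<partial>Lm)
        \<le> ennreal (C * (C powr p * M' powr p))"
    proof
      fix w assume w: "w \<in> \<Omega>"
      let ?f = "S (kn \<sigma> K w)"
      let ?u = "U w ?f"
      note f = bop_in[OF S kn_in[OF w]]
      note [measurable] = B_measurable[OF f] \<phi>_measurable[OF w] B_measurable[OF U_in[OF w f]]
      let ?F = "\<lambda>z. ennreal ((cmod (?f z) * nK (\<phi> w z) powr (1 - 2/p) / nK z) powr p)"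
      have n\<phi> [measurable]: "(\<lambda>z. nK (\<phi> w z)) \<in> borel_measurable \<sigma>"
        by (rule measurable_compose[OF \<phi>_measurable[OF w] n_measurable])
      have F: "?F \<in> borel_measurable \<sigma>" by measurable
      have F\<phi>: "(\<lambda>z. ?F (\<phi> w z)) \<in> borel_measurable \<sigma>"
        by (rule measurable_compose[OF \<phi>_measurable[OF w] F])
      have int_u: "(\<integral>x. cmod (?u x) powr p \<partial>\<sigma>) \<le> M' powr p"
      proof -
        let ?I = "\<integral>x. cmod (?u x) powr p \<partial>\<sigma>"
        have "?I = (?I powr (1/p)) powr p" using p by (simp add: powr_powr)
        also have "\<dots> \<le> M' powr p"
          using M w p by (intro powr_mono2) (auto simp: Lp_norm_def M'_def intro: le_max_iff_disj[THEN iffD2])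
        finally show ?thesis .
      qed
      have "(\<integral>\<^sup>+z. ?F (\<phi> w z) \<partial>Lm) = (\<integral>\<^sup>+z. ennreal ((nK z)\<^sup>2) * ?F (\<phi> w z) \<partial>\<sigma>)"
        by (rule nn_integral_Lm[OF F\<phi>])
      also have "\<dots> \<le> (\<integral>\<^sup>+z. ennreal (C powr p) * ennreal (cmod (?u z) powr p) \<partial>\<sigma>)"
      proof (rule nn_integral_mono)
        fix z assume "z \<in> space \<sigma>"
        then have z: "z \<in> \<Omega>" by (simp add: space_\<sigma>)
        let ?x = "cmod (?f (\<phi> w z))"
        let ?m = "nK z" and ?m' = "nK (\<phi> w z)"
        have pos: "?m > 0" "?m' > 0" using z w n_pos \<phi>_in by auto
        have "?x * (?m / ?m') \<le> ?x * (C * cmod (kn \<sigma> K w z))"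
          by (rule mult_left_mono[OF cmod_kn_ge[OF w z]]) simp
        also have "\<dots> = C * cmod (?u z)" using z by (simp add: transl_def norm_mult)
        finally have le: "?x * (?m / ?m') \<le> C * cmod (?u z)" .
        have "(nK z)\<^sup>2 * (?x * nK (\<phi> w (\<phi> w z)) powr (1 - 2/p) / ?m') powr p
            = ?m powr 2 * (?x powr p * ?m powr ((1 - 2/p) * p) / ?m' powr p)"
          using pos z w by (simp add: \<phi>_inv powr_mult powr_divide powr_powr)
        also have "(1 - 2/p) * p = p - 2" using p by (simp add: field_simps)
        also have "?m powr 2 * (?x powr p * ?m powr (p - 2) / ?m' powr p) = (?x * (?m / ?m')) powr p"
          using pos by (simp add: powr_mult powr_divide powr_diff)
        also have "\<dots> \<le> (C * cmod (?u z)) powr p"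
          using p pos le by (intro powr_mono2) auto
        also have "\<dots> = C powr p * cmod (?u z) powr p" using C_ge by (simp add: powr_mult)
        finally show "ennreal ((nK z)\<^sup>2) * ?F (\<phi> w z) \<le> ennreal (C powr p) * ennreal (cmod (?u z) powr p)"
          by (simp add: ennreal_mult[symmetric] ennreal_leI)
      qed
      also have "\<dots> = ennreal (C powr p) * (\<integral>\<^sup>+z. ennreal (cmod (?u z) powr p) \<partial>\<sigma>)"
        by (rule nn_integral_cmult) measurable
      also have "(\<integral>\<^sup>+z. ennreal (cmod (?u z) powr p) \<partial>\<sigma>) = ennreal (\<integral>x. cmod (?u x) powr p \<partial>\<sigma>)"
        using M w by (intro nn_integral_eq_integral) (auto simp: in_Lp_def)
      also have "ennreal (C powr p) * ennreal (\<integral>x. cmod (?u x) powr p \<partial>\<sigma>)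
          \<le> ennreal (C powr p) * ennreal (M' powr p)"
        by (intro mult_left_mono ennreal_leI int_u) auto
      finally have F\<phi>_le: "(\<integral>\<^sup>+z. ?F (\<phi> w z) \<partial>Lm) \<le> ennreal (C powr p) * ennreal (M' powr p)" .
      \<comment> \<open>Inserting the involution twice brings the integral into the composed form to
        which quasi-invariance applies.\<close>
      have "(\<integral>\<^sup>+z. ?F z \<partial>Lm) = (\<integral>\<^sup>+z. ?F (\<phi> w (\<phi> w z)) \<partial>Lm)"
        using w by (intro nn_integral_cong) (simp add: lam_def space_\<sigma> \<phi>_inv)
      also have "\<dots> \<le> ennreal C * (\<integral>\<^sup>+z. ?F (\<phi> w z) \<partial>Lm)"
        by (rule nn_integral_\<phi>[OF w F\<phi>])
      also have "\<dots> \<le> ennreal C * (ennreal (C powr p) * ennreal (M' powr p))"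
        by (rule mult_left_mono[OF F\<phi>_le]) simp
      also have "\<dots> = ennreal (C * (C powr p * M' powr p))"
        using C_ge by (simp add: ennreal_mult)
      finally show "(\<integral>\<^sup>+z. ?F z \<partial>Lm) \<le> ennreal (C * (C powr p * M' powr p))" .
    qed
  qed
qed

text \<open>With \<open>\<rho> = \<parallel>K\<^bsub>\<phi>\<^sub>w(z)\<^esub>\<parallel>\<close>, Young's inequality splits the integrand into
  \<open>|S k\<^sub>w(z)| \<rho>\<^bsup>1 - 2/p\<^esup> / \<parallel>K\<^sub>z\<parallel>\<close>, whose \<open>p\<close>-th power is the hypothesis on \<open>U\<^sub>w S k\<^sub>w\<close> after the
  substitution \<open>z = \<phi>\<^sub>w(u)\<close>, and a factor whose \<open>q\<close>-th power is a Rudin-Forelli integrand times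
  \<open>\<rho>\<^bsup>-e\<^esup>\<close>; the latter is small where \<open>d(z, w)\<close> is large. The weight exponent \<open>a\<close> depends
  on \<open>p\<close> and \<open>\<kappa>\<close> only, so that it serves both \<open>T\<close> and its adjoint.\<close>

lemma kernel_tail:
  assumes p: "p > (4 - \<kappa>) / (2 - \<kappa>)"
  obtains a where "\<forall>S. bop S \<and> Lp_hyp \<Omega> \<sigma> \<phi> K p S \<longrightarrow> (\<forall>\<epsilon>>0. \<exists>R. \<forall>w\<in>\<Omega>.
     (\<integral>\<^sup>+z. ennreal (if d z w > R then cmod (S (K w) z) * nK z powr a else 0) \<partial>\<sigma>)
       \<le> ennreal (\<epsilon> * nK w powr a))"
proof -
  define q where "q = p / (p - 1)"
  obtain r s e where RF: "rudin_forelli \<Omega> \<sigma> K r s" and rs: "e > 0" "r + s + 2 * e = 2 * (2 - q)" "r > 0" "s > 0"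
    and pq: "p > 2" "1 < q" "q < 2" "1/p + 1/q = 1"
    using rudin_forelli_exponents[OF p q_def] .
  obtain D where D: "D \<ge> 0" "\<forall>w\<in>\<Omega>. (\<integral>\<^sup>+z. ennreal (cmod (K w z) powr ((r + s) / 2) /
     (nK w powr s * nK z powr r)) \<partial>Lm) \<le> ennreal D"
    using rudin_forelli_bound[OF RF] .
  \<comment> \<open>\<open>A\<close> is the exponent of the kernel in the Rudin-Forelli integrand.
    As \<open>q - 2 = - e - A\<close>, the factor \<open>\<rho> powr (q - 2)\<close> is the gain
    \<open>\<rho> powr (-e)\<close> times \<open>\<rho> powr (-A)\<close>, and the lower kernel
    bound turns the latter into \<open>k powr A\<close>.\<close>
  define A where "A = (r + s) / 2"
  have A: "A > 0" "A = 2 - q - e" using rs by (simp_all add: A_def)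
  \<comment> \<open>\<open>a * q = 2 - r - e\<close> gives \<open>m\<close> the power
    \<open>-r\<close>; the relation between \<open>r\<close>, \<open>s\<close>, \<open>e\<close> and
    \<open>q\<close> then gives \<open>N\<close> the power \<open>-s\<close>.\<close>
  define a where "a = (2 - r - e) / q"
  have aq: "a * q = 2 - r - e" using pq by (simp add: a_def)
  have g_bound: "(\<rho> powr (2/p - 1) * m powr (a - 1) * N powr (1 - a)) powr q
      \<le> C powr A * \<rho> powr (-e) * (k powr A / (N powr s * m powr r))"
    if pos: "\<rho> > 0" "m > 0" "N > 0" "k > 0" and le: "N * m / \<rho> \<le> C * k" for \<rho> m N k :: real
  proof -
    have "(2/p - 1) * q = q - 2"
    proof -
      have "q / p = q - 1" using pq by (simp add: q_def field_simps)
      then show ?thesis by (simp add: left_diff_distrib)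
    qed
    then have "(\<rho> powr (2/p - 1) * m powr (a - 1) * N powr (1 - a)) powr q
        = \<rho> powr (q - 2) * m powr ((a - 1) * q) * N powr ((1 - a) * q)"
      using pos by (simp add: powr_mult powr_powr)
    also have "q - 2 = - e + - A" using A by simp
    also have "\<rho> powr (- e + - A) = \<rho> powr (-e) * (1 / \<rho>) powr A"
    proof -
      have "(1 / \<rho>) powr A = \<rho> powr (- A)"
        using pos by (simp add: powr_minus powr_divide inverse_eq_divide)
      then show ?thesis by (simp only: powr_add)
    qed
    also have "\<rho> powr (-e) * (1 / \<rho>) powr A * m powr ((a - 1) * q) * N powr ((1 - a) * q)
        \<le> \<rho> powr (-e) * (C * k / (N * m)) powr A * m powr ((a - 1) * q) * N powr ((1 - a) * q)"
    proof -
      have "1 / \<rho> \<le> C * k / (N * m)" using le pos by (simp add: field_simps)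
      then have "(1 / \<rho>) powr A \<le> (C * k / (N * m)) powr A" using pos A by (intro powr_mono2) auto
      then show ?thesis by (intro mult_right_mono mult_left_mono) auto
    qed
    also have "\<dots> = C powr A * \<rho> powr (-e) * (k powr A * N powr (- A + (1 - a) * q) * m powr (- A + (a - 1) * q))"
    proof -
      have eq: "(C * k / (N * m)) powr A = C powr A * k powr A * N powr (- A) * m powr (- A)"
        using pos C_ge by (simp add: powr_mult powr_divide powr_minus field_simps)
      show ?thesis unfolding eq powr_add by (simp only: mult_ac)
    qed
    also have "- A + (1 - a) * q = - s" using A aq rs by (simp add: left_diff_distrib)
    also have "- A + (a - 1) * q = - r" using A aq rs by (simp add: left_diff_distrib)
    also have "k powr A * N powr (- s) * m powr (- r) = k powr A / (N powr s * m powr r)"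
      by (simp add: powr_minus field_simps)
    finally show ?thesis .
  qed
  have main: "\<exists>R. \<forall>w\<in>\<Omega>. (\<integral>\<^sup>+z. ennreal (if d z w > R then cmod (S (K w) z) * nK z powr a else 0) \<partial>\<sigma>)
       \<le> ennreal (\<epsilon> * nK w powr a)"
    if S: "bop S" and hyp: "Lp_hyp \<Omega> \<sigma> \<phi> K p S" and \<epsilon>: "\<epsilon> > 0" for S \<epsilon>
  proof -
    obtain M where M: "M \<ge> 0" "\<forall>w\<in>\<Omega>. (\<integral>\<^sup>+z. ennreal ((cmod (S (kn \<sigma> K w) z) *
      nK (\<phi> w z) powr (1 - 2/p) / nK z) powr p) \<partial>Lm) \<le> ennreal M"
      using Lp_change_of_variables[OF S _ hyp] pq by auto
    \<comment> \<open>\<open>t\<close> makes the first Young term at most half of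
      \<open>\<epsilon>\<close>, whatever the radius is. Adding 1 to \<open>M\<close> avoids
      division by zero.\<close>
    define t where "t = (\<epsilon> / 2 / (M + 1)) powr (1/p)"
    have t: "t > 0" using \<epsilon> M by (simp add: t_def)
    have tM: "t powr p * M \<le> \<epsilon> / 2"
    proof -
      have "t powr p = \<epsilon> / 2 / (M + 1)" using pq \<epsilon> M by (simp add: t_def powr_powr)
      moreover have "M + 1 \<noteq> 0" using M(1) by simp
      ultimately have "t powr p * (M + 1) = \<epsilon> / 2"
        by (rule iffD1[OF nonzero_eq_divide_eq, rotated])
      moreover have "t powr p * M \<le> t powr p * (M + 1)" by (intro mult_left_mono) auto
      ultimately show ?thesis by simp
    qed
    define X where "X = t powr (-q) * C powr A * D"
    have X: "X \<ge> 0" using D by (simp add: X_def)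
    define Y where "Y = 2 * X / \<epsilon> + 1"
    have Y: "Y > 0" using X \<epsilon> by (simp add: Y_def add_nonneg_pos)
    have XY: "X \<le> \<epsilon> / 2 * Y" using \<epsilon> by (simp add: Y_def distrib_left)
    \<comment> \<open>With \<open>t\<close> fixed, \<open>L\<close> is the size of
      \<open>nK (\<phi> w z)\<close> beyond which the Rudin-Forelli term is also at most half of
      \<open>\<epsilon>\<close>.\<close>
    define L where "L = Y powr (1/e)"
    have L: "L > 0" using Y by (simp add: L_def)
    have LX: "L powr (-e) * X \<le> \<epsilon> / 2"
    proof -
      have "L powr e = Y" using rs Y by (simp add: L_def powr_powr)
      then have "L powr (-e) = 1 / Y" by (simp add: powr_minus inverse_eq_divide)
      then show ?thesis using XY Y by (simp add: divide_le_eq)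
    qed
    obtain R0 where R0: "\<forall>z\<in>\<Omega>. d z 0 > R0 \<longrightarrow> nK z > L" using norm_K_unbounded by blast
    \<comment> \<open>\<open>\<phi> w\<close> sends \<open>w\<close> to the origin, so
      \<open>d z w > C * R0\<close> forces \<open>d (\<phi> w z) 0 > R0\<close>, where the kernel
      norms exceed \<open>L\<close>.\<close>
    define R where "R = C * R0"
    show ?thesis
    proof (intro exI ballI)
      fix w assume w: "w \<in> \<Omega>"
      let ?f = "\<lambda>z. cmod (S (kn \<sigma> K w) z) * nK (\<phi> w z) powr (1 - 2/p) / nK z"
      let ?k = "\<lambda>z. cmod (K w z) powr A / (nK w powr s * nK z powr r)"
      note [measurable] = \<phi>_measurable[OF w] B_measurable[OF bop_in[OF S kn_in[OF w]]]
        B_measurable[OF K_in[OF w]] d_measurable(2)[OF w] B_measurable[OF bop_in[OF S K_in[OF w]]]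
      have n\<phi> [measurable]: "(\<lambda>z. nK (\<phi> w z)) \<in> borel_measurable \<sigma>"
        by (rule measurable_compose[OF \<phi>_measurable[OF w] n_measurable])
      let ?c = "nK w powr a"
      have point: "1 / (nK z)\<^sup>2 * (if d z w > R then cmod (S (K w) z) * nK z powr a else 0)
          \<le> ?c * (t powr p * ?f z powr p + t powr (-q) * C powr A * L powr (-e) * ?k z)"
        if z: "z \<in> \<Omega>" for z
      proof (cases "d z w > R")
        case True
        have pos: "nK z > 0" "nK w > 0" "nK (\<phi> w z) > 0" using z w n_pos \<phi>_in by auto
        have kpos: "cmod (K w z) > 0" using K_nonzero[OF w z] by simp
        have "d (\<phi> w z) 0 > R0"
        proof -
          have "C * R0 < C * d (\<phi> w z) 0"
            using True hm.d_\<phi>'[OF z w w] hm.\<phi>_self[OF w] by (simp add: R_def)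
          then show ?thesis using C_ge by simp
        qed
        then have \<rho>: "nK (\<phi> w z) > L" using R0 \<phi>_in[OF w z] by blast
        let ?g = "nK (\<phi> w z) powr (2/p - 1) * nK z powr (a - 1) * nK w powr (1 - a)"
        have SK: "cmod (S (K w) z) = nK w * cmod (S (kn \<sigma> K w) z)"
        proof -
          have "S (kn \<sigma> K w) = (\<lambda>z. complex_of_real (1 / nK w) * S (K w) z)"
            unfolding kn_eq by (rule bop_cmult[OF S K_in[OF w]])
          then show ?thesis using pos by (simp add: norm_mult norm_divide)
        qed
        have "1 / (nK z)\<^sup>2 * (cmod (S (K w) z) * nK z powr a) = ?c * (?f z * ?g)"
        proof -
          have 1: "nK (\<phi> w z) powr (1 - 2/p) * nK (\<phi> w z) powr (2/p - 1) = 1"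
            using pos by (simp flip: powr_add)
          have 2: "nK w powr a * nK w powr (1 - a) = nK w" using pos by (simp flip: powr_add)
          have 3: "nK z powr (a - 1) = nK z powr a / nK z" using pos by (simp add: powr_diff)
          have "?c * (?f z * ?g) = cmod (S (kn \<sigma> K w) z) *
              (nK (\<phi> w z) powr (1 - 2/p) * nK (\<phi> w z) powr (2/p - 1)) *
              (nK w powr a * nK w powr (1 - a)) * (nK z powr (a - 1) / nK z)"
            by (simp add: mult_ac)
          also have "\<dots> = 1 / (nK z)\<^sup>2 * (cmod (S (K w) z) * nK z powr a)"
            unfolding 1 2 3 SK by (simp add: power2_eq_square)
          finally show ?thesis by simp
        qed
        also have "\<dots> \<le> ?c * (t powr p * ?f z powr p + t powr (-q) * ?g powr q)"
          by (intro mult_left_mono Youngs_inequality_scaled) (use pq t pos in auto)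
        also have "\<dots> \<le> ?c * (t powr p * ?f z powr p + t powr (-q) * (C powr A * L powr (-e) * ?k z))"
        proof (intro mult_left_mono add_left_mono)
          have "?g powr q \<le> C powr A * nK (\<phi> w z) powr (-e) * ?k z"
            by (rule g_bound[OF pos(3,1,2) kpos K_ge[OF w z]])
          also have "\<dots> \<le> C powr A * L powr (-e) * ?k z"
            using \<rho> L rs by (intro mult_right_mono mult_left_mono powr_mono2') auto
          finally show "?g powr q \<le> C powr A * L powr (-e) * ?k z" .
        qed auto
        finally show ?thesis using True by (simp add: mult_ac)
      next
        case False
        then show ?thesis by simp
      qed
      have "(\<integral>\<^sup>+z. ennreal (if d z w > R then cmod (S (K w) z) * nK z powr a else 0) \<partial>\<sigma>)
          = (\<integral>\<^sup>+z. ennreal (1 / (nK z)\<^sup>2) * ennreal (if d z w > R then cmod (S (K w) z) * nK z powr a else 0) \<partial>Lm)"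
        by (rule nn_integral_Lm_inverse) measurable
      also have "\<dots> \<le> (\<integral>\<^sup>+z. ennreal (?c * t powr p) * ennreal (?f z powr p) +
          ennreal (?c * (t powr (-q) * C powr A * L powr (-e))) * ennreal (?k z) \<partial>Lm)"
      proof (rule nn_integral_mono)
        fix z assume "z \<in> space Lm"
        then have z: "z \<in> \<Omega>" by (simp add: lam_def space_\<sigma>)
        have "ennreal (1 / (nK z)\<^sup>2) * ennreal (if d z w > R then cmod (S (K w) z) * nK z powr a else 0)
          = ennreal (1 / (nK z)\<^sup>2 * (if d z w > R then cmod (S (K w) z) * nK z powr a else 0))"
          by (subst ennreal_mult) auto
        also have "\<dots> \<le> ennreal (?c * t powr p * ?f z powr p + ?c * (t powr (-q) * C powr A * L powr (-e)) * ?k z)"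
          using point[OF z] by (intro ennreal_leI) (simp add: algebra_simps)
        also have "\<dots> = ennreal (?c * t powr p) * ennreal (?f z powr p) +
          ennreal (?c * (t powr (-q) * C powr A * L powr (-e))) * ennreal (?k z)"
          by (simp add: ennreal_mult[symmetric])
        finally show "ennreal (1 / (nK z)\<^sup>2) * ennreal (if d z w > R then cmod (S (K w) z) * nK z powr a else 0)
          \<le> ennreal (?c * t powr p) * ennreal (?f z powr p) +
          ennreal (?c * (t powr (-q) * C powr A * L powr (-e))) * ennreal (?k z)" .
      qed
      also have "\<dots> = ennreal (?c * t powr p) * (\<integral>\<^sup>+z. ennreal (?f z powr p) \<partial>Lm) +
          ennreal (?c * (t powr (-q) * C powr A * L powr (-e))) * (\<integral>\<^sup>+z. ennreal (?k z) \<partial>Lm)"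
        by (subst nn_integral_add) (auto simp: nn_integral_cmult)
      also have "\<dots> \<le> ennreal (?c * t powr p) * ennreal M +
          ennreal (?c * (t powr (-q) * C powr A * L powr (-e))) * ennreal D"
        using M(2) D(2) w unfolding A_def by (intro add_mono mult_left_mono) auto
      also have "\<dots> = ennreal (?c * (t powr p * M + L powr (-e) * X))"
        using M(1) D(1) by (simp add: ennreal_mult[symmetric] X_def algebra_simps flip: ennreal_plus)
      also have "\<dots> \<le> ennreal (\<epsilon> * ?c)"
        using tM LX mult_left_mono[of "t powr p * M + L powr (-e) * X" \<epsilon> ?c]
        by (intro ennreal_leI) (simp add: mult.commute)
      finally show "(\<integral>\<^sup>+z. ennreal (if d z w > R then cmod (S (K w) z) * nK z powr a else 0) \<partial>\<sigma>)
          \<le> ennreal (\<epsilon> * nK w powr a)" .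
    qed
  qed
  show ?thesis by (rule that[of a]) (use main in blast)
qed

abbreviation "admissible p T \<equiv> p > (4 - \<kappa>) / (2 - \<kappa>) \<and> bounded_op \<Omega> \<sigma> T \<and>
            Lp_hyp \<Omega> \<sigma> \<phi> K p T \<and> Lp_hyp \<Omega> \<sigma> \<phi> K p (hadj \<Omega> \<sigma> T)"

text \<open>Column sums are \<open>kernel_tail\<close> for \<open>T\<close>, row sums are
  \<open>kernel_tail\<close> for the adjoint, with the same weight. The moduli stay inside the
  integral, and \<open>g\<close> is any square-integrable function, since truncations leave the
  holomorphic space.\<close>

lemma off_diagonal_small:
  assumes T: "admissible p T" and \<epsilon>: "\<epsilon> > 0"
  obtains R where "R > 0" "\<forall>g\<in>sqint \<sigma>. (\<integral>\<^sup>+z. (\<integral>\<^sup>+w. ennreal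
      ((if d z w > R then cmod (T (K w) z) else 0) * cmod (g w)) \<partial>\<sigma>)\<^sup>2 \<partial>\<sigma>) \<le> ennreal ((\<epsilon> * bnorm \<sigma> g)\<^sup>2)"
proof -
  obtain a where a: "\<forall>S. bop S \<and> Lp_hyp \<Omega> \<sigma> \<phi> K p S \<longrightarrow> (\<forall>\<epsilon>>0. \<exists>R. \<forall>w\<in>\<Omega>.
     (\<integral>\<^sup>+z. ennreal (if d z w > R then cmod (S (K w) z) * nK z powr a else 0) \<partial>\<sigma>)
       \<le> ennreal (\<epsilon> * nK w powr a))"
    using kernel_tail[of p] T by blast
  have bT: "bop T" using T by simp
  obtain R1 where R1: "\<forall>w\<in>\<Omega>. (\<integral>\<^sup>+z. ennreal (if d z w > R1 then cmod (T (K w) z) * nK z powr a else 0) \<partial>\<sigma>)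
       \<le> ennreal (\<epsilon> * nK w powr a)"
    using a[rule_format, of T \<epsilon>] T \<epsilon> by auto
  obtain R2 where R2: "\<forall>w\<in>\<Omega>. (\<integral>\<^sup>+z. ennreal (if d z w > R2 then cmod (adj T (K w) z) * nK z powr a else 0) \<partial>\<sigma>)
       \<le> ennreal (\<epsilon> * nK w powr a)"
    using a[rule_format, of "adj T" \<epsilon>] T \<epsilon> bop_adj[OF bT] by auto
  define R where "R = max 1 (max R1 R2)"
  have R: "R > 0" "R \<ge> R1" "R \<ge> R2" by (auto simp: R_def)
  let ?R = "\<lambda>z w. if d z w > R then cmod (T (K w) z) else 0"
  note [measurable] = d_measurable(1)[unfolded case_prod_beta]
  have k [measurable]: "(\<lambda>p. T (K (snd p)) (fst p)) \<in> borel_measurable (\<sigma> \<Otimes>\<^sub>M \<sigma>)"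
    using measurable_pair_continuous[OF kernel_continuous[OF bT]] by (simp add: case_prod_beta')
  have main: "(\<integral>\<^sup>+z. (\<integral>\<^sup>+w. ennreal (?R z w * cmod (g w)) \<partial>\<sigma>)\<^sup>2 \<partial>\<sigma>) \<le> ennreal ((\<epsilon> * bnorm \<sigma> g)\<^sup>2)"
    if g: "g \<in> sqint \<sigma>" for g
  proof -
    have [measurable]: "g \<in> borel_measurable \<sigma>" using g by (auto dest!: sqint_measurable)
    have "(\<integral>\<^sup>+z. (\<integral>\<^sup>+w. ennreal (?R z w * cmod (g w)) \<partial>\<sigma>)\<^sup>2 \<partial>\<sigma>)
        \<le> ennreal (\<epsilon>\<^sup>2) * (\<integral>\<^sup>+w. ennreal ((cmod (g w))\<^sup>2) \<partial>\<sigma>)"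
    proof (rule schur_test[where h = "\<lambda>z. nK z powr a"])
      show "sigma_finite_measure \<sigma>"
        using finite_\<sigma> by (rule finite_measure.axioms)
      show "(\<lambda>(z, w). ?R z w) \<in> borel_measurable (\<sigma> \<Otimes>\<^sub>M \<sigma>)"
        unfolding case_prod_beta by measurable
      show "(\<integral>\<^sup>+w. ennreal (?R z w * nK w powr a) \<partial>\<sigma>) \<le> ennreal (\<epsilon> * nK z powr a)" if "z \<in> space \<sigma>" for z
      proof -
        have z: "z \<in> \<Omega>" using that by (simp add: space_\<sigma>)
        have "(\<integral>\<^sup>+w. ennreal (?R z w * nK w powr a) \<partial>\<sigma>)
            \<le> (\<integral>\<^sup>+w. ennreal (if d w z > R2 then cmod (adj T (K z) w) * nK w powr a else 0) \<partial>\<sigma>)"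
          using R(3) z by (intro nn_integral_mono ennreal_leI)
            (auto simp: space_\<sigma> kernel_adj[OF bT z] hm.commute)
        also have "\<dots> \<le> ennreal (\<epsilon> * nK z powr a)" using R2 z by blast
        finally show ?thesis .
      qed
      show "(\<integral>\<^sup>+z. ennreal (?R z w * nK z powr a) \<partial>\<sigma>) \<le> ennreal (\<epsilon> * nK w powr a)" if "w \<in> space \<sigma>" for w
      proof -
        have w: "w \<in> \<Omega>" using that by (simp add: space_\<sigma>)
        have "(\<integral>\<^sup>+z. ennreal (?R z w * nK z powr a) \<partial>\<sigma>)
            \<le> (\<integral>\<^sup>+z. ennreal (if d z w > R1 then cmod (T (K w) z) * nK z powr a else 0) \<partial>\<sigma>)"
          using R(2) by (intro nn_integral_mono ennreal_leI) auto
        also have "\<dots> \<le> ennreal (\<epsilon> * nK w powr a)" using R1 w by blast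
        finally show ?thesis .
      qed
      show "nK z powr a > 0" if "z \<in> space \<sigma>" for z using n_pos[of z] that by (simp add: space_\<sigma>)
    qed (use \<epsilon> in auto)
    also have "\<dots> = ennreal ((\<epsilon> * bnorm \<sigma> g)\<^sup>2)"
      by (simp add: nn_bnorm[OF g] ennreal_mult[symmetric] power_mult_distrib)
    finally show ?thesis .
  qed
  show ?thesis by (rule that[OF R(1)]) (use main in blast)
qed

end

section \<open>Localization to balls\<close>

lemma ennreal_power2_add_le: "(a + b)\<^sup>2 \<le> 2 * a\<^sup>2 + 2 * (b :: ennreal)\<^sup>2"
proof (cases a; cases b)
  fix x y :: real assume xy: "0 \<le> x" "a = ennreal x" "0 \<le> y" "b = ennreal y"
  have "(x + y)\<^sup>2 \<le> 2 * x\<^sup>2 + 2 * y\<^sup>2" using sum_squares_bound[of x y] by (simp add: power2_sum)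
  then have "ennreal ((x + y)\<^sup>2) \<le> ennreal (2 * x\<^sup>2 + 2 * y\<^sup>2)" by (rule ennreal_leI)
  also have "\<dots> = 2 * ennreal (x\<^sup>2) + 2 * ennreal (y\<^sup>2)"
    by (subst ennreal_plus) (simp_all add: ennreal_mult)
  finally show ?thesis using xy by (simp add: ennreal_power flip: ennreal_plus)
qed (auto simp: ennreal_mult_eq_top_iff)

context bergman
begin

section \<open>Volumes of metric balls\<close>

lemma \<phi>_image_sets:
  assumes "z \<in> \<Omega>" "E \<in> sets \<sigma>"
  shows "\<phi> z ` E \<in> sets \<sigma>"
proof -
  have "E \<subseteq> \<Omega>" using assms(2) sets_\<sigma>_iff by simp
  then have "\<phi> z ` E = \<phi> z -` E \<inter> space \<sigma>"
    using assms(1) \<phi>_in \<phi>_inv by (auto simp: space_\<sigma> intro: rev_image_eqI)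
  then show ?thesis using measurable_sets[OF \<phi>_measurable[OF assms(1)] assms(2)] by simp
qed

lemma emeasure_Lm:
  assumes "E \<in> sets \<sigma>"
  shows "emeasure Lm E = (\<integral>\<^sup>+z. ennreal ((nK z)\<^sup>2) * indicator E z \<partial>\<sigma>)"
  unfolding lam_def using assms by (intro emeasure_density) measurable

lemma emeasure_Lm_ball_finite:
  assumes "x \<in> \<Omega>"
  shows "emeasure Lm (Db x r) < \<infinity>"
proof -
  have "compact (hm.mcball x r)" by (rule hm.compact_mcball[OF assms])
  then have "compact ((\<lambda>z. nK z) ` hm.mcball x r)"
    by (intro compact_continuous_image continuous_on_subset[OF n_continuous]) (rule hm.mcball_subset_mspace)
  then obtain b where b: "\<And>z. z \<in> hm.mcball x r \<Longrightarrow> nK z \<le> b"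
    using compact_imp_bounded bounded_imp_bdd_above unfolding bdd_above_def by (metis imageI)
  have "emeasure Lm (Db x r) \<le> (\<integral>\<^sup>+z. ennreal (b\<^sup>2) \<partial>\<sigma>)"
    unfolding emeasure_Lm[OF ball_sets[OF assms]]
  proof (rule nn_integral_mono)
    fix z
    show "ennreal ((nK z)\<^sup>2) * indicator (Db x r) z \<le> ennreal (b\<^sup>2)"
      using b[of z] by (auto simp: indicator_def intro!: ennreal_leI power_mono)
  qed
  also have "\<dots> < \<infinity>"
    using finite_measure.emeasure_finite[OF finite_\<sigma>, of "space \<sigma>"]
    by (auto simp: ennreal_mult_less_top less_top)
  finally show ?thesis .
qed

text \<open>If one ball were null, doubling would make its dilates null, hence also \<lambda> and
  \<sigma>, and \<open>nK 0\<close> would vanish. Positivity permits division by volumes.\<close>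

lemma emeasure_Lm_ball_pos:
  assumes x: "x \<in> \<Omega>" and r: "r > 0"
  shows "emeasure Lm (Db x r) > 0"
proof (rule ccontr)
  assume "\<not> ?thesis"
  then have 0: "emeasure Lm (Db x r) = 0" by (simp add: not_less)
  have k: "emeasure Lm (Db x (2 ^ k * r)) = 0" for k :: nat
  proof (induction k)
    case (Suc k)
    have "emeasure Lm (Db x (2 * (2 ^ k * r))) \<le> ennreal C * emeasure Lm (Db x (2 ^ k * r))"
      using r by (intro doubling x) simp
    then show ?case using Suc by (simp add: mult.assoc)
  qed (simp add: 0)
  have "\<Omega> = (\<Union>k. Db x (2 ^ k * r))"
  proof (intro equalityI subsetI)
    fix y assume y: "y \<in> \<Omega>"
    obtain k :: nat where "d x y / r < 2 ^ k"
      using real_arch_pow[of 2 "d x y / r"] by auto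
    then have "y \<in> Db x (2 ^ k * r)" using x y r by (simp add: field_simps)
    then show "y \<in> (\<Union>k. Db x (2 ^ k * r))" by blast
  qed auto
  then have "space Lm = (\<Union>k. Db x (2 ^ k * r))" by (simp add: lam_def space_\<sigma>)
  moreover have "Db x (2 ^ k * r) \<in> null_sets Lm" for k :: nat
    using ball_sets[OF x] k by (simp add: null_sets_def sets_Lm)
  then have "(\<Union>k. Db x (2 ^ k * r)) \<in> null_sets Lm" by (rule null_sets_UN)
  ultimately have "space Lm \<in> null_sets Lm" by simp
  then have AE: "AE z in Lm. Q z" for Q by (rule AE_I') auto
  have "(\<integral>\<^sup>+z. ennreal ((cmod (K 0 z))\<^sup>2) \<partial>\<sigma>) = (\<integral>\<^sup>+z. ennreal (1 / (nK z)\<^sup>2) * ennreal ((cmod (K 0 z))\<^sup>2) \<partial>Lm)"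
    using B_measurable[OF K_in[OF base]] by (intro nn_integral_Lm_inverse) measurable
  also have "\<dots> = (\<integral>\<^sup>+z. 0 \<partial>Lm)" by (rule nn_integral_cong_AE[OF AE])
  finally have "ennreal ((nK 0)\<^sup>2) = 0" using nn_bnorm[OF B_sqint[OF K_in[OF base]]] by simp
  then show False using n_pos[OF base] by simp
qed

definition "vol r x = measure Lm (Db x r)"

lemma vol_eq: "x \<in> \<Omega> \<Longrightarrow> emeasure Lm (Db x r) = ennreal (vol r x)"
  unfolding vol_def using emeasure_Lm_ball_finite[of x r] by (intro emeasure_eq_ennreal_measure) auto

lemma vol_pos: "x \<in> \<Omega> \<Longrightarrow> r > 0 \<Longrightarrow> vol r x > 0"
  using emeasure_Lm_ball_pos[of x r] vol_eq[of x r] by simp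

lemma vol_mono:
  assumes "x \<in> \<Omega>" "y \<in> \<Omega>" "Db x r \<subseteq> Db y s"
  shows "vol r x \<le> vol s y"
proof -
  have "emeasure Lm (Db x r) \<le> emeasure Lm (Db y s)"
    using assms ball_sets[of y s] by (intro emeasure_mono) (auto simp: sets_Lm)
  then show ?thesis using assms(1,2) by (simp add: vol_eq) (simp add: vol_def)
qed

lemma vol_doubling: "x \<in> \<Omega> \<Longrightarrow> r > 0 \<Longrightarrow> vol (2 * r) x \<le> C * vol r x"
  using doubling[of x r] C_ge vol_pos[of x r] by (simp add: vol_eq ennreal_mult[symmetric] ennreal_le_iff)

text \<open>The ball at \<open>x\<close> is contained in the image under \<open>\<phi> x\<close> of
  the ball of radius \<open>C * r\<close> at the origin. The bound does not depend on
  \<open>x\<close>, which later makes the compact families independent of the centre.\<close>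

lemma vol_le_base:
  assumes x: "x \<in> \<Omega>"
  shows "vol r x \<le> C * vol (C * r) 0"
proof -
  have "Db x r \<subseteq> \<phi> x ` Db 0 (C * r)"
  proof
    fix y assume y: "y \<in> Db x r"
    then have y\<Omega>: "y \<in> \<Omega>" by simp
    have "d 0 (\<phi> x y) \<le> C * d x y" using d_\<phi>[of x y x] hm.\<phi>_self[OF x] x y\<Omega> by simp
    also have "\<dots> < C * r" using y C_ge by simp
    finally have "\<phi> x y \<in> Db 0 (C * r)" using \<phi>_in[OF x y\<Omega>] base by simp
    then show "y \<in> \<phi> x ` Db 0 (C * r)" using \<phi>_inv[OF x y\<Omega>] by (metis imageI)
  qed
  then have "emeasure Lm (Db x r) \<le> emeasure Lm (\<phi> x ` Db 0 (C * r))"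
    using \<phi>_image_sets[OF x ball_sets[OF base]] by (intro emeasure_mono) (auto simp: sets_Lm)
  also have "\<dots> \<le> ennreal C * emeasure Lm (Db 0 (C * r))"
    by (rule emeasure_\<phi>[OF x ball_sets[OF base]])
  finally show ?thesis
    using C_ge by (simp add: vol_eq[OF x] vol_eq[OF base] ennreal_mult[symmetric] vol_def ennreal_le_iff)
qed

section \<open>Averages over balls\<close>

definition near :: "real \<Rightarrow> 'n pt \<Rightarrow> 'n pt \<Rightarrow> ennreal" where
  "near r x z = (if d x z < r then 1 else 0)"

lemma near_eq: "x \<in> \<Omega> \<Longrightarrow> z \<in> \<Omega> \<Longrightarrow> near r x z = indicator (Db x r) z"
  by (simp add: near_def indicator_def)

lemma near_commute: "near r x z = near r z x"
  by (simp add: near_def hm.commute)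

lemma near_measurable [measurable]: "(\<lambda>p. near r (fst p) (snd p)) \<in> borel_measurable (\<sigma> \<Otimes>\<^sub>M \<sigma>)"
proof -
  note [measurable] = d_measurable(1)[unfolded case_prod_beta]
  show ?thesis unfolding near_def by measurable
qed

lemma near_measurable1: "x \<in> \<Omega> \<Longrightarrow> (\<lambda>z. near r x z) \<in> borel_measurable \<sigma>"
  using measurable_compose[OF measurable_Pair1'[of x \<sigma> \<sigma>] near_measurable[of r]] by (simp add: space_\<sigma>)

lemma near_measurable2: "x \<in> \<Omega> \<Longrightarrow> (\<lambda>z. near r z x) \<in> borel_measurable \<sigma>"
  using near_measurable1 by (simp add: near_commute[of r _ x])

lemma sigma_finite_\<sigma>: "sigma_finite_measure \<sigma>"
  using finite_\<sigma> by (rule finite_measure.axioms)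

lemma vol_measurable: "(\<lambda>x. vol r x) \<in> borel_measurable \<sigma>"
proof -
  interpret sigma_finite_measure \<sigma> by (rule sigma_finite_\<sigma>)
  have "(\<lambda>x. \<integral>\<^sup>+z. ennreal ((nK z)\<^sup>2) * near r x z \<partial>\<sigma>) \<in> borel_measurable \<sigma>"
    by (rule borel_measurable_nn_integral) (simp add: case_prod_beta)
  then have "(\<lambda>x. enn2real (\<integral>\<^sup>+z. ennreal ((nK z)\<^sup>2) * near r x z \<partial>\<sigma>)) \<in> borel_measurable \<sigma>"
    by measurable
  moreover have "enn2real (\<integral>\<^sup>+z. ennreal ((nK z)\<^sup>2) * near r x z \<partial>\<sigma>) = vol r x" if "x \<in> space \<sigma>" for x
  proof -
    have x: "x \<in> \<Omega>" using that by (simp add: space_\<sigma>)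
    have "(\<integral>\<^sup>+z. ennreal ((nK z)\<^sup>2) * near r x z \<partial>\<sigma>) = emeasure Lm (Db x r)"
      unfolding emeasure_Lm[OF ball_sets[OF x]]
      by (intro nn_integral_cong) (simp add: near_eq[OF x] space_\<sigma>)
    then show ?thesis by (simp add: vol_def measure_def)
  qed
  ultimately show ?thesis by (rule measurable_cong[THEN iffD1, rotated])
qed

text \<open>Averaging over all centres \<open>x\<close> with weight \<open>d\<lambda>(x) / \<lambda>(D(x, 2\<rho>))\<close> replaces a covering of \<open>\<Omega>\<close> by balls
  of radius \<open>2\<rho>\<close> whose overlap is bounded independently of \<open>\<rho>\<close>; doubling gives the two bounds.\<close>

definition avg :: "real \<Rightarrow> real \<Rightarrow> ('n pt \<Rightarrow> ennreal) \<Rightarrow> ennreal" where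
  "avg \<rho> r H = (\<integral>\<^sup>+x. ennreal ((nK x)\<^sup>2 / vol (2 * \<rho>) x) * (\<integral>\<^sup>+z. near r x z * H z \<partial>\<sigma>) \<partial>\<sigma>)"

lemma avg_swap:
  assumes H [measurable]: "H \<in> borel_measurable \<sigma>" and \<rho>: "\<rho> > 0"
  shows "avg \<rho> r H = (\<integral>\<^sup>+z. H z * (\<integral>\<^sup>+x. ennreal ((nK x)\<^sup>2) * (indicator (Db z r) x * ennreal (1 / vol (2 * \<rho>) x)) \<partial>\<sigma>) \<partial>\<sigma>)"
proof -
  interpret sigma_finite_measure \<sigma> by (rule sigma_finite_\<sigma>)
  interpret pair_sigma_finite \<sigma> \<sigma> by unfold_locales
  note [measurable] = vol_measurable
  let ?J = "\<lambda>x. ennreal ((nK x)\<^sup>2 / vol (2 * \<rho>) x)"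
  have "avg \<rho> r H = (\<integral>\<^sup>+x. (\<integral>\<^sup>+z. ?J x * (near r x z * H z) \<partial>\<sigma>) \<partial>\<sigma>)"
    unfolding avg_def
  proof (intro nn_integral_cong nn_integral_cmult[symmetric])
    fix x assume "x \<in> space \<sigma>"
    then have [measurable]: "(\<lambda>z. near r x z) \<in> borel_measurable \<sigma>" by (simp add: near_measurable1 space_\<sigma>)
    show "(\<lambda>z. near r x z * H z) \<in> borel_measurable \<sigma>" by measurable
  qed
  also have "\<dots> = (\<integral>\<^sup>+z. (\<integral>\<^sup>+x. ?J x * (near r x z * H z) \<partial>\<sigma>) \<partial>\<sigma>)"
    by (rule Fubini'[symmetric]) (simp add: case_prod_beta)
  also have "\<dots> = (\<integral>\<^sup>+z. H z * (\<integral>\<^sup>+x. ennreal ((nK x)\<^sup>2) * (indicator (Db z r) x * ennreal (1 / vol (2 * \<rho>) x)) \<partial>\<sigma>) \<partial>\<sigma>)"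
  proof (rule nn_integral_cong)
    fix z assume "z \<in> space \<sigma>"
    then have z: "z \<in> \<Omega>" by (simp add: space_\<sigma>)
    note [measurable] = near_measurable2[OF z] ball_sets[OF z]
    have "(\<integral>\<^sup>+x. ?J x * (near r x z * H z) \<partial>\<sigma>)
        = (\<integral>\<^sup>+x. H z * (ennreal ((nK x)\<^sup>2) * (indicator (Db z r) x * ennreal (1 / vol (2 * \<rho>) x))) \<partial>\<sigma>)"
    proof (rule nn_integral_cong)
      fix x assume "x \<in> space \<sigma>"
      then have x: "x \<in> \<Omega>" by (simp add: space_\<sigma>)
      have "?J x = ennreal ((nK x)\<^sup>2) * ennreal (1 / vol (2 * \<rho>) x)"
        using vol_pos[OF x, of "2 * \<rho>"] \<rho> by (simp add: ennreal_mult[symmetric])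
      then show "?J x * (near r x z * H z)
          = H z * (ennreal ((nK x)\<^sup>2) * (indicator (Db z r) x * ennreal (1 / vol (2 * \<rho>) x)))"
        by (simp add: near_commute[of r x z] near_eq[OF z x] mult_ac)
    qed
    also have "\<dots> = H z * (\<integral>\<^sup>+x. ennreal ((nK x)\<^sup>2) * (indicator (Db z r) x * ennreal (1 / vol (2 * \<rho>) x)) \<partial>\<sigma>)"
      by (rule nn_integral_cmult) measurable
    finally show "(\<integral>\<^sup>+x. ?J x * (near r x z * H z) \<partial>\<sigma>)
      = H z * (\<integral>\<^sup>+x. ennreal ((nK x)\<^sup>2) * (indicator (Db z r) x * ennreal (1 / vol (2 * \<rho>) x)) \<partial>\<sigma>)" .
  qed
  finally show ?thesis .
qed

lemma ball_integral_const:
  assumes z: "z \<in> \<Omega>" and r: "r > 0"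
  shows "(\<integral>\<^sup>+x. ennreal ((nK x)\<^sup>2) * (indicator (Db z r) x * ennreal (c / vol r z)) \<partial>\<sigma>) = ennreal c"
proof (cases "c \<ge> 0")
  case True
  note [measurable] = ball_sets[OF z]
  have "(\<integral>\<^sup>+x. ennreal ((nK x)\<^sup>2) * (indicator (Db z r) x * ennreal (c / vol r z)) \<partial>\<sigma>)
      = (\<integral>\<^sup>+x. ennreal (c / vol r z) * (ennreal ((nK x)\<^sup>2) * indicator (Db z r) x) \<partial>\<sigma>)"
    by (simp add: mult_ac)
  also have "\<dots> = ennreal (c / vol r z) * ennreal (vol r z)"
    by (subst nn_integral_cmult) (simp_all add: emeasure_Lm[OF ball_sets[OF z], symmetric] vol_eq[OF z])
  also have "\<dots> = ennreal c"
    using vol_pos[OF z r] True by (subst ennreal_mult[symmetric]) auto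
  finally show ?thesis .
next
  case False
  then have "c / vol r z \<le> 0" using vol_pos[OF z r] by (simp add: divide_nonpos_pos)
  then show ?thesis using False by (simp add: ennreal_neg)
qed

lemma avg_le:
  assumes H: "H \<in> borel_measurable \<sigma>" and \<rho>: "\<rho> > 0"
  shows "avg \<rho> (2 * \<rho>) H \<le> ennreal C * (\<integral>\<^sup>+z. H z \<partial>\<sigma>)"
proof -
  have "avg \<rho> (2 * \<rho>) H \<le> (\<integral>\<^sup>+z. ennreal C * H z \<partial>\<sigma>)"
    unfolding avg_swap[OF assms]
  proof (rule nn_integral_mono)
    fix z assume "z \<in> space \<sigma>"
    then have z: "z \<in> \<Omega>" by (simp add: space_\<sigma>)
    have "(\<integral>\<^sup>+x. ennreal ((nK x)\<^sup>2) * (indicator (Db z (2 * \<rho>)) x * ennreal (1 / vol (2 * \<rho>) x)) \<partial>\<sigma>)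
        \<le> (\<integral>\<^sup>+x. ennreal ((nK x)\<^sup>2) * (indicator (Db z (2 * \<rho>)) x * ennreal (C / vol (2 * \<rho>) z)) \<partial>\<sigma>)"
    proof (rule nn_integral_mono, rule mult_left_mono)
      fix x assume "x \<in> space \<sigma>"
      then have x: "x \<in> \<Omega>" by (simp add: space_\<sigma>)
      show "indicator (Db z (2 * \<rho>)) x * ennreal (1 / vol (2 * \<rho>) x)
          \<le> indicator (Db z (2 * \<rho>)) x * ennreal (C / vol (2 * \<rho>) z)"
      proof (cases "x \<in> Db z (2 * \<rho>)")
        case True
        \<comment> \<open>For \<open>x\<close> and \<open>z\<close> at distance below
          \<open>2 * \<rho>\<close>, one doubling compares the volumes of the balls about
          them.\<close>
        have "Db z (2 * \<rho>) \<subseteq> Db x (2 * (2 * \<rho>))"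
          using True x z by (intro hm.mball_subset) (auto simp: hm.commute)
        then have "vol (2 * \<rho>) z \<le> vol (2 * (2 * \<rho>)) x" by (rule vol_mono[OF z x])
        also have "\<dots> \<le> C * vol (2 * \<rho>) x" using \<rho> by (intro vol_doubling x) simp
        finally have "1 / vol (2 * \<rho>) x \<le> C / vol (2 * \<rho>) z"
          using vol_pos[OF x, of "2 * \<rho>"] vol_pos[OF z, of "2 * \<rho>"] \<rho> by (simp add: field_simps)
        then show ?thesis by (intro mult_left_mono ennreal_leI) auto
      qed simp
    qed simp
    also have "\<dots> = ennreal C" using \<rho> by (intro ball_integral_const z) simp
    finally show "H z * (\<integral>\<^sup>+x. ennreal ((nK x)\<^sup>2) * (indicator (Db z (2 * \<rho>)) x * ennreal (1 / vol (2 * \<rho>) x)) \<partial>\<sigma>)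
        \<le> ennreal C * H z"
      by (subst mult.commute) (intro mult_right_mono, auto)
  qed
  also have "\<dots> = ennreal C * (\<integral>\<^sup>+z. H z \<partial>\<sigma>)" by (rule nn_integral_cmult[OF H])
  finally show ?thesis .
qed

text \<open>The averages for the inner radius \<open>\<rho>\<close> and the outer radius
  \<open>2 * \<rho>\<close> share the normalization by the volume at radius
  \<open>2 * \<rho>\<close>. Here the volume at radius \<open>4 * \<rho>\<close> is compared with
  that at \<open>\<rho>\<close>: two doublings, whence \<open>C\<^sup>2\<close>.\<close>

lemma avg_ge:
  assumes H: "H \<in> borel_measurable \<sigma>" and \<rho>: "\<rho> > 0"
  shows "(\<integral>\<^sup>+z. H z \<partial>\<sigma>) \<le> ennreal (C\<^sup>2) * avg \<rho> \<rho> H"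
proof -
  have "ennreal (1 / C\<^sup>2) * (\<integral>\<^sup>+z. H z \<partial>\<sigma>) = (\<integral>\<^sup>+z. ennreal (1 / C\<^sup>2) * H z \<partial>\<sigma>)"
    by (rule nn_integral_cmult[OF H, symmetric])
  also have "\<dots> \<le> avg \<rho> \<rho> H"
    unfolding avg_swap[OF assms]
  proof (rule nn_integral_mono)
    fix z assume "z \<in> space \<sigma>"
    then have z: "z \<in> \<Omega>" by (simp add: space_\<sigma>)
    have "ennreal (1 / C\<^sup>2) = (\<integral>\<^sup>+x. ennreal ((nK x)\<^sup>2) * (indicator (Db z \<rho>) x * ennreal ((1 / C\<^sup>2) / vol \<rho> z)) \<partial>\<sigma>)"
      by (rule ball_integral_const[OF z \<rho>, symmetric])
    also have "\<dots> \<le> (\<integral>\<^sup>+x. ennreal ((nK x)\<^sup>2) * (indicator (Db z \<rho>) x * ennreal (1 / vol (2 * \<rho>) x)) \<partial>\<sigma>)"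
    proof (rule nn_integral_mono, rule mult_left_mono)
      fix x assume "x \<in> space \<sigma>"
      then have x: "x \<in> \<Omega>" by (simp add: space_\<sigma>)
      show "indicator (Db z \<rho>) x * ennreal ((1 / C\<^sup>2) / vol \<rho> z)
          \<le> indicator (Db z \<rho>) x * ennreal (1 / vol (2 * \<rho>) x)"
      proof (cases "x \<in> Db z \<rho>")
        case True
        have "Db x (2 * \<rho>) \<subseteq> Db z (2 * (2 * \<rho>))"
          using True x z \<rho> by (intro hm.mball_subset) (auto simp: hm.commute)
        then have "vol (2 * \<rho>) x \<le> vol (2 * (2 * \<rho>)) z" by (rule vol_mono[OF x z])
        also have "\<dots> \<le> C * vol (2 * \<rho>) z" using \<rho> by (intro vol_doubling z) simp
        also have "\<dots> \<le> C * (C * vol \<rho> z)" using C_ge \<rho> by (intro mult_left_mono vol_doubling z) auto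
        finally have "(1 / C\<^sup>2) / vol \<rho> z \<le> 1 / vol (2 * \<rho>) x"
          using vol_pos[OF x, of "2 * \<rho>"] vol_pos[OF z, of \<rho>] \<rho> C_ge
          by (simp add: field_simps power2_eq_square)
        then show ?thesis by (intro mult_left_mono ennreal_leI) auto
      qed simp
    qed simp
    finally show "ennreal (1 / C\<^sup>2) * H z
        \<le> H z * (\<integral>\<^sup>+x. ennreal ((nK x)\<^sup>2) * (indicator (Db z \<rho>) x * ennreal (1 / vol (2 * \<rho>) x)) \<partial>\<sigma>)"
      by (subst mult.commute) (intro mult_left_mono, auto)
  qed
  finally have "ennreal (C\<^sup>2) * (ennreal (1 / C\<^sup>2) * (\<integral>\<^sup>+z. H z \<partial>\<sigma>)) \<le> ennreal (C\<^sup>2) * avg \<rho> \<rho> H"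
    by (rule mult_left_mono) simp
  moreover have "ennreal (C\<^sup>2) * ennreal (1 / C\<^sup>2) = 1"
    using C_ge by (simp add: ennreal_mult[symmetric])
  ultimately show ?thesis by (simp add: mult.assoc[symmetric])
qed

lemma avg_mono_radius: "r \<le> r' \<Longrightarrow> avg \<rho> r H \<le> avg \<rho> r' H"
  unfolding avg_def by (intro nn_integral_mono mult_left_mono mult_right_mono) (auto simp: near_def)

text \<open>For \<open>z\<close> in \<open>D(x, \<rho>)\<close>, restricting \<open>g\<close> to
  \<open>D(x, 2\<rho>)\<close> changes \<open>T (P g) z\<close> only through kernel entries with
  \<open>d z w > \<rho>\<close>, whose total effect is small. Squaring and averaging over
  \<open>x\<close> gives the estimate. Since \<open>\<rho>\<close> precedes \<open>g\<close> and
  \<open>\<eta>\<close>, the local bound may be established for this radius afterwards.\<close>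

lemma localization:
  assumes T: "admissible p T" and \<epsilon>: "\<epsilon> > 0"
  obtains \<rho> where "\<rho> > 0" "\<forall>g\<in>sqint \<sigma>. \<forall>\<eta>\<ge>0.
     (\<forall>x\<in>\<Omega>. bnorm \<sigma> (T (P (\<lambda>w. indicator (Db x (2 * \<rho>)) w * g w)))
          \<le> \<eta> * bnorm \<sigma> (\<lambda>w. indicator (Db x (2 * \<rho>)) w * g w)) \<longrightarrow>
     bnorm \<sigma> (T (P g)) \<le> 2 * C\<^sup>2 * (\<epsilon> + \<eta>) * bnorm \<sigma> g"
proof -
  have bT: "bop T" using T by simp
  obtain \<rho> where \<rho>: "\<rho> > 0" and off: "\<forall>g\<in>sqint \<sigma>. (\<integral>\<^sup>+z. (\<integral>\<^sup>+w. ennreal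
      ((if d z w > \<rho> then cmod (T (K w) z) else 0) * cmod (g w)) \<partial>\<sigma>)\<^sup>2 \<partial>\<sigma>) \<le> ennreal ((\<epsilon> * bnorm \<sigma> g)\<^sup>2)"
    using off_diagonal_small[OF T \<epsilon>] .
  have main: "bnorm \<sigma> (T (P g)) \<le> 2 * C\<^sup>2 * (\<epsilon> + \<eta>) * bnorm \<sigma> g"
    if g: "g \<in> sqint \<sigma>" and \<eta>: "\<eta> \<ge> 0" and
      loc: "\<forall>x\<in>\<Omega>. bnorm \<sigma> (T (P (\<lambda>w. indicator (Db x (2 * \<rho>)) w * g w)))
          \<le> \<eta> * bnorm \<sigma> (\<lambda>w. indicator (Db x (2 * \<rho>)) w * g w)" for g \<eta>
  proof -
    interpret sigma_finite_measure \<sigma> by (rule sigma_finite_\<sigma>)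
    have [measurable]: "g \<in> borel_measurable \<sigma>" using g by (auto dest!: sqint_measurable)
    note [measurable] = d_measurable(1)[unfolded case_prod_beta]
    have k [measurable]: "(\<lambda>p. T (K (snd p)) (fst p)) \<in> borel_measurable (\<sigma> \<Otimes>\<^sub>M \<sigma>)"
      using measurable_pair_continuous[OF kernel_continuous[OF bT]] by (simp add: case_prod_beta')
    let ?E0 = "\<lambda>z. \<integral>\<^sup>+w. ennreal ((if d z w > \<rho> then cmod (T (K w) z) else 0) * cmod (g w)) \<partial>\<sigma>"
    have E0 [measurable]: "?E0 \<in> borel_measurable \<sigma>"
      by (rule borel_measurable_nn_integral) (simp add: case_prod_beta)
    let ?F = "T (P g)"
    have FB: "?F \<in> B" by (intro bop_in[OF bT] P_in g)
    note [measurable] = B_measurable[OF FB]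
    let ?H = "\<lambda>z. ennreal ((cmod (?F z))\<^sup>2)"
    let ?G = "\<lambda>z. ennreal ((cmod (g z))\<^sup>2)"
    have local: "(\<integral>\<^sup>+z. near \<rho> x z * ?H z \<partial>\<sigma>) \<le> 2 * (\<integral>\<^sup>+z. near \<rho> x z * (?E0 z)\<^sup>2 \<partial>\<sigma>)
        + ennreal (2 * \<eta>\<^sup>2) * (\<integral>\<^sup>+z. near (2 * \<rho>) x z * ?G z \<partial>\<sigma>)" if x: "x \<in> \<Omega>" for x
    proof -
      let ?gx = "\<lambda>w. indicator (Db x (2 * \<rho>)) w * g w"
      have gx: "?gx \<in> sqint \<sigma>" by (rule sqint_indicator(1)[OF g ball_sets[OF x]])
      have FxB: "T (P ?gx) \<in> B" by (intro bop_in[OF bT] P_in gx)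
      note [measurable] = B_measurable[OF FxB] near_measurable1[OF x]
      have pt: "ennreal (cmod (?F z)) \<le> ennreal (cmod (T (P ?gx) z)) + ?E0 z" if z: "z \<in> \<Omega>" "d x z < \<rho>" for z
      proof -
        have int: "integrable \<sigma> (\<lambda>w. g w * T (K w) z)" "integrable \<sigma> (\<lambda>w. ?gx w * T (K w) z)"
          using op_P_eq_integral(1)[OF bT g z(1)] op_P_eq_integral(1)[OF bT gx z(1)] by auto
        have "?F z - T (P ?gx) z = (\<integral>w. g w * T (K w) z - ?gx w * T (K w) z \<partial>\<sigma>)"
          unfolding op_P_eq_integral(2)[OF bT g z(1)] op_P_eq_integral(2)[OF bT gx z(1)]
          by (rule Bochner_Integration.integral_diff[symmetric]) (use int in auto)
        then have "ennreal (cmod (?F z - T (P ?gx) z))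
            \<le> (\<integral>\<^sup>+w. ennreal (cmod (g w * T (K w) z - ?gx w * T (K w) z)) \<partial>\<sigma>)"
          using integral_norm_bound_ennreal[OF Bochner_Integration.integrable_diff[OF int]] by simp
        also have "\<dots> \<le> ?E0 z"
        proof (rule nn_integral_mono, rule ennreal_leI)
          fix w assume "w \<in> space \<sigma>"
          then have w: "w \<in> \<Omega>" by (simp add: space_\<sigma>)
          show "cmod (g w * T (K w) z - ?gx w * T (K w) z) \<le> (if d z w > \<rho> then cmod (T (K w) z) else 0) * cmod (g w)"
          proof (cases "w \<in> Db x (2 * \<rho>)")
            case False
            then have "d x w \<ge> 2 * \<rho>" using x w by auto
            then have "d z w > \<rho>" using hm.triangle[OF x z(1) w] z(2) by simp
            then show ?thesis using False by (simp add: norm_mult)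
          qed simp
        qed
        finally have le: "ennreal (cmod (?F z - T (P ?gx) z)) \<le> ?E0 z" .
        have "cmod (?F z) \<le> cmod (T (P ?gx) z) + cmod (?F z - T (P ?gx) z)"
          using norm_triangle_ineq[of "T (P ?gx) z" "?F z - T (P ?gx) z"] by simp
        then have "ennreal (cmod (?F z)) \<le> ennreal (cmod (T (P ?gx) z)) + ennreal (cmod (?F z - T (P ?gx) z))"
          by (simp add: ennreal_leI flip: ennreal_plus)
        also have "\<dots> \<le> ennreal (cmod (T (P ?gx) z)) + ?E0 z" by (rule add_left_mono[OF le])
        finally show ?thesis .
      qed
      have "(\<integral>\<^sup>+z. near \<rho> x z * ?H z \<partial>\<sigma>)
          \<le> (\<integral>\<^sup>+z. 2 * ennreal ((cmod (T (P ?gx) z))\<^sup>2) + 2 * (near \<rho> x z * (?E0 z)\<^sup>2) \<partial>\<sigma>)"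
      proof (rule nn_integral_mono)
        fix z assume "z \<in> space \<sigma>"
        then have z: "z \<in> \<Omega>" by (simp add: space_\<sigma>)
        show "near \<rho> x z * ?H z \<le> 2 * ennreal ((cmod (T (P ?gx) z))\<^sup>2) + 2 * (near \<rho> x z * (?E0 z)\<^sup>2)"
        proof (cases "d x z < \<rho>")
          case True
          have "?H z = (ennreal (cmod (?F z)))\<^sup>2" by (simp add: ennreal_power)
          also have "\<dots> \<le> (ennreal (cmod (T (P ?gx) z)) + ?E0 z)\<^sup>2"
            by (rule power_mono[OF pt[OF z True]]) simp
          also have "\<dots> \<le> 2 * (ennreal (cmod (T (P ?gx) z)))\<^sup>2 + 2 * (?E0 z)\<^sup>2"
            by (rule ennreal_power2_add_le)
          finally show ?thesis using True by (simp add: near_def ennreal_power)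
        qed (simp add: near_def)
      qed
      also have "\<dots> = 2 * (\<integral>\<^sup>+z. ennreal ((cmod (T (P ?gx) z))\<^sup>2) \<partial>\<sigma>) + 2 * (\<integral>\<^sup>+z. near \<rho> x z * (?E0 z)\<^sup>2 \<partial>\<sigma>)"
        by (subst nn_integral_add) (measurable, simp add: nn_integral_cmult)
      also have "(\<integral>\<^sup>+z. ennreal ((cmod (T (P ?gx) z))\<^sup>2) \<partial>\<sigma>) = ennreal ((bnorm \<sigma> (T (P ?gx)))\<^sup>2)"
        by (rule nn_bnorm[OF B_sqint[OF FxB]])
      also have "\<dots> \<le> ennreal ((\<eta> * bnorm \<sigma> ?gx)\<^sup>2)"
        using loc x by (intro ennreal_leI power_mono) auto
      also have "\<dots> = ennreal (\<eta>\<^sup>2) * (\<integral>\<^sup>+z. ennreal ((cmod (?gx z))\<^sup>2) \<partial>\<sigma>)"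
        by (simp add: nn_bnorm[OF gx] power_mult_distrib ennreal_mult)
      also have "(\<integral>\<^sup>+z. ennreal ((cmod (?gx z))\<^sup>2) \<partial>\<sigma>) = (\<integral>\<^sup>+z. near (2 * \<rho>) x z * ?G z \<partial>\<sigma>)"
        by (intro nn_integral_cong) (auto simp: near_def indicator_def x space_\<sigma>)
      finally show ?thesis
        using \<eta> by (simp add: ennreal_mult mult.assoc add.commute mult_left_mono)
    qed
    note [measurable] = vol_measurable
    have near_int: "(\<lambda>x. \<integral>\<^sup>+z. near r x z * h z \<partial>\<sigma>) \<in> borel_measurable \<sigma>"
      if [measurable]: "h \<in> borel_measurable \<sigma>" for r h
      by (rule borel_measurable_nn_integral) (simp add: case_prod_beta)
    have "avg \<rho> \<rho> ?H \<le> (\<integral>\<^sup>+x. 2 * (ennreal ((nK x)\<^sup>2 / vol (2 * \<rho>) x) * (\<integral>\<^sup>+z. near \<rho> x z * (?E0 z)\<^sup>2 \<partial>\<sigma>))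
        + ennreal (2 * \<eta>\<^sup>2) * (ennreal ((nK x)\<^sup>2 / vol (2 * \<rho>) x) * (\<integral>\<^sup>+z. near (2 * \<rho>) x z * ?G z \<partial>\<sigma>)) \<partial>\<sigma>)"
      unfolding avg_def
    proof (rule nn_integral_mono)
      fix x assume "x \<in> space \<sigma>"
      then have x: "x \<in> \<Omega>" by (simp add: space_\<sigma>)
      show "ennreal ((nK x)\<^sup>2 / vol (2 * \<rho>) x) * (\<integral>\<^sup>+z. near \<rho> x z * ?H z \<partial>\<sigma>)
        \<le> 2 * (ennreal ((nK x)\<^sup>2 / vol (2 * \<rho>) x) * (\<integral>\<^sup>+z. near \<rho> x z * (?E0 z)\<^sup>2 \<partial>\<sigma>))
        + ennreal (2 * \<eta>\<^sup>2) * (ennreal ((nK x)\<^sup>2 / vol (2 * \<rho>) x) * (\<integral>\<^sup>+z. near (2 * \<rho>) x z * ?G z \<partial>\<sigma>))"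
        using mult_left_mono[OF local[OF x], of "ennreal ((nK x)\<^sup>2 / vol (2 * \<rho>) x)"]
        by (simp add: distrib_left mult_ac)
    qed
    also have "\<dots> = 2 * avg \<rho> \<rho> (\<lambda>z. (?E0 z)\<^sup>2) + ennreal (2 * \<eta>\<^sup>2) * avg \<rho> (2 * \<rho>) ?G"
    proof -
      have m1 [measurable]: "(\<lambda>x. \<integral>\<^sup>+z. near \<rho> x z * (?E0 z)\<^sup>2 \<partial>\<sigma>) \<in> borel_measurable \<sigma>"
        by (rule near_int) measurable
      have m2 [measurable]: "(\<lambda>x. \<integral>\<^sup>+z. near (2 * \<rho>) x z * ?G z \<partial>\<sigma>) \<in> borel_measurable \<sigma>"
        by (rule near_int) measurable
      show ?thesis unfolding avg_def
        by (subst nn_integral_add) (measurable, simp add: nn_integral_cmult)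
    qed
    also have "\<dots> \<le> 2 * (ennreal C * (\<integral>\<^sup>+z. (?E0 z)\<^sup>2 \<partial>\<sigma>)) + ennreal (2 * \<eta>\<^sup>2) * (ennreal C * (\<integral>\<^sup>+z. ?G z \<partial>\<sigma>))"
    proof (intro add_mono mult_left_mono)
      have "avg \<rho> \<rho> (\<lambda>z. (?E0 z)\<^sup>2) \<le> avg \<rho> (2 * \<rho>) (\<lambda>z. (?E0 z)\<^sup>2)"
        using \<rho> by (intro avg_mono_radius) simp
      also have "\<dots> \<le> ennreal C * (\<integral>\<^sup>+z. (?E0 z)\<^sup>2 \<partial>\<sigma>)" by (rule avg_le[OF _ \<rho>]) measurable
      finally show "avg \<rho> \<rho> (\<lambda>z. (?E0 z)\<^sup>2) \<le> ennreal C * (\<integral>\<^sup>+z. (?E0 z)\<^sup>2 \<partial>\<sigma>)" .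
      show "avg \<rho> (2 * \<rho>) ?G \<le> ennreal C * (\<integral>\<^sup>+z. ?G z \<partial>\<sigma>)" by (rule avg_le[OF _ \<rho>]) measurable
    qed auto
    also have "\<dots> \<le> 2 * (ennreal C * ennreal ((\<epsilon> * bnorm \<sigma> g)\<^sup>2)) + ennreal (2 * \<eta>\<^sup>2) * (ennreal C * ennreal ((bnorm \<sigma> g)\<^sup>2))"
      using off g by (intro add_mono mult_left_mono) (auto simp: nn_bnorm[OF g])
    also have "\<dots> = ennreal (2 * C * (\<epsilon>\<^sup>2 + \<eta>\<^sup>2) * (bnorm \<sigma> g)\<^sup>2)"
    proof -
      have "2 * (ennreal C * ennreal ((\<epsilon> * bnorm \<sigma> g)\<^sup>2)) = ennreal (2 * (C * (\<epsilon> * bnorm \<sigma> g)\<^sup>2))"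
        using C_ge by (simp add: ennreal_mult)
      moreover have "ennreal (2 * \<eta>\<^sup>2) * (ennreal C * ennreal ((bnorm \<sigma> g)\<^sup>2)) = ennreal (2 * \<eta>\<^sup>2 * (C * (bnorm \<sigma> g)\<^sup>2))"
        using C_ge by (simp add: ennreal_mult)
      moreover have "2 * (C * (\<epsilon> * bnorm \<sigma> g)\<^sup>2) + 2 * \<eta>\<^sup>2 * (C * (bnorm \<sigma> g)\<^sup>2) = 2 * C * (\<epsilon>\<^sup>2 + \<eta>\<^sup>2) * (bnorm \<sigma> g)\<^sup>2"
        by (simp add: power_mult_distrib algebra_simps)
      ultimately show ?thesis using C_ge by (simp flip: ennreal_plus)
    qed
    finally have A: "avg \<rho> \<rho> ?H \<le> ennreal (2 * C * (\<epsilon>\<^sup>2 + \<eta>\<^sup>2) * (bnorm \<sigma> g)\<^sup>2)" .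
    have "ennreal ((bnorm \<sigma> ?F)\<^sup>2) = (\<integral>\<^sup>+z. ?H z \<partial>\<sigma>)" by (rule nn_bnorm[OF B_sqint[OF FB], symmetric])
    also have "\<dots> \<le> ennreal (C\<^sup>2) * avg \<rho> \<rho> ?H" by (rule avg_ge[OF _ \<rho>]) measurable
    also have "\<dots> \<le> ennreal (C\<^sup>2) * ennreal (2 * C * (\<epsilon>\<^sup>2 + \<eta>\<^sup>2) * (bnorm \<sigma> g)\<^sup>2)"
      by (rule mult_left_mono[OF A]) simp
    also have "\<dots> = ennreal (C\<^sup>2 * (2 * C * (\<epsilon>\<^sup>2 + \<eta>\<^sup>2) * (bnorm \<sigma> g)\<^sup>2))"
      using C_ge by (simp add: ennreal_mult)
    also have "\<dots> \<le> ennreal ((2 * C\<^sup>2 * (\<epsilon> + \<eta>) * bnorm \<sigma> g)\<^sup>2)"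
    proof (rule ennreal_leI)
      have "C\<^sup>2 * (2 * C) \<le> (2 * C\<^sup>2)\<^sup>2"
        using C_ge power_increasing[of 3 4 C] by (simp add: power_mult_distrib power2_eq_square power3_eq_cube power4_eq_xxxx)
      moreover have "\<epsilon>\<^sup>2 + \<eta>\<^sup>2 \<le> (\<epsilon> + \<eta>)\<^sup>2" using \<epsilon> \<eta> by (simp add: power2_sum)
      ultimately have "C\<^sup>2 * (2 * C) * (\<epsilon>\<^sup>2 + \<eta>\<^sup>2) * (bnorm \<sigma> g)\<^sup>2 \<le> (2 * C\<^sup>2)\<^sup>2 * (\<epsilon> + \<eta>)\<^sup>2 * (bnorm \<sigma> g)\<^sup>2"
        by (intro mult_right_mono mult_mono) auto
      then show "C\<^sup>2 * (2 * C * (\<epsilon>\<^sup>2 + \<eta>\<^sup>2) * (bnorm \<sigma> g)\<^sup>2) \<le> (2 * C\<^sup>2 * (\<epsilon> + \<eta>) * bnorm \<sigma> g)\<^sup>2"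
        by (simp add: power_mult_distrib mult.assoc)
    qed
    finally have "(bnorm \<sigma> ?F)\<^sup>2 \<le> (2 * C\<^sup>2 * (\<epsilon> + \<eta>) * bnorm \<sigma> g)\<^sup>2" by (simp add: ennreal_le_iff)
    then show ?thesis by (rule power2_le_imp_le) (use \<epsilon> \<eta> in simp)
  qed
  show ?thesis
    by (rule that[OF \<rho>], intro ballI allI impI) (rule main)
qed


section \<open>Relative compactness\<close>

abbreviation "cop \<equiv> compact_op \<Omega> \<sigma>"

text \<open>Elements of \<open>fam Q M\<close> are dominated, as functionals, by \<open>M\<close> times the sup norm on \<open>Q\<close>. Since
  \<open>\<parallel>h - h'\<parallel>\<^sup>2 = \<langle>h - h', h\<rangle> - \<langle>h - h', h'\<rangle>\<close>, uniform convergence on \<open>Q\<close> then forces norm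
  convergence, so Arzela-Ascoli on \<open>Q\<close> makes the family relatively compact.\<close>

definition fam :: "'n pt set \<Rightarrow> real \<Rightarrow> 'n fn set" where
  "fam Q M = {h \<in> B. \<forall>f\<in>B. \<forall>e. (\<forall>u\<in>Q. cmod (f u) \<le> e) \<longrightarrow> cmod (ip \<sigma> f h) \<le> M * e}"

lemma fam_bound: "h \<in> fam Q M \<Longrightarrow> f \<in> B \<Longrightarrow> (\<And>u. u \<in> Q \<Longrightarrow> cmod (f u) \<le> e) \<Longrightarrow> cmod (ip \<sigma> f h) \<le> M * e"
  by (simp add: fam_def)

lemma fam_in: "h \<in> fam Q M \<Longrightarrow> h \<in> B"
  by (simp add: fam_def)

text \<open>A member is tested against itself: its supremum on \<open>Q\<close> is at most its norm
  times a bound for \<open>nK\<close>, so the square of the norm is at most a multiple of the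
  norm.\<close>

lemma fam_bounded:
  assumes Q: "compact Q" "Q \<subseteq> \<Omega>"
  obtains N where "N \<ge> 0" "\<forall>h\<in>fam Q M. bnorm \<sigma> h \<le> N"
proof -
  have "compact ((\<lambda>z. nK z) ` Q)"
    by (rule compact_continuous_image[OF continuous_on_subset[OF n_continuous Q(2)] Q(1)])
  then obtain b where b: "\<forall>z\<in>Q. nK z \<le> b"
    using compact_imp_bounded bounded_imp_bdd_above unfolding bdd_above_def by (metis imageI)
  show ?thesis
  proof (rule that[of "max 0 (M * max 0 b)"])
    show "\<forall>h\<in>fam Q M. bnorm \<sigma> h \<le> max 0 (M * max 0 b)"
    proof
      fix h assume h: "h \<in> fam Q M"
      note hB = fam_in[OF h]
      have "cmod (ip \<sigma> h h) \<le> M * (bnorm \<sigma> h * max 0 b)"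
      proof (rule fam_bound[OF h hB])
        fix u assume u: "u \<in> Q"
        then have "cmod (h u) \<le> bnorm \<sigma> h * nK u" using eval_le[OF hB, of u] Q by blast
        also have "\<dots> \<le> bnorm \<sigma> h * max 0 b" using b u by (intro mult_left_mono) (auto simp: le_max_iff_disj)
        finally show "cmod (h u) \<le> bnorm \<sigma> h * max 0 b" .
      qed
      then have *: "bnorm \<sigma> h * bnorm \<sigma> h \<le> (M * max 0 b) * bnorm \<sigma> h"
        unfolding ip_self by (simp add: norm_power power2_eq_square norm_mult mult_ac del: of_real_power)
      show "bnorm \<sigma> h \<le> max 0 (M * max 0 b)"
      proof (cases "bnorm \<sigma> h = 0")
        case False
        then have "bnorm \<sigma> h > 0" using bnorm_nonneg[of \<sigma> h] by linarith
        then have "bnorm \<sigma> h \<le> M * max 0 b" using * by (simp only: mult_le_cancel_right_pos)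
        then show ?thesis by simp
      qed simp
    qed
  qed simp
qed

lemma fam_seq_compact:
  assumes Q: "compact Q" "Q \<subseteq> \<Omega>" and M: "M \<ge> 0" and H: "\<And>m::nat. H m \<in> fam Q M"
  obtains r g where "strict_mono (r :: nat \<Rightarrow> nat)" "g \<in> B" "(\<lambda>m. bnorm \<sigma> (\<lambda>w. H (r m) w - g w)) \<longlonglongrightarrow> 0"
proof -
  obtain N where N: "N \<ge> 0" "\<forall>h\<in>fam Q M. bnorm \<sigma> h \<le> N" using fam_bounded[OF Q] .
  have HB: "H m \<in> B" for m using fam_in[OF H] .
  have HN: "bnorm \<sigma> (H m) \<le> N" for m using N(2) H by blast
  have "compact ((\<lambda>z. nK z) ` Q)"
    by (rule compact_continuous_image[OF continuous_on_subset[OF n_continuous Q(2)] Q(1)])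
  then obtain b where b: "\<forall>z\<in>Q. nK z \<le> b"
    using compact_imp_bounded bounded_imp_bdd_above unfolding bdd_above_def by (metis imageI)
  \<comment> \<open>Equicontinuity comes from the norm continuity of the kernels and the uniform
    norm bound. \<open>g0\<close> is a limit on \<open>Q\<close> only and serves to make the
    subsequence Cauchy; the limit in the space comes from completeness.\<close>
  obtain g0 r where r: "strict_mono (r :: nat \<Rightarrow> nat)"
      and conv: "\<And>e. 0 < e \<Longrightarrow> \<exists>N. \<forall>n x. n \<ge> N \<and> x \<in> Q \<longrightarrow> cmod (H (r n) x - g0 x) < e"
  proof (rule Arzela_Ascoli[OF Q(1), of H "N * b"])
    show "cmod (H m x) \<le> N * b" if x: "x \<in> Q" for m x
    proof -
      have x\<Omega>: "x \<in> \<Omega>" using x Q(2) by blast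
      have "cmod (H m x) \<le> bnorm \<sigma> (H m) * nK x" by (rule eval_le[OF HB x\<Omega>])
      also have "\<dots> \<le> N * b" using HN b x N by (intro mult_mono) auto
      finally show ?thesis .
    qed
    show "\<exists>dd>0. \<forall>m y. y \<in> Q \<and> norm (x - y) < dd \<longrightarrow> cmod (H m x - H m y) < e"
      if x: "x \<in> Q" and e: "0 < e" for x e
    proof -
      have x\<Omega>: "x \<in> \<Omega>" using x Q(2) by blast
      have pos: "e / (N + 1) > 0" using e N(1) by simp
      have "eventually (\<lambda>v. bnorm \<sigma> (\<lambda>u. K v u - K x u) < e / (N + 1)) (at x within \<Omega>)"
        by (rule order_tendstoD(2)[OF K_tendsto[OF x\<Omega>] pos])
      then obtain dd where dd: "dd > 0" "\<And>v. v \<in> \<Omega> \<Longrightarrow> v \<noteq> x \<Longrightarrow> dist v x < dd \<Longrightarrow> bnorm \<sigma> (\<lambda>u. K v u - K x u) < e / (N + 1)"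
        unfolding eventually_at by blast
      have "cmod (H m x - H m y) < e" if y: "y \<in> Q" "norm (x - y) < dd" for m y
      proof -
        have y\<Omega>: "y \<in> \<Omega>" using y(1) Q(2) by blast
        have "bnorm \<sigma> (\<lambda>u. K y u - K x u) < e / (N + 1)"
          using dd(2)[OF y\<Omega>] y(2) pos by (cases "y = x") (auto simp: dist_norm norm_minus_commute)
        then have k: "bnorm \<sigma> (\<lambda>u. K x u - K y u) < e / (N + 1)" by (simp add: bnorm_minus_commute[of _ "K x"])
        have "H m x - H m y = ip \<sigma> (H m) (\<lambda>u. K x u - K y u)"
          using x\<Omega> y\<Omega> HB by (simp add: ip_diff_right B_sqint K_in reproducing[of x "H m"] reproducing[of y "H m"])
        then have "cmod (H m x - H m y) \<le> bnorm \<sigma> (H m) * bnorm \<sigma> (\<lambda>u. K x u - K y u)"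
          using norm_ip_le[OF B_sqint[OF HB] B_sqint[OF B_diff[OF K_in[OF x\<Omega>] K_in[OF y\<Omega>]]]] by simp
        also have "\<dots> \<le> N * (e / (N + 1))" using HN k N by (intro mult_mono) auto
        also have "\<dots> < e" using e N by (simp add: field_simps)
        finally show ?thesis .
      qed
      then show ?thesis using dd(1) by blast
    qed
  qed blast
  obtain g where g: "g \<in> B" "(\<lambda>m. bnorm \<sigma> (\<lambda>w. H (r m) w - g w)) \<longlonglongrightarrow> 0"
  proof (rule complete[of "\<lambda>m. H (r m)"])
    fix e :: real assume e: "e > 0"
    \<comment> \<open>A total of \<open>4 * M * e'\<close> must stay below \<open>e\<^sup>2\<close>;
      the added 2 keeps the denominator positive and the inequality strict.\<close>
    define e' where "e' = e\<^sup>2 / (8 * M + 2)"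
    have e': "e' > 0" using e M by (simp add: e'_def)
    obtain N0 where N0: "\<forall>n x. n \<ge> N0 \<and> x \<in> Q \<longrightarrow> cmod (H (r n) x - g0 x) < e'" using conv[OF e'] by blast
    have "bnorm \<sigma> (\<lambda>w. H (r i) w - H (r j) w) < e" if ij: "i \<ge> N0" "j \<ge> N0" for i j
    proof -
      let ?D = "\<lambda>w. H (r i) w - H (r j) w"
      have D: "?D \<in> B" by (rule B_diff[OF HB HB])
      have small: "cmod (?D u) \<le> 2 * e'" if "u \<in> Q" for u
      proof -
        have "cmod (H (r i) u - g0 u) < e'" "cmod (H (r j) u - g0 u) < e'" using N0 ij that by blast+
        then show ?thesis using norm_triangle_ineq4[of "H (r i) u - g0 u" "H (r j) u - g0 u"] by simp
      qed
      have "complex_of_real ((bnorm \<sigma> ?D)\<^sup>2) = ip \<sigma> ?D (H (r i)) - ip \<sigma> ?D (H (r j))"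
        unfolding ip_self[symmetric] by (rule ip_diff_right) (use HB D in \<open>auto intro: B_sqint\<close>)
      then have "(bnorm \<sigma> ?D)\<^sup>2 = cmod (ip \<sigma> ?D (H (r i)) - ip \<sigma> ?D (H (r j)))"
        by (metis abs_of_nonneg norm_of_real zero_le_power2)
      also have "\<dots> \<le> cmod (ip \<sigma> ?D (H (r i))) + cmod (ip \<sigma> ?D (H (r j)))" by (rule norm_triangle_ineq4)
      also have "\<dots> \<le> M * (2 * e') + M * (2 * e')"
        by (intro add_mono fam_bound[OF H D] small)
      also have "\<dots> < e\<^sup>2"
      proof -
        have "M * (2 * e') + M * (2 * e') = e\<^sup>2 * (4 * M / (8 * M + 2))" by (simp add: e'_def)
        also have "\<dots> < e\<^sup>2 * 1" using e M by (intro mult_strict_left_mono) (auto simp: divide_less_eq)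
        finally show ?thesis by simp
      qed
      finally show ?thesis using e by (simp add: power_less_imp_less_base)
    qed
    then show "\<exists>N. \<forall>m\<ge>N. \<forall>n\<ge>N. bnorm \<sigma> (\<lambda>w. H (r m) w - H (r n) w) < e" by blast
  qed (use HB in auto)
  show ?thesis by (rule that[OF r g])
qed

lemma ip_le_of_pointwise:
  assumes f: "f \<in> sqint \<sigma>" and g: "g \<in> sqint \<sigma>" and u: "u \<in> sqint \<sigma>" and v: "v \<in> sqint \<sigma>" and "c \<ge> 0"
    and le: "\<And>w. w \<in> \<Omega> \<Longrightarrow> cmod (f w) * cmod (g w) \<le> c * (cmod (u w) * cmod (v w))"
  shows "cmod (ip \<sigma> f g) \<le> c * (bnorm \<sigma> u * bnorm \<sigma> v)"
proof -
  have "cmod (ip \<sigma> f g) \<le> (\<integral>z. cmod (f z * cnj (g z)) \<partial>\<sigma>)"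
    unfolding ip_def by (rule integral_norm_bound)
  also have "\<dots> \<le> (\<integral>z. c * (cmod (u z) * cmod (v z)) \<partial>\<sigma>)"
    using sqint_mult_integrable[OF f g] sqint_mult_integrable[OF u v] le
    by (intro integral_mono) (auto simp: norm_mult space_\<sigma>)
  also have "\<dots> = c * (\<integral>z. cmod (u z) * cmod (v z) \<partial>\<sigma>)" by simp
  also have "\<dots> \<le> c * (bnorm \<sigma> u * bnorm \<sigma> v)"
    by (rule mult_left_mono[OF integral_mult_le_bnorm[OF u v] \<open>c \<ge> 0\<close>])
  finally show ?thesis .
qed

text \<open>Cauchy-Schwarz against the constant function gives the factor
  \<open>bnorm \<sigma> one\<close>. A point of \<open>Q\<close> forces the bound \<open>e\<close>
  on moduli to be nonnegative.\<close>

lemma P_fam: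
  assumes g: "g \<in> sqint \<sigma>" and supp: "\<And>w. w \<in> \<Omega> \<Longrightarrow> w \<notin> Q \<Longrightarrow> g w = 0" and b: "bnorm \<sigma> g \<le> b"
    and Q: "Q \<noteq> {}"
  shows "P g \<in> fam Q (bnorm \<sigma> one * b)"
  unfolding fam_def
proof (intro CollectI conjI ballI allI impI)
  show "P g \<in> B" by (rule P_in[OF g])
  fix f e assume f: "f \<in> B" and e: "\<forall>u\<in>Q. cmod (f u) \<le> e"
  have e0: "e \<ge> 0" using e Q norm_ge_zero order_trans by blast
  have "cmod (ip \<sigma> f (P g)) = cmod (ip \<sigma> f g)" by (simp add: ip_P[OF g f])
  also have "\<dots> \<le> e * (bnorm \<sigma> one * bnorm \<sigma> g)"
  proof (rule ip_le_of_pointwise[OF B_sqint[OF f] g B_sqint[OF one_in] g e0])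
    show "cmod (f w) * cmod (g w) \<le> e * (cmod (one w) * cmod (g w))" if "w \<in> \<Omega>" for w
      using e supp[OF that] that by (cases "w \<in> Q") (auto simp: one_def intro: mult_right_mono)
  qed
  also have "\<dots> \<le> e * (bnorm \<sigma> one * b)" using b e0 by (intro mult_left_mono) auto
  finally show "cmod (ip \<sigma> f (P g)) \<le> bnorm \<sigma> one * b * e" by (simp add: mult_ac)
qed

text \<open>Its squared norm is the \<lambda>-measure of the ball. Cauchy-Schwarz against it turns a
  pointwise bound by a multiple of \<open>nK\<close> on the ball into a bound uniform in the
  centre.\<close>

definition weight :: "'n pt \<Rightarrow> real \<Rightarrow> 'n fn" where
  "weight x r = (\<lambda>w. indicator (Db x r) w * complex_of_real (nK w))"

lemma weight_props:
  assumes x: "x \<in> \<Omega>"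
  shows weight_sqint: "weight x r \<in> sqint \<sigma>"
    and bnorm_weight: "bnorm \<sigma> (weight x r) \<le> sqrt (C * vol (C * r) 0)"
proof -
  note [measurable] = ball_sets[OF x]
  have m: "weight x r \<in> borel_measurable \<sigma>" unfolding weight_def by measurable
  have v0: "vol (C * r) 0 \<ge> 0" by (simp add: vol_def)
  have "(\<integral>\<^sup>+z. ennreal ((cmod (weight x r z))\<^sup>2) \<partial>\<sigma>) = (\<integral>\<^sup>+z. ennreal ((nK z)\<^sup>2) * indicator (Db x r) z \<partial>\<sigma>)"
    by (intro nn_integral_cong) (auto simp: weight_def indicator_def)
  also have "\<dots> = ennreal (vol r x)"
    by (simp add: emeasure_Lm[OF ball_sets[OF x], symmetric] vol_eq[OF x])
  also have "\<dots> \<le> ennreal ((sqrt (C * vol (C * r) 0))\<^sup>2)"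
    using vol_le_base[OF x, of r] C_ge v0 by (intro ennreal_leI) simp
  finally have le: "(\<integral>\<^sup>+z. ennreal ((cmod (weight x r z))\<^sup>2) \<partial>\<sigma>) \<le> ennreal ((sqrt (C * vol (C * r) 0))\<^sup>2)" .
  have "sqrt (C * vol (C * r) 0) \<ge> 0" using C_ge v0 by simp
  from sqintI_nn[OF m le this]
  show "weight x r \<in> sqint \<sigma>" "bnorm \<sigma> (weight x r) \<le> sqrt (C * vol (C * r) 0)" .
qed

text \<open>Pairing \<open>f\<close> with this adjoint means integrating \<open>V x f\<close>
  against \<open>g\<close>. On \<open>D(x, r)\<close> the function \<open>V x f\<close> involves
  \<open>f\<close> only at points \<open>\<phi> x w\<close> of the closed ball of radius
  \<open>C * r\<close> at the origin, and is bounded there by a multiple of \<open>nK w\<close>.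
  Neither the compact set nor the constant depends on \<open>x\<close>.\<close>

lemma adj_V_fam:
  assumes x: "x \<in> \<Omega>" and g: "g \<in> sqint \<sigma>" and supp: "\<And>w. w \<in> \<Omega> \<Longrightarrow> w \<notin> Db x r \<Longrightarrow> g w = 0"
    and b: "bnorm \<sigma> g \<le> b" and r: "r \<ge> 0"
  shows "adj (V x) (P g) \<in> fam (hm.mcball 0 (C * r)) (C * bnorm \<sigma> one * (sqrt (C * vol (C * r) 0) * b))"
  unfolding fam_def
proof (intro CollectI conjI ballI allI impI)
  show "adj (V x) (P g) \<in> B" by (rule adj_in[OF bop_V[OF x] P_in[OF g]])
  fix f e assume f: "f \<in> B" and e: "\<forall>u\<in>hm.mcball 0 (C * r). cmod (f u) \<le> e"
  have "0 \<in> hm.mcball 0 (C * r)" using base r C_ge by simp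
  then have e0: "e \<ge> 0" using e norm_ge_zero order_trans by blast
  have c: "C * bnorm \<sigma> one * e \<ge> 0" using C_ge e0 by simp
  have "ip \<sigma> f (adj (V x) (P g)) = ip \<sigma> (V x f) g"
    using ip_adj[OF bop_V[OF x] P_in[OF g] f] ip_P[OF g V_in[OF x f]] by simp
  also have "cmod \<dots> \<le> C * bnorm \<sigma> one * e * (bnorm \<sigma> (weight x r) * bnorm \<sigma> g)"
  proof (rule ip_le_of_pointwise[OF B_sqint[OF V_in[OF x f]] g weight_sqint[OF x] g c])
    fix w assume w: "w \<in> \<Omega>"
    show "cmod (V x f w) * cmod (g w) \<le> C * bnorm \<sigma> one * e * (cmod (weight x r w) * cmod (g w))"
    proof (cases "w \<in> Db x r")
      case True
      have y: "\<phi> x w \<in> \<Omega>" by (rule \<phi>_in[OF x w])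
      have "d 0 (\<phi> x w) \<le> C * d x w" using d_\<phi>[OF x w x] hm.\<phi>_self[OF x] by simp
      also have "\<dots> \<le> C * r" using True C_ge by simp
      finally have fe: "cmod (f (\<phi> x w)) \<le> e" using e y base by simp
      have "cmod (V x f w) \<le> C * (cmod (f (\<phi> x w)) * nK w / nK (\<phi> x w))"
        by (rule cmod_V_le[OF x f w])
      also have "\<dots> = C * (cmod (f (\<phi> x w)) * nK w * (1 / nK (\<phi> x w)))" by simp
      also have "\<dots> \<le> C * (e * nK w * bnorm \<sigma> one)"
        using C_ge fe e0 inverse_n_le[OF y] by (intro mult_left_mono mult_mono) auto
      finally have "cmod (V x f w) \<le> C * bnorm \<sigma> one * e * cmod (weight x r w)"
        using True by (simp add: weight_def mult_ac)
      then have "cmod (V x f w) * cmod (g w) \<le> C * bnorm \<sigma> one * e * cmod (weight x r w) * cmod (g w)"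
        by (rule mult_right_mono) simp
      then show ?thesis by (simp add: mult.assoc)
    qed (simp add: supp[OF w])
  qed
  also have "\<dots> \<le> C * bnorm \<sigma> one * e * (sqrt (C * vol (C * r) 0) * b)"
    using c bnorm_weight[OF x, of r] b order_trans[OF bnorm_nonneg bnorm_weight[OF x, of r]]
    by (intro mult_left_mono mult_mono) auto
  finally show "cmod (ip \<sigma> f (adj (V x) (P g))) \<le> C * bnorm \<sigma> one * (sqrt (C * vol (C * r) 0) * b) * e"
    by (simp add: mult_ac)
qed

text \<open>Duality: the squared norm of \<open>T (P g)\<close> is a pairing of \<open>g\<close>
  with \<open>adj T (T (P g))\<close>. The modulus of the latter at \<open>w\<close> is at most
  \<open>nK w\<close> times the norms of \<open>T (kn \<sigma> K w)\<close> and of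
  \<open>T (P g)\<close>, so smallness on the normalized kernels of the ball suffices.\<close>

lemma local_bound_of_kernels:
  assumes T: "bop T" and x: "x \<in> \<Omega>" and g: "g \<in> sqint \<sigma>"
    and supp: "\<And>w. w \<in> \<Omega> \<Longrightarrow> w \<notin> Db x r \<Longrightarrow> g w = 0"
    and s: "\<And>w. w \<in> Db x r \<Longrightarrow> bnorm \<sigma> (T (kn \<sigma> K w)) \<le> s" and "s \<ge> 0"
  shows "bnorm \<sigma> (T (P g)) \<le> s * (sqrt (C * vol (C * r) 0) * bnorm \<sigma> g)"
proof -
  let ?F = "T (P g)"
  have F: "?F \<in> B" by (intro bop_in[OF T] P_in g)
  note aF = adj_in[OF T F]
  have c: "s * bnorm \<sigma> ?F \<ge> 0" using \<open>s \<ge> 0\<close> by simp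
  have "complex_of_real ((bnorm \<sigma> ?F)\<^sup>2) = ip \<sigma> (P g) (adj T ?F)"
    unfolding ip_self[symmetric] by (rule ip_adj[OF T F P_in[OF g]])
  also have "\<dots> = cnj (ip \<sigma> (adj T ?F) g)" by (subst ip_cnj) (simp add: ip_P[OF g aF])
  finally have "(bnorm \<sigma> ?F)\<^sup>2 = cmod (ip \<sigma> (adj T ?F) g)"
    by (metis abs_of_nonneg complex_mod_cnj norm_of_real zero_le_power2)
  also have "\<dots> \<le> s * bnorm \<sigma> ?F * (bnorm \<sigma> (weight x r) * bnorm \<sigma> g)"
  proof (rule ip_le_of_pointwise[OF B_sqint[OF aF] g weight_sqint[OF x] g c])
    fix w assume w: "w \<in> \<Omega>"
    show "cmod (adj T ?F w) * cmod (g w) \<le> s * bnorm \<sigma> ?F * (cmod (weight x r w) * cmod (g w))"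
    proof (cases "w \<in> Db x r")
      case True
      have "adj T ?F w = cnj (ip \<sigma> (K w) (adj T ?F))"
        using reproducing[OF w aF] ip_cnj by metis
      also have "ip \<sigma> (K w) (adj T ?F) = ip \<sigma> (T (K w)) ?F"
        by (rule ip_adj[OF T F K_in[OF w], symmetric])
      finally have "cmod (adj T ?F w) \<le> bnorm \<sigma> (T (K w)) * bnorm \<sigma> ?F"
        using norm_ip_le[OF B_sqint[OF bop_in[OF T K_in[OF w]]] B_sqint[OF F]] by simp
      moreover have "bnorm \<sigma> (T (K w)) = nK w * bnorm \<sigma> (T (kn \<sigma> K w))"
        unfolding kn_eq bop_cmult[OF T K_in[OF w]] bnorm_cmult using n_pos[OF w] by (simp add: norm_divide)
      moreover have "nK w * bnorm \<sigma> (T (kn \<sigma> K w)) \<le> nK w * s" by (rule mult_left_mono[OF s[OF True]]) simp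
      ultimately have "cmod (adj T ?F w) \<le> nK w * s * bnorm \<sigma> ?F"
        using mult_right_mono[of "bnorm \<sigma> (T (K w))" "nK w * s" "bnorm \<sigma> ?F"] by simp
      then have "cmod (adj T ?F w) \<le> s * bnorm \<sigma> ?F * cmod (weight x r w)"
        using True by (simp add: weight_def mult_ac)
      then have "cmod (adj T ?F w) * cmod (g w) \<le> s * bnorm \<sigma> ?F * cmod (weight x r w) * cmod (g w)"
        by (rule mult_right_mono) simp
      then show ?thesis by (simp add: mult.assoc)
    qed (simp add: supp[OF w])
  qed
  also have "\<dots> \<le> s * bnorm \<sigma> ?F * (sqrt (C * vol (C * r) 0) * bnorm \<sigma> g)"
    using c bnorm_weight[OF x, of r] by (intro mult_left_mono mult_right_mono) auto
  finally have *: "bnorm \<sigma> ?F * bnorm \<sigma> ?F \<le> (s * (sqrt (C * vol (C * r) 0) * bnorm \<sigma> g)) * bnorm \<sigma> ?F"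
    by (simp add: power2_eq_square mult_ac)
  show ?thesis
  proof (cases "bnorm \<sigma> ?F = 0")
    case True
    moreover have "vol (C * r) 0 \<ge> 0" by (simp add: vol_def)
    ultimately show ?thesis using \<open>s \<ge> 0\<close> C_ge by simp
  next
    case False
    then have "bnorm \<sigma> ?F > 0" using bnorm_nonneg[of \<sigma> ?F] by linarith
    then show ?thesis using * by (simp only: mult_le_cancel_right_pos)
  qed
qed

section \<open>Truncations and compact approximants\<close>

definition cutoff :: "real \<Rightarrow> 'n fn \<Rightarrow> 'n fn" where
  "cutoff R f = (\<lambda>w. indicator (Db 0 R) w * f w)"

definition tail :: "real \<Rightarrow> 'n fn \<Rightarrow> 'n fn" where
  "tail R f = (\<lambda>w. indicator (\<Omega> - Db 0 R) w * f w)"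

lemma dom_sets: "\<Omega> \<in> sets \<sigma>"
  using sets.top[of \<sigma>] by (simp add: space_\<sigma>)

lemma cutoff_sqint: "f \<in> sqint \<sigma> \<Longrightarrow> cutoff R f \<in> sqint \<sigma>"
  and bnorm_cutoff: "f \<in> sqint \<sigma> \<Longrightarrow> bnorm \<sigma> (cutoff R f) \<le> bnorm \<sigma> f"
  unfolding cutoff_def using sqint_indicator[OF _ ball_sets[OF base]] by auto

lemma tail_sqint: "f \<in> sqint \<sigma> \<Longrightarrow> tail R f \<in> sqint \<sigma>"
  and bnorm_tail: "f \<in> sqint \<sigma> \<Longrightarrow> bnorm \<sigma> (tail R f) \<le> bnorm \<sigma> f"
  unfolding tail_def using sqint_indicator[OF _ sets.Diff[OF dom_sets ball_sets[OF base]]] by auto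

lemma cutoff_plus_tail: "w \<in> \<Omega> \<Longrightarrow> cutoff R f w + tail R f w = f w"
  by (auto simp: cutoff_def tail_def indicator_def)

text \<open>Truncation followed by \<open>P\<close> sends the unit ball into a family
  \<open>fam\<close> attached to a closed ball at the origin; the bounded \<open>T\<close> preserves
  convergence of the resulting subsequence.\<close>

lemma compose_cutoff_compact:
  assumes T: "bop T" and R: "R > 0"
  shows "cop (\<lambda>f. T (P (cutoff R f)))"
  unfolding compact_op_def
proof (intro conjI allI impI)
  obtain M where M': "M \<ge> 0" "\<forall>f\<in>B. bnorm \<sigma> (T f) \<le> M * bnorm \<sigma> f" using bop_bound[OF T] .
  note M = M'(1) bspec[OF M'(2)]
  have cB: "P (cutoff R f) \<in> B" if "f \<in> B" for f by (intro P_in cutoff_sqint B_sqint that)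
  show "bop (\<lambda>f. T (P (cutoff R f)))"
  proof (rule bopI)
    show "T (P (cutoff R f)) \<in> B" if "f \<in> B" for f by (intro bop_in[OF T] cB that)
    show "T (P (cutoff R (\<lambda>w. f w + g w))) = (\<lambda>w. T (P (cutoff R f)) w + T (P (cutoff R g)) w)"
      if "f \<in> B" "g \<in> B" for f g
    proof -
      have "cutoff R (\<lambda>w. f w + g w) = (\<lambda>w. cutoff R f w + cutoff R g w)"
        by (simp add: cutoff_def algebra_simps)
      then show ?thesis
        by (simp add: P_add cutoff_sqint B_sqint that bop_add[OF T cB[OF that(1)] cB[OF that(2)]])
    qed
    show "T (P (cutoff R (\<lambda>w. c * f w))) = (\<lambda>w. c * T (P (cutoff R f)) w)" if "f \<in> B" for f c
    proof -
      have "cutoff R (\<lambda>w. c * f w) = (\<lambda>w. c * cutoff R f w)"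
        by (simp add: cutoff_def algebra_simps)
      then show ?thesis
        by (simp add: P_cmult cutoff_sqint B_sqint that bop_cmult[OF T cB[OF that]])
    qed
    show "bnorm \<sigma> (T (P (cutoff R f))) \<le> M * bnorm \<sigma> f" if f: "f \<in> B" for f
    proof -
      have "bnorm \<sigma> (T (P (cutoff R f))) \<le> M * bnorm \<sigma> (P (cutoff R f))" by (rule M(2)[OF cB[OF f]])
      also have "\<dots> \<le> M * bnorm \<sigma> f"
        using bnorm_P[OF cutoff_sqint[OF B_sqint[OF f]], of R] bnorm_cutoff[OF B_sqint[OF f], of R] M(1)
        by (intro mult_left_mono) auto
      finally show ?thesis .
    qed
  qed
  fix X :: "nat \<Rightarrow> 'n fn" assume X: "\<forall>n. X n \<in> B \<and> bnorm \<sigma> (X n) \<le> 1"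
  have XB: "X m \<in> B" for m using X by simp
  obtain r g where r: "strict_mono (r :: nat \<Rightarrow> nat)" and g: "g \<in> B"
    and lim: "(\<lambda>m. bnorm \<sigma> (\<lambda>w. P (cutoff R (X (r m))) w - g w)) \<longlonglongrightarrow> 0"
  proof (rule fam_seq_compact[of "hm.mcball 0 R" "bnorm \<sigma> one * 1" "\<lambda>m. P (cutoff R (X m))"])
    show "compact (hm.mcball 0 R)" by (rule hm.compact_mcball[OF base])
    show "P (cutoff R (X m)) \<in> fam (hm.mcball 0 R) (bnorm \<sigma> one * 1)" for m
    proof (rule P_fam[OF cutoff_sqint[OF B_sqint[OF XB]]])
      show "bnorm \<sigma> (cutoff R (X m)) \<le> 1"
        using bnorm_cutoff[OF B_sqint[OF XB], of R m] X by (meson order_trans)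
      show "hm.mcball 0 R \<noteq> {}" using base R by (simp add: hm.mcball_eq_empty)
    qed (auto simp: cutoff_def indicator_def)
  qed auto
  have "(\<lambda>m. bnorm \<sigma> (\<lambda>w. T (P (cutoff R (X (r m)))) w - T g w)) \<longlonglongrightarrow> 0"
  proof (rule tendsto_sandwich[OF _ _ tendsto_const])
    show "(\<lambda>m. M * bnorm \<sigma> (\<lambda>w. P (cutoff R (X (r m))) w - g w)) \<longlonglongrightarrow> 0"
      using tendsto_mult_right_zero[OF lim] by simp
    have "bnorm \<sigma> (\<lambda>w. T (P (cutoff R (X (r m)))) w - T g w)
        \<le> M * bnorm \<sigma> (\<lambda>w. P (cutoff R (X (r m))) w - g w)" for m
      using M(2)[OF B_diff[OF cB[OF XB] g]] by (simp add: bop_diff[OF T cB[OF XB] g])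
    then show "\<forall>\<^sub>F m in sequentially. bnorm \<sigma> (\<lambda>w. T (P (cutoff R (X (r m)))) w - T g w)
        \<le> M * bnorm \<sigma> (\<lambda>w. P (cutoff R (X (r m))) w - g w)" by simp
  qed simp
  then show "\<exists>r g. strict_mono r \<and> g \<in> B \<and>
     (\<lambda>n. bnorm \<sigma> (\<lambda>w. T (P (cutoff R (X (r n)))) w - g w)) \<longlonglongrightarrow> 0"
    using r bop_in[OF T g] by blast
qed

text \<open>The local hypothesis is asked for every \<open>\<rho>\<close> because
  \<open>localization\<close> dictates the radius. The error is \<open>T\<close> after
  \<open>P\<close> on the tail of \<open>f\<close>; balls with centre near the origin miss the
  support of the tail, so only distant centres matter.\<close>

lemma approx_by_cutoff:
  assumes T: "admissible p T" and \<eta>: "\<eta> \<ge> 0" and \<epsilon>: "\<epsilon> > 0"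
    and loc: "\<And>\<rho>. \<rho> > 0 \<Longrightarrow> \<exists>R. \<forall>x\<in>\<Omega>. d x 0 > R \<longrightarrow> (\<forall>g\<in>sqint \<sigma>.
        (\<forall>w\<in>\<Omega>. w \<notin> Db x \<rho> \<longrightarrow> g w = 0) \<longrightarrow> bnorm \<sigma> (T (P g)) \<le> \<eta> * bnorm \<sigma> g)"
  obtains R where "R > 0" "\<forall>f\<in>B. bnorm \<sigma> (\<lambda>w. T f w - T (P (cutoff R f)) w) \<le> 2 * C\<^sup>2 * (\<epsilon> + \<eta>) * bnorm \<sigma> f"
proof -
  have bT: "bop T" using T by simp
  obtain \<rho> where \<rho>: "\<rho> > 0" and glob: "\<forall>g\<in>sqint \<sigma>. \<forall>\<eta>\<ge>0.
     (\<forall>x\<in>\<Omega>. bnorm \<sigma> (T (P (\<lambda>w. indicator (Db x (2 * \<rho>)) w * g w)))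
          \<le> \<eta> * bnorm \<sigma> (\<lambda>w. indicator (Db x (2 * \<rho>)) w * g w)) \<longrightarrow>
     bnorm \<sigma> (T (P g)) \<le> 2 * C\<^sup>2 * (\<epsilon> + \<eta>) * bnorm \<sigma> g"
    using localization[OF T \<epsilon>] .
  obtain R0 where R0: "\<forall>x\<in>\<Omega>. d x 0 > R0 \<longrightarrow> (\<forall>g\<in>sqint \<sigma>.
        (\<forall>w\<in>\<Omega>. w \<notin> Db x (2 * \<rho>) \<longrightarrow> g w = 0) \<longrightarrow> bnorm \<sigma> (T (P g)) \<le> \<eta> * bnorm \<sigma> g)"
    using loc[of "2 * \<rho>"] \<rho> by auto
  \<comment> \<open>A ball of radius \<open>2 * \<rho>\<close> whose centre is within
    \<open>R0\<close> of the origin then lies where the tail vanishes.\<close>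
  define R where "R = max 0 R0 + 2 * \<rho>"
  have R: "R > 0" "R0 + 2 * \<rho> \<le> R" using \<rho> by (auto simp: R_def)
  have "bnorm \<sigma> (\<lambda>w. T f w - T (P (cutoff R f)) w) \<le> 2 * C\<^sup>2 * (\<epsilon> + \<eta>) * bnorm \<sigma> f" if f: "f \<in> B" for f
  proof -
    note fs = B_sqint[OF f]
    have "f = (\<lambda>w. cutoff R f w + tail R f w)"
    proof
      show "f w = cutoff R f w + tail R f w" for w
        using cutoff_plus_tail[of w R f] B_off[OF f, of w] by (cases "w \<in> \<Omega>") (auto simp: cutoff_def tail_def)
    qed
    then have "P f = (\<lambda>w. P (cutoff R f) w + P (tail R f) w)"
      using P_add[OF cutoff_sqint[OF fs] tail_sqint[OF fs], of R R] by metis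
    then have "T f = (\<lambda>w. T (P (cutoff R f)) w + T (P (tail R f)) w)"
      using bop_add[OF bT P_in[OF cutoff_sqint[OF fs]] P_in[OF tail_sqint[OF fs]], of R R] P_of_B[OF f] by metis
    then have "(\<lambda>w. T f w - T (P (cutoff R f)) w) = T (P (tail R f))" by auto
    moreover have "bnorm \<sigma> (T (P (tail R f))) \<le> 2 * C\<^sup>2 * (\<epsilon> + \<eta>) * bnorm \<sigma> (tail R f)"
    proof (rule glob[rule_format, OF tail_sqint[OF fs] \<eta>])
      fix x assume x: "x \<in> \<Omega>"
      let ?g = "\<lambda>w. indicator (Db x (2 * \<rho>)) w * tail R f w"
      have g: "?g \<in> sqint \<sigma>" by (rule sqint_indicator(1)[OF tail_sqint[OF fs] ball_sets[OF x]])
      show "bnorm \<sigma> (T (P ?g)) \<le> \<eta> * bnorm \<sigma> ?g"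
      proof (cases "d x 0 > R0")
        case True
        then show ?thesis using R0 x g by auto
      next
        case False
        have "?g w = 0" for w
        proof (cases "w \<in> Db x (2 * \<rho>)")
          case True
          then have w: "w \<in> \<Omega>" by simp
          have "d 0 w \<le> d 0 x + d x w" by (rule hm.triangle[OF base x w])
          also have "\<dots> < R0 + 2 * \<rho>" using False True by (simp add: hm.commute[of 0 x])
          finally have "w \<in> Db 0 R" using R(2) base w by simp
          then show ?thesis by (simp add: tail_def)
        qed simp
        then have "?g = (\<lambda>_. 0)" by blast
        moreover have "T (P (\<lambda>_. 0)) = (\<lambda>_. 0)" using P_of_B[OF B_zero] bop_zero[OF bT] by simp
        ultimately show ?thesis by simp
      qed
    qed
    moreover have "2 * C\<^sup>2 * (\<epsilon> + \<eta>) * bnorm \<sigma> (tail R f) \<le> 2 * C\<^sup>2 * (\<epsilon> + \<eta>) * bnorm \<sigma> f"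
      using bnorm_tail[OF fs, of R] \<epsilon> \<eta> by (intro mult_left_mono) auto
    ultimately show ?thesis by simp
  qed
  then show ?thesis using that[OF R(1)] by blast
qed

section \<open>The limit at infinity and weak convergence of translates\<close>

lemma eventually_dinf: "eventually Q (dinf \<Omega> d) \<longleftrightarrow> (\<exists>R. \<forall>z\<in>\<Omega>. d z 0 > R \<longrightarrow> Q z)"
  unfolding dinf_def eventually_inf_principal eventually_filtercomap_at_top_dense by auto

text \<open>Without unboundedness of \<open>d\<close> the Limsup in (a) would be the junk value \<open>-\<infinity>\<close>.\<close>

lemma dinf_neq_bot: "dinf \<Omega> d \<noteq> bot"
proof
  assume "dinf \<Omega> d = bot"
  then have "eventually (\<lambda>_. False) (dinf \<Omega> d)" by simp
  then obtain R where "\<forall>z\<in>\<Omega>. \<not> d z 0 > R" unfolding eventually_dinf by blast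
  then show False using hm.unbounded[of R] by blast
qed

lemma tail_small:
  assumes f: "f \<in> sqint \<sigma>" and \<epsilon>: "\<epsilon> > 0"
  obtains R where "R > 0" "bnorm \<sigma> (tail R f) < \<epsilon>"
proof -
  note [measurable] = sqint_measurable[OF f]
  have s: "\<Omega> - Db 0 (real k) \<in> sets \<sigma>" for k by (rule sets.Diff[OF dom_sets ball_sets[OF base]])
  have "(\<lambda>k. \<integral>w. (cmod (tail (real k) f w))\<^sup>2 \<partial>\<sigma>) \<longlonglongrightarrow> (\<integral>w. 0 \<partial>\<sigma>)"
  proof (rule integral_dominated_convergence[where w = "\<lambda>w. (cmod (f w))\<^sup>2"])
    show "(\<lambda>w. (cmod (tail (real k) f w))\<^sup>2) \<in> borel_measurable \<sigma>" for k
      using sqint_measurable[OF tail_sqint[OF f, of "real k"]] by measurable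
    show "integrable \<sigma> (\<lambda>w. (cmod (f w))\<^sup>2)" by (rule sqint_integrable[OF f])
    show "AE w in \<sigma>. (\<lambda>k. (cmod (tail (real k) f w))\<^sup>2) \<longlonglongrightarrow> 0"
    proof (rule AE_I2)
      fix w assume "w \<in> space \<sigma>"
      then have w: "w \<in> \<Omega>" by (simp add: space_\<sigma>)
      obtain k0 :: nat where k0: "d 0 w < real k0" using reals_Archimedean2 by blast
      have "tail (real k) f w = 0" if "k \<ge> k0" for k
        using k0 that w base by (simp add: tail_def)
      then have "eventually (\<lambda>k. (cmod (tail (real k) f w))\<^sup>2 = 0) sequentially"
        unfolding eventually_sequentially by (intro exI[of _ k0]) simp
      then show "(\<lambda>k. (cmod (tail (real k) f w))\<^sup>2) \<longlonglongrightarrow> 0" by (rule tendsto_eventually)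
    qed
    show "AE w in \<sigma>. norm ((cmod (tail (real k) f w))\<^sup>2) \<le> (cmod (f w))\<^sup>2" for k
      by (rule AE_I2) (auto simp: tail_def indicator_def)
  qed simp
  then have "(\<lambda>k. bnorm \<sigma> (tail (real k) f)) \<longlonglongrightarrow> sqrt 0"
    unfolding bnorm_def by (intro tendsto_real_sqrt) simp
  then have "eventually (\<lambda>k. bnorm \<sigma> (tail (real k) f) < \<epsilon>) sequentially"
    using \<epsilon> by (intro order_tendstoD(2)) auto
  then obtain k where k: "\<forall>j\<ge>k. bnorm \<sigma> (tail (real j) f) < \<epsilon>" unfolding eventually_sequentially by blast
  show ?thesis by (rule that[OF _ k[rule_format, of "Suc k"]]) auto
qed

text \<open>On a ball about the origin \<open>U z v\<close> involves only values of \<open>v\<close>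
  near \<open>z\<close>, that is, the tail of \<open>v\<close>; off that ball \<open>f\<close>
  itself is small. Up to conjugation the pairing is that of \<open>adj (U z) f\<close> with
  \<open>v\<close>, so this is weak convergence of the adjoint translates to 0.\<close>

lemma U_weakly_null:
  assumes v: "v \<in> B" and f: "f \<in> B"
  shows "((\<lambda>z. ip \<sigma> (U z v) f) \<longlongrightarrow> 0) (dinf \<Omega> d)"
proof (rule tendstoI)
  fix \<epsilon> :: real assume \<epsilon>: "\<epsilon> > 0"
  note vs = B_sqint[OF v] and fs = B_sqint[OF f]
  define c where "c = C\<^sup>2 * (bnorm \<sigma> f + bnorm \<sigma> v + 1)"
  have c: "c > 0" using C_ge by (auto simp: c_def add_nonneg_pos)
  obtain R where R: "R > 0" "bnorm \<sigma> (tail R f) < \<epsilon> / c" using tail_small[OF fs, of "\<epsilon> / c"] \<epsilon> c by auto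
  obtain R' where R': "R' > 0" "bnorm \<sigma> (tail R' v) < \<epsilon> / c" using tail_small[OF vs, of "\<epsilon> / c"] \<epsilon> c by auto
  show "eventually (\<lambda>z. dist (ip \<sigma> (U z v) f) 0 < \<epsilon>) (dinf \<Omega> d)"
    unfolding eventually_dinf
  proof (intro exI ballI impI)
    fix z assume z: "z \<in> \<Omega>" and far: "d z 0 > R' + C * R"
    note Us = B_sqint[OF U_in[OF z v]]
    have cut: "bnorm \<sigma> (cutoff R (U z v)) \<le> C\<^sup>2 * bnorm \<sigma> (tail R' v)"
    proof (rule bnorm_\<phi>_le(2)[OF z tail_sqint[OF vs] sqint_measurable[OF cutoff_sqint[OF Us]]])
      fix w assume w: "w \<in> \<Omega>"
      show "cmod (cutoff R (U z v) w) \<le> C * (cmod (tail R' v (\<phi> z w)) * nK w / nK (\<phi> z w))"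
      proof (cases "w \<in> Db 0 R")
        case True
        have y: "\<phi> z w \<in> \<Omega>" by (rule \<phi>_in[OF z w])
        have "d z (\<phi> z w) \<le> C * d 0 w" using d_\<phi>[OF base w z] \<phi>_base[OF z] by simp
        also have "\<dots> < C * R" using True C_ge by simp
        finally have "d z (\<phi> z w) < C * R" .
        then have "d 0 (\<phi> z w) > R'"
          using hm.triangle[OF z y base] far by (simp add: hm.commute[of 0])
        then have "\<phi> z w \<notin> Db 0 R'" by simp
        then have "tail R' v (\<phi> z w) = v (\<phi> z w)" using y by (simp add: tail_def)
        then show ?thesis using cmod_U_le[OF z v w] True by (simp add: cutoff_def)
      next
        case False
        then have "cutoff R (U z v) w = 0" by (simp add: cutoff_def)
        moreover have "0 \<le> C * (cmod (tail R' v (\<phi> z w)) * nK w / nK (\<phi> z w))" using C_ge by simp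
        ultimately show ?thesis by simp
      qed
    qed
    have split: "ip \<sigma> (U z v) f = ip \<sigma> (cutoff R (U z v)) f + ip \<sigma> (U z v) (tail R f)"
    proof -
      have "ip \<sigma> (cutoff R (U z v)) f + ip \<sigma> (U z v) (tail R f)
          = (\<integral>w. cutoff R (U z v) w * cnj (f w) + U z v w * cnj (tail R f w) \<partial>\<sigma>)"
        unfolding ip_def
        by (rule Bochner_Integration.integral_add[symmetric])
          (intro ip_integrable cutoff_sqint tail_sqint Us fs)+
      also have "\<dots> = ip \<sigma> (U z v) f"
        unfolding ip_def
        by (rule Bochner_Integration.integral_cong) (auto simp: space_\<sigma> cutoff_def tail_def indicator_def)
      finally show ?thesis by simp
    qed
    have "cmod (ip \<sigma> (U z v) f) \<le> cmod (ip \<sigma> (cutoff R (U z v)) f) + cmod (ip \<sigma> (U z v) (tail R f))"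
      unfolding split by (rule norm_triangle_ineq)
    also have "\<dots> \<le> C\<^sup>2 * bnorm \<sigma> (tail R' v) * bnorm \<sigma> f + C\<^sup>2 * bnorm \<sigma> v * bnorm \<sigma> (tail R f)"
    proof (rule add_mono)
      show "cmod (ip \<sigma> (cutoff R (U z v)) f) \<le> C\<^sup>2 * bnorm \<sigma> (tail R' v) * bnorm \<sigma> f"
        using norm_ip_le[OF cutoff_sqint[OF Us] fs, of R] mult_right_mono[OF cut bnorm_nonneg[of \<sigma> f]]
        by (rule order_trans)
      show "cmod (ip \<sigma> (U z v) (tail R f)) \<le> C\<^sup>2 * bnorm \<sigma> v * bnorm \<sigma> (tail R f)"
        using norm_ip_le[OF Us tail_sqint[OF fs], of R] mult_right_mono[OF bnorm_U[OF z v] bnorm_nonneg[of \<sigma> "tail R f"]]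
        by (rule order_trans)
    qed
    also have "\<dots> \<le> C\<^sup>2 * (\<epsilon> / c) * bnorm \<sigma> f + C\<^sup>2 * bnorm \<sigma> v * (\<epsilon> / c)"
      using R R' by (intro add_mono mult_left_mono mult_right_mono) auto
    also have "\<dots> = \<epsilon> / c * (C\<^sup>2 * (bnorm \<sigma> f + bnorm \<sigma> v))" by (simp add: algebra_simps)
    also have "\<dots> < \<epsilon> / c * c"
      using \<epsilon> c C_ge by (intro mult_strict_left_mono) (auto simp: c_def)
    also have "\<dots> = \<epsilon>" using c by simp
    finally show "dist (ip \<sigma> (U z v) f) 0 < \<epsilon>" by simp
  qed
qed

lemma compact_imp_bop: "cop A \<Longrightarrow> bop A"
  by (simp add: compact_op_def)

text \<open>A subsequence of the images converges in norm. Its limit vanishes at every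
  \<open>w\<close>, because its value there is the limit of pairings of weakly null functions with
  \<open>adj A (K w)\<close>; this contradicts a lower bound by \<open>\<epsilon>\<close>.\<close>

lemma compact_translates_null:
  assumes A: "cop A" and f: "f \<in> B" and \<epsilon>: "\<epsilon> > 0"
  shows "eventually (\<lambda>z. bnorm \<sigma> (A (adj (U z) f)) < \<epsilon>) (dinf \<Omega> d)"
proof (rule ccontr)
  assume "\<not> ?thesis"
  then have "\<forall>m::nat. \<exists>z\<in>\<Omega>. d z 0 > real m \<and> bnorm \<sigma> (A (adj (U z) f)) \<ge> \<epsilon>"
    unfolding eventually_dinf by (meson not_le)
  then obtain z where z: "\<And>m. z m \<in> \<Omega>" "\<And>m::nat. d (z m) 0 > real m" "\<And>m. bnorm \<sigma> (A (adj (U (z m)) f)) \<ge> \<epsilon>"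
    by metis
  note bA = compact_imp_bop[OF A]
  \<comment> \<open>This scales the adjoint translates into the unit ball; the added 1 covers
    \<open>f\<close> of norm 0.\<close>
  define c where "c = 1 / (C\<^sup>2 * bnorm \<sigma> f + 1)"
  have pos: "C\<^sup>2 * bnorm \<sigma> f + 1 > 0" by (simp add: add_nonneg_pos)
  then have c: "c > 0" by (simp add: c_def)
  define X where "X m = (\<lambda>w. complex_of_real c * adj (U (z m)) f w)" for m
  have aB: "adj (U (z m)) f \<in> B" for m by (rule adj_in[OF bop_U[OF z(1)] f])
  have X: "X m \<in> B" for m unfolding X_def by (rule B_cmult[OF aB])
  have "bnorm \<sigma> (X m) \<le> 1" for m
  proof -
    have "bnorm \<sigma> (X m) = c * bnorm \<sigma> (adj (U (z m)) f)" unfolding X_def bnorm_cmult using c by simp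
    also have "\<dots> \<le> c * (C\<^sup>2 * bnorm \<sigma> f + 1)"
      using c bnorm_adj_U[OF z(1) f, of m] by (intro mult_left_mono) auto
    also have "\<dots> = 1" using pos by (simp add: c_def)
    finally show ?thesis .
  qed
  then have "\<exists>(r::nat \<Rightarrow> nat) g. strict_mono r \<and> g \<in> B \<and> (\<lambda>n. bnorm \<sigma> (\<lambda>w. A (X (r n)) w - g w)) \<longlonglongrightarrow> 0"
    using A X unfolding compact_op_def by simp
  then obtain r g where r: "strict_mono (r :: nat \<Rightarrow> nat)" and g: "g \<in> B"
    and lim: "(\<lambda>n. bnorm \<sigma> (\<lambda>w. A (X (r n)) w - g w)) \<longlonglongrightarrow> 0" by blast
  have AX: "A (X m) \<in> B" for m by (rule bop_in[OF bA X])
  have z_far: "filterlim (\<lambda>n. z (r n)) (dinf \<Omega> d) sequentially"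
    unfolding filterlim_iff eventually_dinf
  proof (intro allI impI)
    fix Q assume "\<exists>R. \<forall>z\<in>\<Omega>. R < d z 0 \<longrightarrow> Q z"
    then obtain R where R: "\<forall>z\<in>\<Omega>. R < d z 0 \<longrightarrow> Q z" by blast
    obtain k :: nat where k: "R < real k" using reals_Archimedean2 by blast
    have "Q (z (r n))" if "n \<ge> k" for n
    proof -
      have "k \<le> r n" using that seq_suble[OF r, of n] by simp
      then have "R < d (z (r n)) 0" using k z(2)[of "r n"] by (meson le_less_trans less_imp_le less_le_trans of_nat_le_iff)
      then show ?thesis using R z(1) by blast
    qed
    then show "eventually (\<lambda>n. Q (z (r n))) sequentially" unfolding eventually_sequentially by blast
  qed
  have "g w = 0" if w: "w \<in> \<Omega>" for w
  proof -
    let ?v = "adj A (K w)"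
    have v: "?v \<in> B" by (rule adj_in[OF bA K_in[OF w]])
    have Aw: "A (X m) w = complex_of_real c * cnj (ip \<sigma> (U (z m) ?v) f)" for m
    proof -
      have "A (X m) w = ip \<sigma> (X m) ?v"
        using reproducing[OF w AX] ip_adj[OF bA K_in[OF w] X] by simp
      also have "\<dots> = complex_of_real c * ip \<sigma> (adj (U (z m)) f) ?v" unfolding X_def by (rule ip_cmult_left)
      also have "ip \<sigma> (adj (U (z m)) f) ?v = cnj (ip \<sigma> (U (z m) ?v) f)"
        unfolding ip_adj[OF bop_U[OF z(1)] f v] by (rule ip_cnj)
      finally show ?thesis .
    qed
    have "(\<lambda>n. ip \<sigma> (U (z (r n)) ?v) f) \<longlonglongrightarrow> 0"
      using filterlim_compose[OF U_weakly_null[OF v f] z_far] .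
    then have "(\<lambda>n. complex_of_real c * cnj (ip \<sigma> (U (z (r n)) ?v) f)) \<longlonglongrightarrow> complex_of_real c * cnj 0"
      by (intro tendsto_intros)
    then have l0: "(\<lambda>n. A (X (r n)) w) \<longlonglongrightarrow> 0" by (simp add: Aw)
    have "(\<lambda>n. A (X (r n)) w - g w) \<longlonglongrightarrow> 0"
    proof (rule tendsto_norm_zero_cancel, rule tendsto_sandwich[OF _ _ tendsto_const])
      show "(\<lambda>n. bnorm \<sigma> (\<lambda>w. A (X (r n)) w - g w) * nK w) \<longlonglongrightarrow> 0"
        using tendsto_mult_left_zero[OF lim] by simp
      show "\<forall>\<^sub>F n in sequentially. cmod (A (X (r n)) w - g w) \<le> bnorm \<sigma> (\<lambda>w. A (X (r n)) w - g w) * nK w"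
        using eval_le[OF B_diff[OF AX g] w] by simp
    qed simp
    from tendsto_diff[OF l0 this] have "(\<lambda>n::nat. g w) \<longlonglongrightarrow> 0" by simp
    then show ?thesis by (simp add: LIMSEQ_const_iff)
  qed
  then have "g = (\<lambda>_. 0)" by (intro B_eqI[OF g B_zero]) simp
  then have "(\<lambda>n. bnorm \<sigma> (A (X (r n)))) \<longlonglongrightarrow> 0" using lim by simp
  moreover have "bnorm \<sigma> (A (X m)) \<ge> c * \<epsilon>" for m
  proof -
    have "bnorm \<sigma> (A (X m)) = c * bnorm \<sigma> (A (adj (U (z m)) f))"
      unfolding X_def bop_cmult[OF bA aB] bnorm_cmult using c by simp
    then show ?thesis using z(3)[of m] c by simp
  qed
  ultimately have "c * \<epsilon> \<le> 0" by (intro LIMSEQ_le_const) auto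
  then show False using c \<epsilon> by (simp add: mult_le_0_iff)
qed


section \<open>The essential norm\<close>

lemma metric_B: "Metric_space B (\<lambda>f g. bnorm \<sigma> (\<lambda>w. f w - g w))"
proof
  fix f g h
  show "0 \<le> bnorm \<sigma> (\<lambda>w. f w - g w)" by simp
  show "bnorm \<sigma> (\<lambda>w. f w - g w) = bnorm \<sigma> (\<lambda>w. g w - f w)" by (rule bnorm_minus_commute)
  show "(bnorm \<sigma> (\<lambda>w. f w - g w) = 0) = (f = g)" if "f \<in> B" "g \<in> B"
  proof
    assume 0: "bnorm \<sigma> (\<lambda>w. f w - g w) = 0"
    show "f = g"
    proof (rule B_eqI[OF that])
      fix z assume "z \<in> \<Omega>"
      from eval_le[OF B_diff[OF that] this] show "f z = g z" by (simp add: 0)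
    qed
  qed simp
  show "bnorm \<sigma> (\<lambda>w. f w - h w) \<le> bnorm \<sigma> (\<lambda>w. f w - g w) + bnorm \<sigma> (\<lambda>w. g w - h w)"
    if "f \<in> B" "g \<in> B" "h \<in> B"
    by (rule bnorm_triangle_diff) (use that B_sqint in auto)
qed

text \<open>Norm limits of compact operators are compact by total boundedness: unit-ball elements
  whose images under a close compact \<open>A\<close> form a net have images under \<open>T\<close>
  that form a slightly coarser net.\<close>

lemma compact_limit:
  assumes T: "bop T"
    and approx: "\<And>\<epsilon>. \<epsilon> > 0 \<Longrightarrow> \<exists>A. cop A \<and> (\<forall>f\<in>B. bnorm \<sigma> (\<lambda>w. T f w - A f w) \<le> \<epsilon> * bnorm \<sigma> f)"
  shows "cop T"
proof -
  interpret MB: Metric_space B "\<lambda>f g. bnorm \<sigma> (\<lambda>w. f w - g w)" by (rule metric_B)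
  let ?b = "{f \<in> B. bnorm \<sigma> f \<le> 1}"
  have A_tb: "MB.mtotally_bounded (A ` ?b)" if A: "cop A" for A
    unfolding MB.mtotally_bounded_sequentially
  proof (intro conjI allI impI)
    show "A ` ?b \<subseteq> B" using bop_in[OF compact_imp_bop[OF A]] by blast
    fix Y :: "nat \<Rightarrow> 'n fn" assume "range Y \<subseteq> A ` ?b"
    then have "\<forall>m. \<exists>x. x \<in> ?b \<and> Y m = A x" by blast
    then obtain X where X: "\<And>m. X m \<in> ?b" "\<And>m. Y m = A (X m)" by metis
    have "\<exists>(r::nat \<Rightarrow> nat) g. strict_mono r \<and> g \<in> B \<and> (\<lambda>n. bnorm \<sigma> (\<lambda>w. A (X (r n)) w - g w)) \<longlonglongrightarrow> 0"
      using A X(1) unfolding compact_op_def by simp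
    then obtain r g where r: "strict_mono (r :: nat \<Rightarrow> nat)" and g: "g \<in> B"
      and lim: "(\<lambda>n. bnorm \<sigma> (\<lambda>w. A (X (r n)) w - g w)) \<longlonglongrightarrow> 0" by blast
    have AX: "A (X m) \<in> B" for m using X(1)[of m] bop_in[OF compact_imp_bop[OF A]] by simp
    have "limitin MB.mtopology (Y \<circ> r) g sequentially"
      unfolding MB.limitin_metric
    proof (intro conjI allI impI g)
      fix \<epsilon> :: real assume "\<epsilon> > 0"
      from order_tendstoD(2)[OF lim this]
      show "\<forall>\<^sub>F n in sequentially. (Y \<circ> r) n \<in> B \<and> bnorm \<sigma> (\<lambda>w. (Y \<circ> r) n w - g w) < \<epsilon>"
        by (rule eventually_mono) (simp add: X(2) AX)
    qed
    then have "MB.MCauchy (Y \<circ> r)"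
      by (rule MB.convergent_imp_MCauchy[rotated]) (use AX X(2) in auto)
    then show "\<exists>r. strict_mono r \<and> MB.MCauchy (Y \<circ> r)" using r by blast
  qed
  have "MB.mtotally_bounded (T ` ?b)"
    unfolding MB.mtotally_bounded_def
  proof (intro allI impI)
    fix \<epsilon> :: real assume \<epsilon>: "\<epsilon> > 0"
    then obtain A where A: "cop A" and TA: "\<forall>f\<in>B. bnorm \<sigma> (\<lambda>w. T f w - A f w) \<le> \<epsilon> / 4 * bnorm \<sigma> f"
      using approx[of "\<epsilon> / 4"] by auto
    note bA = compact_imp_bop[OF A]
    have "\<exists>F. finite F \<and> F \<subseteq> A ` ?b \<and> A ` ?b \<subseteq> (\<Union>x\<in>F. MB.mball x (\<epsilon> / 4))"
      using A_tb[OF A] \<epsilon> unfolding MB.mtotally_bounded_def by simp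
    then obtain F where F: "finite F" "F \<subseteq> A ` ?b" "A ` ?b \<subseteq> (\<Union>x\<in>F. MB.mball x (\<epsilon> / 4))" by blast
    obtain G where G: "finite G" "G \<subseteq> ?b" "F = A ` G" using finite_subset_image[OF F(1,2)] by blast
    have near: "bnorm \<sigma> (\<lambda>w. T f w - A f w) \<le> \<epsilon> / 4" if "f \<in> ?b" for f
    proof -
      have "bnorm \<sigma> (\<lambda>w. T f w - A f w) \<le> \<epsilon> / 4 * bnorm \<sigma> f" using TA that by blast
      also have "\<dots> \<le> \<epsilon> / 4 * 1" using that \<epsilon> by (intro mult_left_mono) auto
      finally show ?thesis by simp
    qed
    have "T f \<in> (\<Union>x\<in>T ` G. MB.mball x \<epsilon>)" if f: "f \<in> ?b" for f
    proof -
      have "A f \<in> (\<Union>x\<in>F. MB.mball x (\<epsilon> / 4))" by (rule subsetD[OF F(3)]) (rule imageI[OF f])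
      then obtain g where g: "g \<in> G" "A f \<in> MB.mball (A g) (\<epsilon> / 4)" using G(3) by blast
      have gb: "g \<in> ?b" using g(1) G(2) by blast
      have in_B: "T f \<in> B" "T g \<in> B" "A f \<in> B" "A g \<in> B"
        using f gb bop_in[OF T] bop_in[OF bA] by auto
      have "bnorm \<sigma> (\<lambda>w. T g w - T f w) \<le> bnorm \<sigma> (\<lambda>w. T g w - A g w) + bnorm \<sigma> (\<lambda>w. A g w - T f w)"
        by (rule MB.triangle[OF in_B(2,4,1)])
      also have "bnorm \<sigma> (\<lambda>w. A g w - T f w) \<le> bnorm \<sigma> (\<lambda>w. A g w - A f w) + bnorm \<sigma> (\<lambda>w. A f w - T f w)"
        by (rule MB.triangle[OF in_B(4,3,1)])
      also have "bnorm \<sigma> (\<lambda>w. A f w - T f w) = bnorm \<sigma> (\<lambda>w. T f w - A f w)" by (rule bnorm_minus_commute)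
      finally have "bnorm \<sigma> (\<lambda>w. T g w - T f w) < \<epsilon>"
        using near[OF f] near[OF gb] g(2) \<epsilon> by simp
      then show ?thesis using g(1) in_B by (auto intro!: bexI[of _ g])
    qed
    then show "\<exists>K. finite K \<and> K \<subseteq> T ` ?b \<and> T ` ?b \<subseteq> (\<Union>x\<in>K. MB.mball x \<epsilon>)"
      using G(1,2) by (intro exI[of _ "T ` G"]) auto
  qed
  then have seq: "\<And>Y :: nat \<Rightarrow> 'n fn. range Y \<subseteq> T ` ?b \<Longrightarrow> \<exists>r. strict_mono r \<and> MB.MCauchy (Y \<circ> r)"
    unfolding MB.mtotally_bounded_sequentially by blast
  show ?thesis
    unfolding compact_op_def
  proof (intro conjI allI impI T)
    fix X :: "nat \<Rightarrow> 'n fn" assume X: "\<forall>n. X n \<in> B \<and> bnorm \<sigma> (X n) \<le> 1"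
    then have "range (\<lambda>m. T (X m)) \<subseteq> T ` ?b" by auto
    from seq[OF this] obtain r where r: "strict_mono (r :: nat \<Rightarrow> nat)" "MB.MCauchy ((\<lambda>m. T (X m)) \<circ> r)" by blast
    obtain g where "g \<in> B" "(\<lambda>n. bnorm \<sigma> (\<lambda>w. T (X (r n)) w - g w)) \<longlonglongrightarrow> 0"
    proof (rule complete[of "\<lambda>n. T (X (r n))"])
      show "T (X (r n)) \<in> B" for n using X bop_in[OF T] by blast
      show "\<exists>N. \<forall>m\<ge>N. \<forall>n\<ge>N. bnorm \<sigma> (\<lambda>w. T (X (r m)) w - T (X (r n)) w) < e" if "e > 0" for e
        using r(2) that unfolding MB.MCauchy_def by simp
    qed blast
    then show "\<exists>r g. strict_mono r \<and> g \<in> B \<and> (\<lambda>n. bnorm \<sigma> (\<lambda>w. T (X (r n)) w - g w)) \<longlonglongrightarrow> 0"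
      using r(1) by blast
  qed
qed

lemma compact_zero: "cop (\<lambda>f w. 0)"
  unfolding compact_op_def
proof (intro conjI allI impI)
  show "bop (\<lambda>f w. 0)" by (rule bopI[where M = 0]) (auto simp: B_zero)
  fix X :: "nat \<Rightarrow> 'n fn"
  show "\<exists>(r :: nat \<Rightarrow> nat) g. strict_mono r \<and> g \<in> B \<and> (\<lambda>n::nat. bnorm \<sigma> (\<lambda>w. 0 - g w)) \<longlonglongrightarrow> 0"
    by (rule exI[of _ id], rule exI[of _ "\<lambda>_. 0"]) (simp add: strict_mono_def B_zero)
qed

section \<open>Translated operators and the uniform bound on distant balls\<close>

abbreviation "cj \<equiv> conjop \<Omega> \<sigma> \<phi> K"

lemma conjop_eq: "cj T z f = U z (T (adj (U z) f))"
  by (simp add: conjop_def)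

lemma bop_conjop: "bop T \<Longrightarrow> z \<in> \<Omega> \<Longrightarrow> f \<in> B \<Longrightarrow> cj T z f \<in> B"
  unfolding conjop_eq by (intro U_in bop_in[of T] adj_in bop_U)

lemma bnorm_conjop_le:
  assumes T: "bop T" and M: "M \<ge> 0" "\<forall>f\<in>B. bnorm \<sigma> (T f) \<le> M * bnorm \<sigma> f" and z: "z \<in> \<Omega>" and f: "f \<in> B"
  shows "bnorm \<sigma> (cj T z f) \<le> C ^ 4 * M * bnorm \<sigma> f"
proof -
  have a: "adj (U z) f \<in> B" by (rule adj_in[OF bop_U[OF z] f])
  have "bnorm \<sigma> (cj T z f) \<le> C\<^sup>2 * bnorm \<sigma> (T (adj (U z) f))"
    unfolding conjop_eq by (rule bnorm_U[OF z bop_in[OF T a]])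
  also have "\<dots> \<le> C\<^sup>2 * (M * bnorm \<sigma> (adj (U z) f))" using M a by (intro mult_left_mono) auto
  also have "\<dots> \<le> C\<^sup>2 * (M * (C\<^sup>2 * bnorm \<sigma> f))"
    using M by (intro mult_left_mono bnorm_adj_U z f) auto
  also have "\<dots> = C ^ 4 * M * bnorm \<sigma> f" by (simp add: power4_eq_xxxx power2_eq_square mult_ac)
  finally show ?thesis .
qed

text \<open>A limsup taken for each \<open>f\<close> separately must become a bound uniform over
  functions on distant balls. Normalized violators at centres tending to infinity, pulled back by
  the adjoint of \<open>V\<close>, would lie in one relatively compact family; the limsup at a
  single limit function contradicts them. One \<open>C\<^sup>2\<close> normalizes that limit,
  another recovers \<open>T (P g)\<close> from its translate, and the 2 absorbs the approximation
  error.\<close>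

lemma upper_local:
  assumes T: "bop T" and s: "s > 0" and \<rho>: "\<rho> > 0"
    and lim: "\<And>f. f \<in> B \<Longrightarrow> bnorm \<sigma> f \<le> 1 \<Longrightarrow> eventually (\<lambda>z. bnorm \<sigma> (cj T z f) < s) (dinf \<Omega> d)"
  shows "\<exists>R. \<forall>x\<in>\<Omega>. d x 0 > R \<longrightarrow> (\<forall>g\<in>sqint \<sigma>.
        (\<forall>w\<in>\<Omega>. w \<notin> Db x \<rho> \<longrightarrow> g w = 0) \<longrightarrow> bnorm \<sigma> (T (P g)) \<le> 2 * C ^ 4 * s * bnorm \<sigma> g)"
proof (rule ccontr)
  assume "\<not> ?thesis"
  then have "\<forall>m::nat. \<exists>x g. x \<in> \<Omega> \<and> d x 0 > real m \<and> g \<in> sqint \<sigma> \<and>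
      (\<forall>w\<in>\<Omega>. w \<notin> Db x \<rho> \<longrightarrow> g w = 0) \<and> \<not> bnorm \<sigma> (T (P g)) \<le> 2 * C ^ 4 * s * bnorm \<sigma> g"
    by blast
  then obtain x g where x: "\<And>m::nat. x m \<in> \<Omega>" "\<And>m::nat. d (x m) 0 > real m"
    and g: "\<And>m. g m \<in> sqint \<sigma>" and supp: "\<And>m w. w \<in> \<Omega> \<Longrightarrow> w \<notin> Db (x m) \<rho> \<Longrightarrow> g m w = 0"
    and big: "\<And>m. \<not> bnorm \<sigma> (T (P (g m))) \<le> 2 * C ^ 4 * s * bnorm \<sigma> (g m)"
    by metis
  obtain M where M: "M \<ge> 0" "\<forall>f\<in>B. bnorm \<sigma> (T f) \<le> M * bnorm \<sigma> f" using bop_bound[OF T] .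
  have gpos: "bnorm \<sigma> (g m) > 0" for m
  proof (rule ccontr)
    assume "\<not> ?thesis"
    then have g0: "bnorm \<sigma> (g m) = 0" using bnorm_nonneg[of \<sigma> "g m"] by linarith
    then have "bnorm \<sigma> (P (g m)) = 0" using bnorm_P[OF g, of m] bnorm_nonneg[of \<sigma> "P (g m)"] by linarith
    then have "bnorm \<sigma> (T (P (g m))) \<le> 0" using M(2) P_in[OF g, of m] by (metis mult_zero_right)
    then show False using big[of m] g0 by simp
  qed
  define g' where "g' m = (\<lambda>w. complex_of_real (1 / bnorm \<sigma> (g m)) * g m w)" for m
  have g': "g' m \<in> sqint \<sigma>" for m unfolding g'_def by (rule sqint_cmult[OF g])
  have g'1: "bnorm \<sigma> (g' m) = 1" for m unfolding g'_def bnorm_cmult using gpos[of m] by (simp add: norm_divide)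
  have big': "bnorm \<sigma> (T (P (g' m))) > 2 * C ^ 4 * s" for m
  proof -
    have eq: "bnorm \<sigma> (T (P (g' m))) = bnorm \<sigma> (T (P (g m))) / bnorm \<sigma> (g m)"
      unfolding g'_def P_cmult[OF g] bop_cmult[OF T P_in[OF g]] bnorm_cmult
      using gpos[of m] by (simp add: norm_divide)
    show ?thesis
      using big[of m] by (simp only: eq not_le pos_less_divide_eq[OF gpos[of m]])
  qed
  define h where "h m = adj (V (x m)) (P (g' m))" for m
  have h: "h m \<in> B" for m unfolding h_def by (rule adj_in[OF bop_V[OF x(1)] P_in[OF g']])
  have h_le: "bnorm \<sigma> (h m) \<le> C\<^sup>2" for m
  proof -
    have "bnorm \<sigma> (h m) \<le> C\<^sup>2 * bnorm \<sigma> (P (g' m))"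
      unfolding h_def by (rule bnorm_adj_V[OF x(1) P_in[OF g']])
    also have "\<dots> \<le> C\<^sup>2 * 1" using bnorm_P[OF g', of m] g'1[of m] by (intro mult_left_mono) auto
    finally show ?thesis by simp
  qed
  have Th: "bnorm \<sigma> (T (P (g' m))) \<le> C\<^sup>2 * bnorm \<sigma> (cj T (x m) (h m))" for m
  proof -
    \<comment> \<open>\<open>h m\<close> was built so that its adjoint translate is exactly
      \<open>P (g' m)\<close>.\<close>
    have "cj T (x m) (h m) = U (x m) (T (P (g' m)))"
      unfolding conjop_eq h_def by (simp add: adj_U_adj_V[OF x(1) P_in[OF g']])
    then show ?thesis using bnorm_le_U[OF x(1) bop_in[OF T P_in[OF g']]] by simp
  qed
  have cQ: "compact (hm.mcball 0 (C * \<rho>))" by (rule hm.compact_mcball[OF base])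
  have fam: "h m \<in> fam (hm.mcball 0 (C * \<rho>)) (C * bnorm \<sigma> one * (sqrt (C * vol (C * \<rho>) 0) * 1))" for m
    unfolding h_def
  proof (rule adj_V_fam[OF x(1) g'])
    show "g' m w = 0" if "w \<in> \<Omega>" "w \<notin> Db (x m) \<rho>" for w using supp[OF that] by (simp add: g'_def)
  qed (use g'1 \<rho> in auto)
  have M0: "0 \<le> C * bnorm \<sigma> one * (sqrt (C * vol (C * \<rho>) 0) * 1)" using C_ge by (simp add: vol_def)
  obtain r h0 where r: "strict_mono (r :: nat \<Rightarrow> nat)" and h0: "h0 \<in> B"
    and conv: "(\<lambda>m. bnorm \<sigma> (\<lambda>w. h (r m) w - h0 w)) \<longlonglongrightarrow> 0"
    using fam_seq_compact[OF cQ hm.mcball_subset_mspace M0 fam] .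
  have h0_le: "bnorm \<sigma> h0 \<le> C\<^sup>2"
  proof (rule LIMSEQ_le_const)
    show "(\<lambda>m. bnorm \<sigma> (\<lambda>w. h (r m) w - h0 w) + C\<^sup>2) \<longlonglongrightarrow> C\<^sup>2"
      using tendsto_add[OF conv tendsto_const, of "C\<^sup>2"] by simp
    have "bnorm \<sigma> h0 \<le> bnorm \<sigma> (\<lambda>w. h (r m) w - h0 w) + C\<^sup>2" for m
      using bnorm_le_diff[OF B_sqint[OF h0] B_sqint[OF h], of "r m"] h_le[of "r m"]
      by (simp add: bnorm_minus_commute[of \<sigma> h0])
    then show "\<exists>N. \<forall>m\<ge>N. bnorm \<sigma> h0 \<le> bnorm \<sigma> (\<lambda>w. h (r m) w - h0 w) + C\<^sup>2" by blast
  qed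
  define f0 where "f0 = (\<lambda>w. complex_of_real (1 / C\<^sup>2) * h0 w)"
  have f0: "f0 \<in> B" unfolding f0_def by (rule B_cmult[OF h0])
  have "bnorm \<sigma> f0 \<le> 1"
    unfolding f0_def bnorm_cmult using h0_le C_ge by (simp add: norm_divide norm_power field_simps)
  from lim[OF f0 this] obtain R where R: "\<forall>z\<in>\<Omega>. d z 0 > R \<longrightarrow> bnorm \<sigma> (cj T z f0) < s"
    unfolding eventually_dinf by blast
  obtain k :: nat where k: "R < real k" using reals_Archimedean2 by blast
  \<comment> \<open>The tolerance for \<open>h\<close> near its limit: multiplied by
    \<open>C\<^sup>2\<close> and the norm bound of the translated operators it stays below
    \<open>C ^ 4 * s\<close>, half of the violated bound.\<close>
  define b where "b = C ^ 4 * s / (C\<^sup>2 * (C ^ 4 * M) + 1)"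
  have den: "C\<^sup>2 * (C ^ 4 * M) + 1 > 0" using C_ge M by (simp add: add_nonneg_pos)
  have b: "b > 0" unfolding b_def using den s C_ge by simp
  obtain k' where k': "\<forall>m\<ge>k'. bnorm \<sigma> (\<lambda>w. h (r m) w - h0 w) < b"
    using order_tendstoD(2)[OF conv b] unfolding eventually_sequentially by blast
  define m where "m = max k k'"
  have "k \<le> r m" using seq_suble[OF r, of m] by (simp add: m_def)
  then have far: "R < d (x (r m)) 0" using k x(2)[of "r m"] by (simp add: order.strict_trans[OF less_le_trans])
  have hm: "bnorm \<sigma> (\<lambda>w. h (r m) w - h0 w) < b" using k' by (simp add: m_def)
  let ?y = "x (r m)"
  have y: "?y \<in> \<Omega>" by (rule x(1))
  have lin: "cj T ?y h0 = (\<lambda>w. complex_of_real (C\<^sup>2) * cj T ?y f0 w)"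
  proof -
    have h0eq: "h0 = (\<lambda>w. complex_of_real (C\<^sup>2) * f0 w)" using C_ge by (auto simp: f0_def fun_eq_iff)
    have aU: "adj (U ?y) f0 \<in> B" by (rule adj_in[OF bop_U[OF y] f0])
    show ?thesis unfolding conjop_eq
      by (subst h0eq) (simp only: bop_cmult[OF bop_adj[OF bop_U[OF y]] f0] bop_cmult[OF T aU] bop_cmult[OF bop_U[OF y] bop_in[OF T aU]])
  qed
  have "bnorm \<sigma> (cj T ?y h0) \<le> C\<^sup>2 * s"
  proof -
    have "bnorm \<sigma> (cj T ?y f0) \<le> s" using R y far by (simp add: less_imp_le)
    then show ?thesis unfolding lin bnorm_cmult by (simp add: norm_power mult_left_mono)
  qed
  moreover have "bnorm \<sigma> (cj T ?y (h (r m))) \<le> bnorm \<sigma> (cj T ?y (\<lambda>w. h (r m) w - h0 w)) + bnorm \<sigma> (cj T ?y h0)"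
  proof -
    have a: "adj (U ?y) (h (r m)) \<in> B" "adj (U ?y) h0 \<in> B"
      by (rule adj_in[OF bop_U[OF y]], rule h h0)+
    have "cj T ?y (\<lambda>w. h (r m) w - h0 w) = (\<lambda>w. cj T ?y (h (r m)) w - cj T ?y h0 w)"
      unfolding conjop_eq
      by (simp only: bop_diff[OF bop_adj[OF bop_U[OF y]] h h0] bop_diff[OF T a]
          bop_diff[OF bop_U[OF y] bop_in[OF T a(1)] bop_in[OF T a(2)]])
    then show ?thesis
      using bnorm_le_diff[OF B_sqint[OF bop_conjop[OF T y h]] B_sqint[OF bop_conjop[OF T y h0]]] by simp
  qed
  moreover have "bnorm \<sigma> (cj T ?y (\<lambda>w. h (r m) w - h0 w)) \<le> C ^ 4 * M * b"
  proof -
    have "bnorm \<sigma> (cj T ?y (\<lambda>w. h (r m) w - h0 w)) \<le> C ^ 4 * M * bnorm \<sigma> (\<lambda>w. h (r m) w - h0 w)"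
      by (rule bnorm_conjop_le[OF T M y B_diff[OF h h0]])
    also have "\<dots> \<le> C ^ 4 * M * b" using hm M C_ge by (intro mult_left_mono) auto
    finally show ?thesis .
  qed
  ultimately have "bnorm \<sigma> (cj T ?y (h (r m))) \<le> C ^ 4 * M * b + C\<^sup>2 * s" by linarith
  then have "C\<^sup>2 * bnorm \<sigma> (cj T ?y (h (r m))) \<le> C\<^sup>2 * (C ^ 4 * M * b + C\<^sup>2 * s)"
    by (rule mult_left_mono) simp
  then have "bnorm \<sigma> (T (P (g' (r m)))) \<le> C\<^sup>2 * (C ^ 4 * M * b + C\<^sup>2 * s)"
    using Th[of "r m"] by (rule order_trans[rotated])
  also have "\<dots> = C\<^sup>2 * (C ^ 4 * M) * b + C ^ 4 * s"
    by (simp add: distrib_left power4_eq_xxxx power2_eq_square mult_ac)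
  also have "C\<^sup>2 * (C ^ 4 * M) * b \<le> C ^ 4 * s"
  proof -
    have "C\<^sup>2 * (C ^ 4 * M) * b \<le> (C\<^sup>2 * (C ^ 4 * M) + 1) * b" using b by (intro mult_right_mono) auto
    also have "\<dots> = C ^ 4 * s" using den by (simp add: b_def)
    finally show ?thesis .
  qed
  finally show False using big'[of "r m"] by (simp add: mult_ac)
qed

text \<open>\<open>opnorm\<close> is a supremum of reals, so boundedness of the set comes before it
  can be used; functions of norm 0 cannot be normalized and are handled by the bound
  \<open>M\<close>.\<close>

lemma opnorm_bound:
  assumes D: "bop D" and h: "h \<in> B"
  shows "bnorm \<sigma> (D h) \<le> opnorm \<Omega> \<sigma> D * bnorm \<sigma> h"
proof -
  obtain M where M: "M \<ge> 0" "\<forall>f\<in>B. bnorm \<sigma> (D f) \<le> M * bnorm \<sigma> f" using bop_bound[OF D] .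
  have bdd: "bdd_above ((\<lambda>f. bnorm \<sigma> (D f)) ` {f \<in> B. bnorm \<sigma> f \<le> 1})"
  proof (rule bdd_aboveI2)
    fix f assume f: "f \<in> {f \<in> B. bnorm \<sigma> f \<le> 1}"
    then have "bnorm \<sigma> (D f) \<le> M * bnorm \<sigma> f" using M by blast
    also have "\<dots> \<le> M * 1" using f M by (intro mult_left_mono) auto
    finally show "bnorm \<sigma> (D f) \<le> M" by simp
  qed
  show ?thesis
  proof (cases "bnorm \<sigma> h = 0")
    case True
    then show ?thesis using M(2) h by (metis mult_zero_right)
  next
    case False
    then have pos: "bnorm \<sigma> h > 0" using bnorm_nonneg[of \<sigma> h] by linarith
    let ?f = "\<lambda>w. complex_of_real (1 / bnorm \<sigma> h) * h w"
    have "?f \<in> B" by (rule B_cmult[OF h])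
    moreover have "bnorm \<sigma> ?f \<le> 1" unfolding bnorm_cmult using pos by (simp add: norm_divide)
    ultimately have "bnorm \<sigma> (D ?f) \<le> opnorm \<Omega> \<sigma> D"
      unfolding opnorm_def by (intro cSUP_upper bdd) simp
    then show ?thesis
      unfolding bop_cmult[OF D h] bnorm_cmult using pos by (simp add: norm_divide field_simps)
  qed
qed

lemma opnorm_le:
  assumes "\<And>f. f \<in> B \<Longrightarrow> bnorm \<sigma> (D f) \<le> b * bnorm \<sigma> f" "b \<ge> 0"
  shows "opnorm \<Omega> \<sigma> D \<le> b"
  unfolding opnorm_def
proof (rule cSUP_least)
  show "{f \<in> B. bnorm \<sigma> f \<le> 1} \<noteq> {}" using B_zero by force
  fix f assume "f \<in> {f \<in> B. bnorm \<sigma> f \<le> 1}"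
  then have f: "f \<in> B" "bnorm \<sigma> f \<le> 1" by auto
  have "bnorm \<sigma> (D f) \<le> b * bnorm \<sigma> f" by (rule assms(1)[OF f(1)])
  also have "\<dots> \<le> b * 1" using f assms(2) by (intro mult_left_mono) auto
  finally show "bnorm \<sigma> (D f) \<le> b" by simp
qed

lemma bop_minus: "bop T \<Longrightarrow> bop A \<Longrightarrow> bop (\<lambda>f w. T f w - A f w)"
proof -
  assume T: "bop T" and A: "bop A"
  obtain M where M: "M \<ge> 0" "\<forall>f\<in>B. bnorm \<sigma> (T f) \<le> M * bnorm \<sigma> f" using bop_bound[OF T] .
  obtain N where N: "N \<ge> 0" "\<forall>f\<in>B. bnorm \<sigma> (A f) \<le> N * bnorm \<sigma> f" using bop_bound[OF A] .
  show ?thesis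
  proof (rule bopI)
    show "bnorm \<sigma> (\<lambda>w. T f w - A f w) \<le> (M + N) * bnorm \<sigma> f" if f: "f \<in> B" for f
      using bnorm_diff_le[OF B_sqint[OF bop_in[OF T f]] B_sqint[OF bop_in[OF A f]]]
        bspec[OF M(2) f] bspec[OF N(2) f] by (simp add: distrib_right)
  qed (simp_all add: bop_in[OF T] bop_in[OF A] B_diff bop_add[OF T] bop_add[OF A] bop_cmult[OF T] bop_cmult[OF A]
      algebra_simps)
qed

lemma opnorm_nonneg: "bop D \<Longrightarrow> opnorm \<Omega> \<sigma> D \<ge> 0"
  using opnorm_bound[OF _ one_in, of D] bnorm_one_pos order_trans[OF bnorm_nonneg, of \<sigma> "D one"]
  by (metis mult_less_0_iff not_le not_less_iff_gr_or_eq)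

text \<open>The infimum is taken over reals and therefore needs a lower bound, which nonnegativity
  of the operator norms supplies.\<close>

lemma essnorm_le:
  assumes "bop T" "cop A"
  shows "essnorm \<Omega> \<sigma> T \<le> opnorm \<Omega> \<sigma> (\<lambda>f w. T f w - A f w)"
  unfolding essnorm_def
proof (rule cINF_lower)
  show "bdd_below ((\<lambda>A. opnorm \<Omega> \<sigma> (\<lambda>f w. T f w - A f w)) ` {A. cop A})"
    by (rule bdd_belowI2[of _ 0]) (auto intro: opnorm_nonneg bop_minus assms(1) compact_imp_bop)
qed (use assms in simp)

abbreviation "loc_norm T \<equiv> (SUP f\<in>{f\<in>bspace \<Omega> \<sigma>. bnorm \<sigma> f \<le> 1}.
                    Limsup (dinf \<Omega> d) (\<lambda>z. ereal (bnorm \<sigma> (conjop \<Omega> \<sigma> \<phi> K T z f))))"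

text \<open>\<open>T\<close> is split into \<open>T - A\<close> and \<open>A\<close>, and the
  compact part tends to 0 on adjoint translates. \<open>C ^ 4\<close> is the product of the bounds
  for \<open>U z\<close> and its adjoint.\<close>

lemma loc_norm_le_opnorm:
  assumes T: "bop T" and A: "cop A"
  shows "loc_norm T \<le> ereal (C ^ 4 * opnorm \<Omega> \<sigma> (\<lambda>f w. T f w - A f w))"
proof (rule SUP_least)
  fix f assume "f \<in> {f \<in> B. bnorm \<sigma> f \<le> 1}"
  then have f: "f \<in> B" "bnorm \<sigma> f \<le> 1" by auto
  note bA = compact_imp_bop[OF A]
  let ?D = "\<lambda>f w. T f w - A f w"
  have D: "bop ?D" by (rule bop_minus[OF T bA])
  let ?o = "opnorm \<Omega> \<sigma> ?D"
  show "Limsup (dinf \<Omega> d) (\<lambda>z. ereal (bnorm \<sigma> (cj T z f))) \<le> ereal (C ^ 4 * ?o)"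
  proof (rule ereal_le_epsilon2)
    fix e :: real assume e: "e > 0"
    then have e': "e / C\<^sup>2 > 0" using C_ge by simp
    have "eventually (\<lambda>z. ereal (bnorm \<sigma> (cj T z f)) \<le> ereal (C ^ 4 * ?o) + ereal e) (dinf \<Omega> d)"
    proof -
      obtain R where R: "\<forall>z\<in>\<Omega>. d z 0 > R \<longrightarrow> bnorm \<sigma> (A (adj (U z) f)) < e / C\<^sup>2"
        using compact_translates_null[OF A f(1) e'] unfolding eventually_dinf by blast
      show ?thesis unfolding eventually_dinf
      proof (intro exI ballI impI)
        fix z assume z: "z \<in> \<Omega>" "d z 0 > R"
        let ?a = "adj (U z) f"
        have a: "?a \<in> B" by (rule adj_in[OF bop_U[OF z(1)] f(1)])
        have "bnorm \<sigma> (cj T z f) \<le> C\<^sup>2 * bnorm \<sigma> (T ?a)"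
          unfolding conjop_eq by (rule bnorm_U[OF z(1) bop_in[OF T a]])
        also have "\<dots> \<le> C\<^sup>2 * (?o * C\<^sup>2 + e / C\<^sup>2)"
        proof (rule mult_left_mono)
          have "bnorm \<sigma> (T ?a) \<le> bnorm \<sigma> (?D ?a) + bnorm \<sigma> (A ?a)"
            by (rule bnorm_le_diff[OF B_sqint[OF bop_in[OF T a]] B_sqint[OF bop_in[OF bA a]]])
          also have "bnorm \<sigma> (?D ?a) \<le> ?o * bnorm \<sigma> ?a" by (rule opnorm_bound[OF D a])
          also have "?o * bnorm \<sigma> ?a \<le> ?o * C\<^sup>2"
          proof (rule mult_left_mono[OF _ opnorm_nonneg[OF D]])
            have "bnorm \<sigma> ?a \<le> C\<^sup>2 * bnorm \<sigma> f" by (rule bnorm_adj_U[OF z(1) f(1)])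
            also have "\<dots> \<le> C\<^sup>2 * 1" using f(2) by (intro mult_left_mono) auto
            finally show "bnorm \<sigma> ?a \<le> C\<^sup>2" by simp
          qed
          also have "bnorm \<sigma> (A ?a) \<le> e / C\<^sup>2" using R z by (simp add: less_imp_le)
          finally show "bnorm \<sigma> (T ?a) \<le> ?o * C\<^sup>2 + e / C\<^sup>2" by simp
        qed simp
        also have "\<dots> = C ^ 4 * ?o + e"
          using C_ge by (simp add: distrib_left power4_eq_xxxx power2_eq_square)
        finally show "ereal (bnorm \<sigma> (cj T z f)) \<le> ereal (C ^ 4 * ?o) + ereal e" by simp
      qed
    qed
    then show "Limsup (dinf \<Omega> d) (\<lambda>z. ereal (bnorm \<sigma> (cj T z f))) \<le> ereal (C ^ 4 * ?o) + ereal e"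
      by (rule Limsup_bounded)
  qed
qed

lemma loc_norm_nonneg:
  assumes T: "bop T"
  shows "loc_norm T \<ge> 0"
proof -
  have "ereal (bnorm \<sigma> (cj T z (\<lambda>_. 0))) \<ge> 0" for z by simp
  then have "Limsup (dinf \<Omega> d) (\<lambda>z. ereal (bnorm \<sigma> (cj T z (\<lambda>_. 0)))) \<ge> Limsup (dinf \<Omega> d) (\<lambda>z. 0)"
    by (intro Limsup_mono always_eventually) simp
  then have "0 \<le> Limsup (dinf \<Omega> d) (\<lambda>z. ereal (bnorm \<sigma> (cj T z (\<lambda>_. 0))))"
    by (simp add: Limsup_const[OF dinf_neq_bot])
  also have "\<dots> \<le> loc_norm T" by (rule SUP_upper) (simp add: B_zero)
  finally show ?thesis .
qed

text \<open>Comparison with the zero operator, which is compact, makes the supremum finite, so that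
  the two estimates can be carried out in real arithmetic.\<close>

lemma loc_norm_real:
  assumes T: "bop T"
  obtains s where "s \<ge> 0" "loc_norm T = ereal s"
proof (cases "loc_norm T")
  case (real s)
  then show ?thesis using loc_norm_nonneg[OF T] by (intro that[of s]) auto
next
  case PInf
  then show ?thesis using loc_norm_le_opnorm[OF T compact_zero] by simp
next
  case MInf
  then show ?thesis using loc_norm_nonneg[OF T] by simp
qed

lemma essnorm_le_loc_norm:
  assumes T: "admissible p T" and s: "loc_norm T = ereal s" "s \<ge> 0"
  shows "essnorm \<Omega> \<sigma> T \<le> 4 * C ^ 6 * s"
proof (rule field_le_epsilon)
  fix e :: real assume e: "e > 0"
  have bT: "bop T" using T by simp
  \<comment> \<open>\<open>c\<close> is the coefficient of \<open>\<epsilon>\<close> in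
    \<open>2 * C\<^sup>2 * (\<epsilon> + 2 * C ^ 4 * (s + \<epsilon>))\<close>; what remains is
    \<open>4 * C ^ 6 * s\<close>. Working with \<open>s + \<epsilon>\<close> supplies the strict
    positivity that \<open>upper_local\<close> requires even if \<open>s = 0\<close>.\<close>
  define c where "c = 2 * C\<^sup>2 * (1 + 2 * C ^ 4)"
  have c: "c > 0" using C_ge by (simp add: c_def add_pos_nonneg)
  define \<epsilon> where "\<epsilon> = e / c"
  have \<epsilon>: "\<epsilon> > 0" using e c by (simp add: \<epsilon>_def)
  have lim: "eventually (\<lambda>z. bnorm \<sigma> (cj T z f) < s + \<epsilon>) (dinf \<Omega> d)" if "f \<in> B" "bnorm \<sigma> f \<le> 1" for f
  proof -
    have "Limsup (dinf \<Omega> d) (\<lambda>z. ereal (bnorm \<sigma> (cj T z f))) \<le> loc_norm T"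
      using that by (intro SUP_upper) simp
    also have "\<dots> < ereal (s + \<epsilon>)" using s \<epsilon> by simp
    finally have "eventually (\<lambda>z. ereal (bnorm \<sigma> (cj T z f)) < ereal (s + \<epsilon>)) (dinf \<Omega> d)"
      by (rule Limsup_lessD)
    then show ?thesis by simp
  qed
  have s\<epsilon>: "s + \<epsilon> > 0" using s \<epsilon> by simp
  let ?\<eta> = "2 * C ^ 4 * (s + \<epsilon>)"
  have \<eta>: "?\<eta> \<ge> 0" using s\<epsilon> C_ge by simp
  obtain R where R: "R > 0" "\<forall>f\<in>B. bnorm \<sigma> (\<lambda>w. T f w - T (P (cutoff R f)) w) \<le> 2 * C\<^sup>2 * (\<epsilon> + ?\<eta>) * bnorm \<sigma> f"
    using approx_by_cutoff[OF T \<eta> \<epsilon> upper_local[OF bT s\<epsilon> _ lim]] .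
  have "essnorm \<Omega> \<sigma> T \<le> opnorm \<Omega> \<sigma> (\<lambda>f w. T f w - T (P (cutoff R f)) w)"
    by (rule essnorm_le[OF bT compose_cutoff_compact[OF bT R(1)]])
  also have "\<dots> \<le> 2 * C\<^sup>2 * (\<epsilon> + ?\<eta>)" using R(2) \<epsilon> \<eta> by (intro opnorm_le) auto
  also have "\<dots> = 4 * (C\<^sup>2 * C ^ 4) * s + c * \<epsilon>" by (simp add: c_def algebra_simps)
  also have "\<dots> = 4 * C ^ 6 * s + e" using c by (simp add: \<epsilon>_def flip: power_add)
  finally show "essnorm \<Omega> \<sigma> T \<le> 4 * C ^ 6 * s + e" .
qed

lemma loc_norm_le_essnorm:
  assumes T: "bop T" and s: "loc_norm T = ereal s"
  shows "s \<le> C ^ 4 * essnorm \<Omega> \<sigma> T"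
proof -
  have "s / C ^ 4 \<le> essnorm \<Omega> \<sigma> T"
    unfolding essnorm_def
  proof (rule cINF_greatest)
    show "{A. cop A} \<noteq> {}" using compact_zero by blast
    fix A assume "A \<in> {A. cop A}"
    then have "s \<le> C ^ 4 * opnorm \<Omega> \<sigma> (\<lambda>f w. T f w - A f w)"
      using loc_norm_le_opnorm[OF T, of A] s by simp
    then show "s / C ^ 4 \<le> opnorm \<Omega> \<sigma> (\<lambda>f w. T f w - A f w)"
      using C_ge by (simp add: field_simps)
  qed
  then show ?thesis using C_ge by (simp add: field_simps)
qed

text \<open>Here the bound on distant balls comes directly from the kernels through
  \<open>local_bound_of_kernels\<close>, and it can be made arbitrarily small. Thus \<open>T\<close>
  is a norm limit of its compact truncations.\<close>

lemma compact_of_kernels_null: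
  assumes T: "admissible p T" and lim: "((\<lambda>z. bnorm \<sigma> (T (kn \<sigma> K z))) \<longlongrightarrow> 0) (dinf \<Omega> d)"
  shows "cop T"
proof (rule compact_limit)
  show bT: "bop T" using T by simp
  fix \<epsilon> :: real assume \<epsilon>: "\<epsilon> > 0"
  \<comment> \<open>\<open>approx_by_cutoff\<close> is applied with both of its parameters equal to
    \<open>\<epsilon>'\<close>, which yields the error
    \<open>4 * C\<^sup>2 * \<epsilon>'\<close>.\<close>
  define \<epsilon>' where "\<epsilon>' = \<epsilon> / (4 * C\<^sup>2)"
  have \<epsilon>': "\<epsilon>' > 0" using \<epsilon> C_ge by (simp add: \<epsilon>'_def)
  have loc: "\<exists>R. \<forall>x\<in>\<Omega>. d x 0 > R \<longrightarrow> (\<forall>g\<in>sqint \<sigma>.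
        (\<forall>w\<in>\<Omega>. w \<notin> Db x \<rho> \<longrightarrow> g w = 0) \<longrightarrow> bnorm \<sigma> (T (P g)) \<le> \<epsilon>' * bnorm \<sigma> g)" if \<rho>: "\<rho> > 0" for \<rho>
  proof -
    define W where "W = sqrt (C * vol (C * \<rho>) 0)"
    have W: "W \<ge> 0" using C_ge by (simp add: W_def vol_def)
    define s where "s = \<epsilon>' / (W + 1)"
    have s: "s > 0" using \<epsilon>' W by (simp add: s_def)
    have sW: "s * W \<le> \<epsilon>'"
    proof -
      have "s * W \<le> s * (W + 1)" using s by (intro mult_left_mono) auto
      also have "\<dots> = \<epsilon>'" using W by (simp add: s_def)
      finally show ?thesis .
    qed
    obtain R where R: "\<forall>z\<in>\<Omega>. d z 0 > R \<longrightarrow> bnorm \<sigma> (T (kn \<sigma> K z)) < s"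
      using order_tendstoD(2)[OF lim s] unfolding eventually_dinf by blast
    show ?thesis
    proof (intro exI ballI impI)
      \<comment> \<open>A centre beyond \<open>R + \<rho>\<close> keeps the whole ball of radius
        \<open>\<rho>\<close> beyond \<open>R\<close>.\<close>
      fix x g assume x: "x \<in> \<Omega>" "d x 0 > R + \<rho>" and g: "g \<in> sqint \<sigma>" and supp: "\<forall>w\<in>\<Omega>. w \<notin> Db x \<rho> \<longrightarrow> g w = 0"
      have "bnorm \<sigma> (T (P g)) \<le> s * (sqrt (C * vol (C * \<rho>) 0) * bnorm \<sigma> g)"
      proof (rule local_bound_of_kernels[OF bT x(1) g])
        show "bnorm \<sigma> (T (kn \<sigma> K w)) \<le> s" if w: "w \<in> Db x \<rho>" for w
        proof -
          have "w \<in> \<Omega>" "d w 0 > R" using w x hm.triangle[of x w 0] base by auto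
          then show ?thesis using R by (simp add: less_imp_le)
        qed
      qed (use supp s in auto)
      also have "\<dots> = s * W * bnorm \<sigma> g" by (simp add: W_def)
      also have "\<dots> \<le> \<epsilon>' * bnorm \<sigma> g" by (rule mult_right_mono[OF sW]) simp
      finally show "bnorm \<sigma> (T (P g)) \<le> \<epsilon>' * bnorm \<sigma> g" .
    qed
  qed
  obtain R where R: "R > 0" "\<forall>f\<in>B. bnorm \<sigma> (\<lambda>w. T f w - T (P (cutoff R f)) w) \<le> 2 * C\<^sup>2 * (\<epsilon>' + \<epsilon>') * bnorm \<sigma> f"
    using approx_by_cutoff[OF T less_imp_le[OF \<epsilon>'] \<epsilon>' loc] .
  have "2 * C\<^sup>2 * (\<epsilon>' + \<epsilon>') = \<epsilon>" using C_ge by (simp add: \<epsilon>'_def)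
  then show "\<exists>A. cop A \<and> (\<forall>f\<in>B. bnorm \<sigma> (\<lambda>w. T f w - A f w) \<le> \<epsilon> * bnorm \<sigma> f)"
    using compose_cutoff_compact[OF bT R(1)] R(2) by auto
qed

end

theorem theorem4p3:
  fixes \<Omega> :: "('n::finite) pt set" and d :: "'n pt \<Rightarrow> 'n pt \<Rightarrow> real"
    and \<sigma> :: "'n pt measure" and \<phi> :: "'n pt \<Rightarrow> 'n pt \<Rightarrow> 'n pt"
    and K :: "'n pt \<Rightarrow> 'n fn" and \<kappa> :: real
  assumes "bergman_type \<Omega> d \<sigma> \<phi> K \<kappa>"
  shows "(\<exists>C>0. \<forall>(p::real) T. p > (4 - \<kappa>) / (2 - \<kappa>) \<and> bounded_op \<Omega> \<sigma> T \<and>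
            Lp_hyp \<Omega> \<sigma> \<phi> K p T \<and> Lp_hyp \<Omega> \<sigma> \<phi> K p (hadj \<Omega> \<sigma> T) \<longrightarrow>
              ereal (essnorm \<Omega> \<sigma> T) \<le> ereal C *
                 (SUP f\<in>{f\<in>bspace \<Omega> \<sigma>. bnorm \<sigma> f \<le> 1}.
                    Limsup (dinf \<Omega> d) (\<lambda>z. ereal (bnorm \<sigma> (conjop \<Omega> \<sigma> \<phi> K T z f)))) \<and>
              (SUP f\<in>{f\<in>bspace \<Omega> \<sigma>. bnorm \<sigma> f \<le> 1}.
                    Limsup (dinf \<Omega> d) (\<lambda>z. ereal (bnorm \<sigma> (conjop \<Omega> \<sigma> \<phi> K T z f))))
                 \<le> ereal C * ereal (essnorm \<Omega> \<sigma> T)) \<and>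
         (\<forall>(p::real) T. p > (4 - \<kappa>) / (2 - \<kappa>) \<and> bounded_op \<Omega> \<sigma> T \<and>
            Lp_hyp \<Omega> \<sigma> \<phi> K p T \<and> Lp_hyp \<Omega> \<sigma> \<phi> K p (hadj \<Omega> \<sigma> T) \<and>
            ((\<lambda>z. bnorm \<sigma> (T (kn \<sigma> K z))) \<longlongrightarrow> 0) (dinf \<Omega> d) \<longrightarrow>
              compact_op \<Omega> \<sigma> T)"
proof -
  interpret bergman \<Omega> d \<sigma> \<phi> K \<kappa> by unfold_locales (rule assms)
  \<comment> \<open>One constant must serve both inequalities, so the \<open>C ^ 4\<close> of the
    lower estimate is absorbed into \<open>4 * C ^ 6\<close>.\<close>
  have C: "C ^ 4 \<le> 4 * C ^ 6" "4 * C ^ 6 > 0"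
  proof -
    have "C ^ 4 \<le> C ^ 6" using C_ge by (intro power_increasing) auto
    moreover have "C ^ 4 \<ge> 0" "C ^ 6 > 0" using C_ge by auto
    ultimately show "C ^ 4 \<le> 4 * C ^ 6" "4 * C ^ 6 > 0" by linarith+
  qed
  have a: "ereal (essnorm \<Omega> \<sigma> T) \<le> ereal (4 * C ^ 6) * loc_norm T \<and>
      loc_norm T \<le> ereal (4 * C ^ 6) * ereal (essnorm \<Omega> \<sigma> T)" if T: "admissible p T" for p T
  proof -
    have bT: "bop T" using T by simp
    obtain s where s: "s \<ge> 0" "loc_norm T = ereal s" using loc_norm_real[OF bT] .
    have le: "s \<le> C ^ 4 * essnorm \<Omega> \<sigma> T" by (rule loc_norm_le_essnorm[OF bT s(2)])
    have "0 < C ^ 4" using C_ge by simp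
    \<comment> \<open>Nonnegativity of the essential norm is read off from \<open>0 \<le> s\<close>
      and \<open>s \<le> C ^ 4 * essnorm \<Omega> \<sigma> T\<close>; it is what allows
      \<open>C ^ 4\<close> to be enlarged.\<close>
    then have "essnorm \<Omega> \<sigma> T \<ge> 0" using le s(1) by (meson order_trans zero_le_mult_iff less_le_not_le)
    then have "s \<le> 4 * C ^ 6 * essnorm \<Omega> \<sigma> T"
      using le mult_right_mono[OF C(1)] by (meson order_trans)
    then show ?thesis using essnorm_le_loc_norm[OF T s(2,1)] s(2) by simp
  qed
  show ?thesis
  proof (rule conjI)
    show "\<exists>C>0. \<forall>(p::real) T. p > (4 - \<kappa>) / (2 - \<kappa>) \<and> bounded_op \<Omega> \<sigma> T \<and>
            Lp_hyp \<Omega> \<sigma> \<phi> K p T \<and> Lp_hyp \<Omega> \<sigma> \<phi> K p (hadj \<Omega> \<sigma> T) \<longrightarrow>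
              ereal (essnorm \<Omega> \<sigma> T) \<le> ereal C * loc_norm T \<and> loc_norm T \<le> ereal C * ereal (essnorm \<Omega> \<sigma> T)"
      by (rule exI[of _ "4 * C ^ 6"], rule conjI[OF C(2)], intro allI impI, rule a)
  qed (use compact_of_kernels_null in blast)
qed

end
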